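(* Let $p$ be a non-negative integer, let $U$ be a $p\times p$ antisymmetric matrix with integer entries, and let the quantum parameter $\xi\in\mathbb C^\times$ be a root of unity. Let $\Lambda\subset\mathbb Z^p$ be a finitely generated submonoid of $\mathbb Z^p$ of rank $p$ that is primitive in its group completion. Then the monomial subalgebra $\mathbb A(\Lambda)\subset\mathbb T(U;\mathbb C)$ is a maximal order.
   Context: The quantum torus is $\mathbb T(U;\mathbb C)=\mathbb C\langle x_1^{\pm1},\dots,x_p^{\pm1}\rangle/(x_ix_j=\xi^{U_{ij}}x_jx_i)$. A square root $\xi^{1/2}$ is fixed. For $\mathbf k\in\mathbb Z^p$, $X^{\mathbf k}=[\prod_ix_i^{k_i}]$ is the normalized monomial, where for pairwise $\xi$-commuting elements ($y_iy_j=\xi^{C(y_i,y_j)}y_jy_i$) one puts $[y_1\cdots y_n]=\xi^{-\frac12\sum_{i<j}C(y_i,y_j)}y_1\cdots y_n$. The $X^{\mathbf k}$ form a $\mathbb C$-basis of $\mathbb T(U;\mathbb C)$. For a submonoid $\Lambda\subset\mathbb Z^p$, the monomial subalgebra $\mathbb A(\Lambda)$ is the $\mathbb C$-span of $\{X^{\mathbf k}\mid\mathbf k\in\Lambda\}$. The group completion of $\Lambda$ is the subgroup $\underline\Lambda=\{\mathbf k-\mathbf k'\mid\mathbf k,\mathbf k'\in\Lambda\}$; the rank of $\Lambda$ is the rank of $\underline\Lambda$; $\Lambda$ is primitive in $\underline\Lambda$ if whenever $c\mathbf k\in\Lambda$ for some positive integer $c$ and $\mathbf k\in\underline\Lambda$,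 then $\mathbf k\in\Lambda$. Maximal order: let $A$ be an associative algebra that is a domain and is finitely generated as a module over its center $Z$; let $\widetilde Z$ be the field of fractions of $Z$. $A$ is a maximal order if any subring $B$ of $A\otimes_Z\widetilde Z$ with $A\subset B\subset(z^{-1})A$ for some nonzero $z\in Z$ satisfies $B=A$, where $(z^{-1})A=\{z^{-1}a\mid a\in A\}$. *)

theory Defs
  imports
    "HOL-Library.Poly_Mapping"
    "HOL-Algebra.QuotRing"
    "HOL-Algebra.Subrings"
    "HOL-Algebra.Generated_Groups"
    "Jordan_Normal_Form.VS_Connect"
begin

definition monoid_algebra :: "('g, 'm) monoid_scheme \<Rightarrow> ('g \<Rightarrow>\<^sub>0 'r::comm_ring_1) ring" where
  "monoid_algebra G =
    \<lparr>carrier = {f. Poly_Mapping.keys f \<subseteq> carrier G},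
     monoid.mult = (\<lambda>f g. \<Sum>x\<in>Poly_Mapping.keys f. \<Sum>y\<in>Poly_Mapping.keys g.
       Poly_Mapping.single (x \<otimes>\<^bsub>G\<^esub> y) (Poly_Mapping.lookup f x * Poly_Mapping.lookup g y)),
     one = Poly_Mapping.single \<one>\<^bsub>G\<^esub> 1,
     zero = 0,
     add = (+)\<rparr>"

text \<open>The free algebra on the letters \<open>x\<^sub>i\<close> and \<open>x\<^sub>i\<inverse>\<close>, \<open>i < p\<close>, is the monoid algebra of the
  free monoid on these letters.  Indices run from \<open>0\<close> to \<open>p - 1\<close>.\<close>

datatype letter = Pos nat | Neg nat

definition word_monoid :: "nat \<Rightarrow> letter list monoid" where
  "word_monoid p = \<lparr>carrier = lists (Pos ` {..<p} \<union> Neg ` {..<p}), monoid.mult = (@), one = []\<rparr>"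

definition free_algebra :: "nat \<Rightarrow> (letter list \<Rightarrow>\<^sub>0 complex) ring" where
  "free_algebra p = monoid_algebra (word_monoid p)"

abbreviation word :: "complex \<Rightarrow> letter list \<Rightarrow> (letter list \<Rightarrow>\<^sub>0 complex)" where
  "word c w \<equiv> Poly_Mapping.single w c"

text \<open>Each pair \<open>(l, r)\<close> of equal elements contributes the generator \<open>l - r\<close> of the ideal.\<close>

definition torus_relations :: "nat \<Rightarrow> int mat \<Rightarrow> complex \<Rightarrow> (letter list \<Rightarrow>\<^sub>0 complex) set" where
  "torus_relations p U \<xi> =
     {word 1 [Pos i, Neg i] - word 1 [] | i. i < p} \<union>
     {word 1 [Neg i, Pos i] - word 1 [] | i. i < p} \<union>
     {word 1 [Pos i, Pos j] - word (\<xi> powi (U $$ (i, j))) [Pos j, Pos i] | i j. i < p \<and> j < p}"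

definition torus_ideal :: "nat \<Rightarrow> int mat \<Rightarrow> complex \<Rightarrow> (letter list \<Rightarrow>\<^sub>0 complex) set" where
  "torus_ideal p U \<xi> = Idl\<^bsub>free_algebra p\<^esub> (torus_relations p U \<xi>)"

definition quantum_torus :: "nat \<Rightarrow> int mat \<Rightarrow> complex \<Rightarrow> (letter list \<Rightarrow>\<^sub>0 complex) set ring" where
  "quantum_torus p U \<xi> = free_algebra p Quot torus_ideal p U \<xi>"

definition torus_gen :: "nat \<Rightarrow> int mat \<Rightarrow> complex \<Rightarrow> nat \<Rightarrow> (letter list \<Rightarrow>\<^sub>0 complex) set" where
  "torus_gen p U \<xi> i = torus_ideal p U \<xi> +>\<^bsub>free_algebra p\<^esub> word 1 [Pos i]"

text \<open>The image of the scalar \<open>c\<close>; scalar multiplication by \<open>c\<close> is multiplication by it.\<close>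

definition torus_const :: "nat \<Rightarrow> int mat \<Rightarrow> complex \<Rightarrow> complex \<Rightarrow> (letter list \<Rightarrow>\<^sub>0 complex) set" where
  "torus_const p U \<xi> c = torus_ideal p U \<xi> +>\<^bsub>free_algebra p\<^esub> word c []"

text \<open>The normalization \<open>[y\<^sub>0 \<dots> y\<^sub>n\<^sub>-\<^sub>1]\<close> of a product of elements satisfying
  \<open>y\<^sub>i y\<^sub>j = \<xi>\<^bsup>C i j\<^esup> y\<^sub>j y\<^sub>i\<close>, where \<open>s\<close> is the chosen square root of \<open>\<xi>\<close>.\<close>

definition normalized_product ::
  "nat \<Rightarrow> int mat \<Rightarrow> complex \<Rightarrow> complex \<Rightarrow> (nat \<Rightarrow> nat \<Rightarrow> int) \<Rightarrow>
    (letter list \<Rightarrow>\<^sub>0 complex) set list \<Rightarrow> (letter list \<Rightarrow>\<^sub>0 complex) set" where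
  "normalized_product p U \<xi> s C ys =
     torus_const p U \<xi> (s powi (- (\<Sum>j<length ys. \<Sum>i<j. C i j)))
       \<otimes>\<^bsub>quantum_torus p U \<xi>\<^esub> foldr (\<otimes>\<^bsub>quantum_torus p U \<xi>\<^esub>) ys \<one>\<^bsub>quantum_torus p U \<xi>\<^esub>"

text \<open>The relations give \<open>x\<^sub>i\<^bsup>a\<^esup> x\<^sub>j\<^bsup>b\<^esup> = \<xi>\<^bsup>a b U i j\<^esup> x\<^sub>j\<^bsup>b\<^esup> x\<^sub>i\<^bsup>a\<^esup>\<close>, which is the exponent \<open>C\<close> used here.\<close>

definition normalized_monomial ::
  "nat \<Rightarrow> int mat \<Rightarrow> complex \<Rightarrow> complex \<Rightarrow> int vec \<Rightarrow> (letter list \<Rightarrow>\<^sub>0 complex) set" where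
  "normalized_monomial p U \<xi> s k =
     normalized_product p U \<xi> s (\<lambda>i j. k $ i * k $ j * U $$ (i, j))
       (map (\<lambda>i. torus_gen p U \<xi> i [^]\<^bsub>quantum_torus p U \<xi>\<^esub> (k $ i)) [0..<p])"

definition monomial_subalgebra ::
  "nat \<Rightarrow> int mat \<Rightarrow> complex \<Rightarrow> complex \<Rightarrow> int vec set \<Rightarrow> (letter list \<Rightarrow>\<^sub>0 complex) set ring" where
  "monomial_subalgebra p U \<xi> s \<Lambda> = (quantum_torus p U \<xi>)
     \<lparr>carrier := {\<Oplus>\<^bsub>quantum_torus p U \<xi>\<^esub>k\<in>F. torus_const p U \<xi> (c k)
         \<otimes>\<^bsub>quantum_torus p U \<xi>\<^esub> normalized_monomial p U \<xi> s k | F c. finite F \<and> F \<subseteq> \<Lambda>}\<rparr>"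

definition finitely_generated_submonoid :: "('a, 'b) monoid_scheme \<Rightarrow> 'a set \<Rightarrow> bool" where
  "finitely_generated_submonoid G \<Lambda> \<longleftrightarrow>
     (\<exists>S. finite S \<and> S \<subseteq> carrier G \<and> \<Lambda> = (\<lambda>M. submonoid M G) hull S)"

definition group_completion :: "int vec set \<Rightarrow> int vec set" where
  "group_completion \<Lambda> = {k - k' | k k'. k \<in> \<Lambda> \<and> k' \<in> \<Lambda>}"

definition subgroup_rank :: "nat \<Rightarrow> int vec set \<Rightarrow> nat" where
  "subgroup_rank p H =
     Max {card S | S. finite S \<and> S \<subseteq> H \<and>
            \<not> LinearCombinations.module.lin_dep (class_ring :: int ring) (module_vec TYPE(int) p) S}"

definition primitive_submonoid :: "int vec set \<Rightarrow> bool" where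
  "primitive_submonoid \<Lambda> \<longleftrightarrow>
     (\<forall>c::int. c > 0 \<longrightarrow> (\<forall>k\<in>group_completion \<Lambda>. c \<cdot>\<^sub>v k \<in> \<Lambda> \<longrightarrow> k \<in> \<Lambda>))"

definition fraction_rel :: "('a, 'm) ring_scheme \<Rightarrow> (('a \<times> 'a) \<times> ('a \<times> 'a)) set" where
  "fraction_rel R = {((a, s), (b, t)).
     a \<in> carrier R \<and> s \<in> carrier R - {\<zero>\<^bsub>R\<^esub>} \<and> b \<in> carrier R \<and> t \<in> carrier R - {\<zero>\<^bsub>R\<^esub>} \<and>
     a \<otimes>\<^bsub>R\<^esub> t = b \<otimes>\<^bsub>R\<^esub> s}"

definition fraction :: "('a, 'm) ring_scheme \<Rightarrow> 'a \<Rightarrow> 'a \<Rightarrow> ('a \<times> 'a) set" where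
  "fraction R a s = fraction_rel R `` {(a, s)}"

definition fraction_field :: "('a, 'm) ring_scheme \<Rightarrow> ('a \<times> 'a) set ring" where
  "fraction_field R =
    \<lparr>carrier = (carrier R \<times> (carrier R - {\<zero>\<^bsub>R\<^esub>})) // fraction_rel R,
     monoid.mult = (\<lambda>X Y. \<Union>(a, s)\<in>X. \<Union>(b, t)\<in>Y. fraction R (a \<otimes>\<^bsub>R\<^esub> b) (s \<otimes>\<^bsub>R\<^esub> t)),
     one = fraction R \<one>\<^bsub>R\<^esub> \<one>\<^bsub>R\<^esub>,
     zero = fraction R \<zero>\<^bsub>R\<^esub> \<one>\<^bsub>R\<^esub>,
     add = (\<lambda>X Y. \<Union>(a, s)\<in>X. \<Union>(b, t)\<in>Y.
       fraction R (a \<otimes>\<^bsub>R\<^esub> t \<oplus>\<^bsub>R\<^esub> b \<otimes>\<^bsub>R\<^esub> s) (s \<otimes>\<^bsub>R\<^esub> t))\<rparr>"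

text \<open>For a ring \<open>A\<close> containing the commutative ring \<open>Z\<close> in its center and a commutative
  \<open>Z\<close>-algebra \<open>F\<close> with structure map \<open>\<phi>\<close>: the additive group of \<open>\<int>[A \<times> F]\<close> is the free abelian
  group on \<open>A \<times> F\<close>, and its multiplication extends \<open>(a, x) (b, y) = (a b, x y)\<close>.  The subgroup
  generated by the relations is a two-sided ideal, because multiplying a relation by a pair
  gives again a relation.\<close>

abbreviation pair :: "'a \<Rightarrow> 'b \<Rightarrow> ('a \<times> 'b \<Rightarrow>\<^sub>0 int)" where
  "pair a x \<equiv> Poly_Mapping.single (a, x) 1"

definition tensor_relations ::
  "('z, 'k) ring_scheme \<Rightarrow> ('z, 'm) ring_scheme \<Rightarrow> ('b, 'n) ring_scheme \<Rightarrow> ('z \<Rightarrow> 'b) \<Rightarrow>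
    ('z \<times> 'b \<Rightarrow>\<^sub>0 int) set" where
  "tensor_relations Z A F \<phi> =
     {pair (a \<oplus>\<^bsub>A\<^esub> a') x - pair a x - pair a' x
        | a a' x. a \<in> carrier A \<and> a' \<in> carrier A \<and> x \<in> carrier F} \<union>
     {pair a (x \<oplus>\<^bsub>F\<^esub> x') - pair a x - pair a x'
        | a x x'. a \<in> carrier A \<and> x \<in> carrier F \<and> x' \<in> carrier F} \<union>
     {pair (a \<otimes>\<^bsub>A\<^esub> z) x - pair a (\<phi> z \<otimes>\<^bsub>F\<^esub> x)
        | a z x. a \<in> carrier A \<and> z \<in> carrier Z \<and> x \<in> carrier F}"

definition tensor_subgroup ::
  "('z, 'k) ring_scheme \<Rightarrow> ('z, 'm) ring_scheme \<Rightarrow> ('b, 'n) ring_scheme \<Rightarrow> ('z \<Rightarrow> 'b) \<Rightarrow>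
    ('z \<times> 'b \<Rightarrow>\<^sub>0 int) set" where
  "tensor_subgroup Z A F \<phi> =
     generate (add_monoid (monoid_algebra (A \<times>\<times> F))) (tensor_relations Z A F \<phi>)"

definition tensor_product ::
  "('z, 'k) ring_scheme \<Rightarrow> ('z, 'm) ring_scheme \<Rightarrow> ('b, 'n) ring_scheme \<Rightarrow> ('z \<Rightarrow> 'b) \<Rightarrow>
    ('z \<times> 'b \<Rightarrow>\<^sub>0 int) set ring" where
  "tensor_product Z A F \<phi> = monoid_algebra (A \<times>\<times> F) Quot tensor_subgroup Z A F \<phi>"

definition pure_tensor ::
  "('z, 'k) ring_scheme \<Rightarrow> ('z, 'm) ring_scheme \<Rightarrow> ('b, 'n) ring_scheme \<Rightarrow> ('z \<Rightarrow> 'b) \<Rightarrow>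
    'z \<Rightarrow> 'b \<Rightarrow> ('z \<times> 'b \<Rightarrow>\<^sub>0 int) set" where
  "pure_tensor Z A F \<phi> a x = tensor_subgroup Z A F \<phi> +>\<^bsub>monoid_algebra (A \<times>\<times> F)\<^esub> pair a x"

definition center :: "('a, 'm) ring_scheme \<Rightarrow> ('a, 'm) ring_scheme" where
  "center A = A\<lparr>carrier := {z \<in> carrier A. \<forall>a\<in>carrier A. z \<otimes>\<^bsub>A\<^esub> a = a \<otimes>\<^bsub>A\<^esub> z}\<rparr>"

text \<open>The library's \<open>domain\<close> is commutative.\<close>

definition noncomm_domain :: "('a, 'm) ring_scheme \<Rightarrow> bool" where
  "noncomm_domain A \<longleftrightarrow> ring A \<and> \<one>\<^bsub>A\<^esub> \<noteq> \<zero>\<^bsub>A\<^esub> \<and>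
     (\<forall>a\<in>carrier A. \<forall>b\<in>carrier A. a \<otimes>\<^bsub>A\<^esub> b = \<zero>\<^bsub>A\<^esub> \<longrightarrow> a = \<zero>\<^bsub>A\<^esub> \<or> b = \<zero>\<^bsub>A\<^esub>)"

definition finite_over_center :: "('a, 'm) ring_scheme \<Rightarrow> bool" where
  "finite_over_center A \<longleftrightarrow>
     (\<exists>S. finite S \<and> S \<subseteq> carrier A \<and>
        (\<forall>a\<in>carrier A. \<exists>c\<in>S \<rightarrow> carrier (center A). a = (\<Oplus>\<^bsub>A\<^esub>s\<in>S. c s \<otimes>\<^bsub>A\<^esub> s)))"

definition center_fraction :: "('a, 'm) ring_scheme \<Rightarrow> 'a \<Rightarrow> 'a \<Rightarrow> ('a \<times> 'a) set" where
  "center_fraction A = fraction (center A)"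

text \<open>\<open>A \<otimes>\<^sub>Z Z'\<close>, where \<open>Z\<close> is the center of \<open>A\<close> and \<open>Z'\<close> the field of fractions of \<open>Z\<close>.\<close>

definition central_quotient_ring ::
  "('a, 'm) ring_scheme \<Rightarrow> ('a \<times> ('a \<times> 'a) set \<Rightarrow>\<^sub>0 int) set ring" where
  "central_quotient_ring A =
     tensor_product (center A) A (fraction_field (center A)) (\<lambda>z. center_fraction A z \<one>\<^bsub>A\<^esub>)"

definition central_tensor ::
  "('a, 'm) ring_scheme \<Rightarrow> 'a \<Rightarrow> ('a \<times> 'a) set \<Rightarrow> ('a \<times> ('a \<times> 'a) set \<Rightarrow>\<^sub>0 int) set" where
  "central_tensor A =
     pure_tensor (center A) A (fraction_field (center A)) (\<lambda>z. center_fraction A z \<one>\<^bsub>A\<^esub>)"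

text \<open>\<open>A\<close> is regarded as a subring of \<open>A \<otimes>\<^sub>Z Z'\<close> through \<open>a \<mapsto> a \<otimes> 1\<close>, and \<open>z\<inverse>\<close> is \<open>1 \<otimes> 1/z\<close>.\<close>

definition embedded_order ::
  "('a, 'm) ring_scheme \<Rightarrow> ('a \<times> ('a \<times> 'a) set \<Rightarrow>\<^sub>0 int) set set" where
  "embedded_order A = (\<lambda>a. central_tensor A a \<one>\<^bsub>fraction_field (center A)\<^esub>) ` carrier A"

definition inverse_multiple ::
  "('a, 'm) ring_scheme \<Rightarrow> 'a \<Rightarrow> ('a \<times> ('a \<times> 'a) set \<Rightarrow>\<^sub>0 int) set set" where
  "inverse_multiple A z =
     (\<lambda>a. central_tensor A \<one>\<^bsub>A\<^esub> (center_fraction A \<one>\<^bsub>A\<^esub> z) \<otimes>\<^bsub>central_quotient_ring A\<^esub> a)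
       ` embedded_order A"

definition maximal_order :: "('a, 'm) ring_scheme \<Rightarrow> bool" where
  "maximal_order A \<longleftrightarrow> noncomm_domain A \<and> finite_over_center A \<and>
     (\<forall>B. \<forall>z\<in>carrier (center A) - {\<zero>\<^bsub>A\<^esub>}.
        subring B (central_quotient_ring A) \<and> embedded_order A \<subseteq> B \<and> B \<subseteq> inverse_multiple A z
          \<longrightarrow> B = embedded_order A)"

end

theory Submission
  imports Defs
begin

text \<open>The quantum torus is the group algebra of \<open>\<int>\<^sup>p\<close> twisted by a cocycle: if \<open>\<omega>(k, l) = \<Sum> U\<^sub>i\<^sub>j k\<^sub>i l\<^sub>j\<close>, then
\<open>X\<^sup>k X\<^sup>l = s\<^bsup>\<omega>(k, l)\<^esup> X\<^bsup>k + l\<^esup>\<close>.  The exponents carry many translation invariant total orders, and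
for each of them the leading exponent of a product is the sum of the leading exponents.  All of the
argument for maximality takes place in these leading exponents.

Let \<open>A \<subseteq> B \<subseteq> z\<inverse> A\<close> with \<open>A\<close> the monomial subalgebra of \<open>\<Lambda>\<close>, and let \<open>b = z\<inverse> a\<close> be a nonzero element of \<open>B\<close>.  Every power
of \<open>b\<close> lies in \<open>z\<inverse> A\<close>, so \<open>a\<^sup>n z = w\<^sub>n z\<^sup>n\<close> with \<open>w\<^sub>n \<in> A\<close>.  Write \<open>t\<close> for the leading exponent of \<open>a\<close>
minus that of \<open>z\<close>.  Comparing leading exponents shows that \<open>w\<^sub>n\<close> has the leading exponent
\<open>top z + n t\<close>, and these all lie in \<open>\<Lambda>\<close>.  As \<open>\<Lambda>\<close> is finitely generated, Dickson's lemma finds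
\<open>m < n\<close> for which \<open>(n - m) t\<close> is in \<open>\<Lambda>\<close>, and then \<open>t \<in> \<Lambda>\<close> by primitivity
(\<open>direction_of_ray_in_primitive_monoid\<close>).  So \<open>X\<^sup>t \<in> A \<subseteq> B\<close>, and subtracting a multiple of \<open>X\<^sup>t\<close> from \<open>b\<close>
gives an element \<open>z\<inverse> a'\<close> of \<open>B\<close> where \<open>a'\<close> has a smaller leading exponent than \<open>a\<close>.

This division must stop.  Use the orders that first compare plus or minus one coordinate: the same
equation \<open>a\<^sup>n z = w\<^sub>n z\<^sup>n\<close>, for large \<open>n\<close>, shows that in each of these directions \<open>t\<close> plus the maximum over \<open>z\<close>
is at most the maximum over \<open>a\<close>.  Hence the exponents of \<open>a'\<close> stay in any box that contains those of
\<open>a\<close>, and a box has finitely many points.  In the end \<open>a \<in> A z\<close>, which says \<open>b \<in> A\<close>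
(\<open>torus_division\<close>).

Around this core there are three further tasks.  To read equations in \<open>A \<otimes>\<^sub>Z Z'\<close> back as equations
in \<open>A\<close>, one multiplies by a common denominator; this is an additive map on formal sums of pairs which kills
the defining relations (\<open>cleared_vanishes\<close>, \<open>tensor_eq_imp\<close>), and it leads to
\<open>maximal_order_criterion\<close>.  To identify the quotient of the free algebra with the twisted group
algebra, one shows that two words of the same degree are proportional modulo the relations
(\<open>proportional_if_same_degree\<close>, \<open>kernel_evaluate\<close>).  Finally, \<open>A\<close> is finite over its center because
for \<open>\<xi>\<^sup>N = 1\<close> the monomials with exponent in \<open>N \<Lambda>\<close> are central (\<open>finite_over_center_W\<Lambda>\<close>).\<close>

section \<open>Algebras of monoids twisted by a cocycle\<close>

text \<open>The coefficient \<open>\<sigma> x y\<close> multiplies the product of the monomials \<open>x\<close> and \<open>y\<close>; for a constant \<open>\<sigma> = 1\<close> this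
is the monoid algebra, so that the free algebra and the quantum torus are handled together.\<close>

definition twisted_algebra ::
  "('g, 'm) monoid_scheme \<Rightarrow> ('g \<Rightarrow> 'g \<Rightarrow> 'r) \<Rightarrow> ('g \<Rightarrow>\<^sub>0 'r::comm_ring_1) ring" where
  "twisted_algebra G \<sigma> =
    \<lparr>carrier = {f. Poly_Mapping.keys f \<subseteq> carrier G},
     monoid.mult = (\<lambda>f g. \<Sum>x\<in>Poly_Mapping.keys f. \<Sum>y\<in>Poly_Mapping.keys g.
       Poly_Mapping.single (x \<otimes>\<^bsub>G\<^esub> y)
         (\<sigma> x y * (Poly_Mapping.lookup f x * Poly_Mapping.lookup g y))),
     one = Poly_Mapping.single \<one>\<^bsub>G\<^esub> 1,
     zero = 0,
     add = (+)\<rparr>"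

lemma monoid_algebra_is_twisted: "monoid_algebra G = twisted_algebra G (\<lambda>_ _. 1)"
  by (simp add: monoid_algebra_def twisted_algebra_def)

lemma twisted_algebra_simps [simp]:
  "carrier (twisted_algebra G \<sigma>) = {f. Poly_Mapping.keys f \<subseteq> carrier G}"
  "\<one>\<^bsub>twisted_algebra G \<sigma>\<^esub> = Poly_Mapping.single \<one>\<^bsub>G\<^esub> 1"
  "\<zero>\<^bsub>twisted_algebra G \<sigma>\<^esub> = 0"
  "f \<oplus>\<^bsub>twisted_algebra G \<sigma>\<^esub> g = f + g"
  by (simp_all add: twisted_algebra_def)

lemma keys_uminus: "Poly_Mapping.keys (- f :: 'g \<Rightarrow>\<^sub>0 'r::ab_group_add) = Poly_Mapping.keys f"
  by (auto simp: in_keys_iff)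

lemma keys_minus_subset:
  "Poly_Mapping.keys (f - g :: 'g \<Rightarrow>\<^sub>0 'r::ab_group_add) \<subseteq> Poly_Mapping.keys f \<union> Poly_Mapping.keys g"
  by (auto simp: in_keys_iff lookup_minus)

lemma keys_sum_subset:
  "Poly_Mapping.keys (\<Sum>i\<in>I. h i :: 'g \<Rightarrow>\<^sub>0 'r::comm_monoid_add) \<subseteq> (\<Union>i\<in>I. Poly_Mapping.keys (h i))"
proof (induction I rule: infinite_finite_induct)
  case (insert i I)
  then show ?case using keys_add[of "h i" "sum h I"] by auto
qed auto

lemma keys_sum_subsetI:
  fixes h :: "'i \<Rightarrow> 'g \<Rightarrow>\<^sub>0 'r::comm_monoid_add"
  assumes "\<And>i. i \<in> I \<Longrightarrow> Poly_Mapping.keys (h i) \<subseteq> K"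
  shows "Poly_Mapping.keys (\<Sum>i\<in>I. h i) \<subseteq> K"
  using assms by (intro order_trans[OF keys_sum_subset] UN_least)

lemma sum_single_lookup:
  fixes f :: "'g \<Rightarrow>\<^sub>0 'r::comm_monoid_add"
  assumes "finite K" and "Poly_Mapping.keys f \<subseteq> K"
  shows "(\<Sum>k\<in>K. Poly_Mapping.single k (Poly_Mapping.lookup f k)) = f"
proof (rule poly_mapping_eqI)
  fix k
  have "Poly_Mapping.lookup (\<Sum>k\<in>K. Poly_Mapping.single k (Poly_Mapping.lookup f k)) k
      = (\<Sum>k'\<in>K. if k' = k then Poly_Mapping.lookup f k' else 0)"
    by (simp add: lookup_sum lookup_single when_def)
  also have "\<dots> = Poly_Mapping.lookup f k"
    using assms by (auto simp: sum.delta in_keys_iff)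
  finally show "Poly_Mapping.lookup (\<Sum>k\<in>K. Poly_Mapping.single k (Poly_Mapping.lookup f k)) k
      = Poly_Mapping.lookup f k" .
qed

text \<open>Identities that are additive in \<open>f\<close> need to be checked on monomials only.\<close>

lemma poly_mapping_additive_induct [consumes 1, case_names single add]:
  fixes f :: "'g \<Rightarrow>\<^sub>0 'r::comm_monoid_add"
  assumes "Poly_Mapping.keys f \<subseteq> K"
    and single: "\<And>k c. k \<in> K \<Longrightarrow> P (Poly_Mapping.single k c)"
    and add: "\<And>f g. \<lbrakk>Poly_Mapping.keys f \<subseteq> K; Poly_Mapping.keys g \<subseteq> K; P f; P g\<rbrakk> \<Longrightarrow> P (f + g)"
    and "K \<noteq> {}"
  shows "P f"
proof -
  obtain k0 where "k0 \<in> K" using \<open>K \<noteq> {}\<close> by blast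
  have P0: "P 0" using single[OF \<open>k0 \<in> K\<close>, of 0] by simp
  have "P (\<Sum>k\<in>F. Poly_Mapping.single k (Poly_Mapping.lookup f k))" if "finite F" "F \<subseteq> K" for F
    using that
  proof (induction F)
    case (insert k F)
    have "Poly_Mapping.keys (\<Sum>k\<in>F. Poly_Mapping.single k (Poly_Mapping.lookup f k)) \<subseteq> K"
      using insert.prems by (intro keys_sum_subsetI) auto
    then show ?case using insert by (auto intro!: add single split: if_splits)
  qed (simp add: P0)
  from this[of "Poly_Mapping.keys f"] show ?thesis
    using assms(1) by (simp add: sum_single_lookup)
qed

lemma twisted_mult_superset:
  assumes "finite X" "Poly_Mapping.keys f \<subseteq> X" "finite Y" "Poly_Mapping.keys g \<subseteq> Y"
  shows "f \<otimes>\<^bsub>twisted_algebra G \<sigma>\<^esub> g = (\<Sum>x\<in>X. \<Sum>y\<in>Y.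
       Poly_Mapping.single (x \<otimes>\<^bsub>G\<^esub> y)
         (\<sigma> x y * (Poly_Mapping.lookup f x * Poly_Mapping.lookup g y)))"
proof -
  let ?m = "\<lambda>x y. Poly_Mapping.single (x \<otimes>\<^bsub>G\<^esub> y)
         (\<sigma> x y * (Poly_Mapping.lookup f x * Poly_Mapping.lookup g y))"
  have "f \<otimes>\<^bsub>twisted_algebra G \<sigma>\<^esub> g = (\<Sum>x\<in>Poly_Mapping.keys f. \<Sum>y\<in>Poly_Mapping.keys g. ?m x y)"
    by (simp add: twisted_algebra_def)
  also have "\<dots> = (\<Sum>x\<in>Poly_Mapping.keys f. \<Sum>y\<in>Y. ?m x y)"
    using assms by (intro sum.cong sum.mono_neutral_left) (auto simp: in_keys_iff)
  also have "\<dots> = (\<Sum>x\<in>X. \<Sum>y\<in>Y. ?m x y)"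
    using assms by (intro sum.mono_neutral_left) (auto simp: in_keys_iff)
  finally show ?thesis .
qed

lemma twisted_mult_single:
  "Poly_Mapping.single x a \<otimes>\<^bsub>twisted_algebra G \<sigma>\<^esub> Poly_Mapping.single y b
    = Poly_Mapping.single (x \<otimes>\<^bsub>G\<^esub> y) (\<sigma> x y * (a * b))"
  by (subst twisted_mult_superset[of "{x}" _ "{y}"]) auto

lemma twisted_mult_add_left:
  "(f + f') \<otimes>\<^bsub>twisted_algebra G \<sigma>\<^esub> g
    = f \<otimes>\<^bsub>twisted_algebra G \<sigma>\<^esub> g + f' \<otimes>\<^bsub>twisted_algebra G \<sigma>\<^esub> g"
proof -
  let ?X = "Poly_Mapping.keys f \<union> Poly_Mapping.keys f'" and ?Y = "Poly_Mapping.keys g"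
  have "Poly_Mapping.keys (f + f') \<subseteq> ?X" by (rule keys_add)
  then show ?thesis
    by (simp add: twisted_mult_superset[of ?X _ ?Y] lookup_add distrib_left distrib_right
        single_add sum.distrib)
qed

lemma twisted_mult_add_right:
  "f \<otimes>\<^bsub>twisted_algebra G \<sigma>\<^esub> (g + g')
    = f \<otimes>\<^bsub>twisted_algebra G \<sigma>\<^esub> g + f \<otimes>\<^bsub>twisted_algebra G \<sigma>\<^esub> g'"
proof -
  let ?Y = "Poly_Mapping.keys g \<union> Poly_Mapping.keys g'" and ?X = "Poly_Mapping.keys f"
  have "Poly_Mapping.keys (g + g') \<subseteq> ?Y" by (rule keys_add)
  then show ?thesis
    by (simp add: twisted_mult_superset[of ?X _ ?Y] lookup_add distrib_left
        single_add sum.distrib)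
qed

lemma keys_twisted_mult:
  "Poly_Mapping.keys (f \<otimes>\<^bsub>twisted_algebra G \<sigma>\<^esub> g)
    \<subseteq> {x \<otimes>\<^bsub>G\<^esub> y | x y. x \<in> Poly_Mapping.keys f \<and> y \<in> Poly_Mapping.keys g}"
proof -
  have "Poly_Mapping.keys (f \<otimes>\<^bsub>twisted_algebra G \<sigma>\<^esub> g)
      \<subseteq> (\<Union>x\<in>Poly_Mapping.keys f. \<Union>y\<in>Poly_Mapping.keys g. Poly_Mapping.keys
       (Poly_Mapping.single (x \<otimes>\<^bsub>G\<^esub> y)
         (\<sigma> x y * (Poly_Mapping.lookup f x * Poly_Mapping.lookup g y))))"
    unfolding twisted_algebra_def monoid.select_convs
    by (intro order_trans[OF keys_sum_subset] UN_mono order_refl)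
  also have "\<dots> \<subseteq> {x \<otimes>\<^bsub>G\<^esub> y | x y. x \<in> Poly_Mapping.keys f \<and> y \<in> Poly_Mapping.keys g}"
    by (auto split: if_splits)
  finally show ?thesis .
qed

text \<open>The cocycle identity is associativity of the product of three monomials.\<close>

locale twisted_monoid = monoid G for G :: "('g, 'm) monoid_scheme" (structure) +
  fixes \<sigma> :: "'g \<Rightarrow> 'g \<Rightarrow> 'r::comm_ring_1"
  assumes cocycle: "\<lbrakk>x \<in> carrier G; y \<in> carrier G; z \<in> carrier G\<rbrakk>
      \<Longrightarrow> \<sigma> x y * \<sigma> (x \<otimes> y) z = \<sigma> y z * \<sigma> x (y \<otimes> z)"
    and cocycle_one: "x \<in> carrier G \<Longrightarrow> \<sigma> \<one> x = 1" "x \<in> carrier G \<Longrightarrow> \<sigma> x \<one> = 1"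
begin

abbreviation "W \<equiv> twisted_algebra G \<sigma>"

lemma carrier_not_empty: "carrier G \<noteq> {}" using one_closed by blast

lemmas element_induct = poly_mapping_additive_induct
  [OF _ _ _ carrier_not_empty, consumes 1, case_names single add]

lemma twisted_mult_closed:
  assumes "f \<in> carrier W" "g \<in> carrier W"
  shows "f \<otimes>\<^bsub>W\<^esub> g \<in> carrier W"
  using keys_twisted_mult[of G \<sigma> f g] assms by fastforce

lemma twisted_mult_assoc:
  assumes "f \<in> carrier W" "g \<in> carrier W" "h \<in> carrier W"
  shows "(f \<otimes>\<^bsub>W\<^esub> g) \<otimes>\<^bsub>W\<^esub> h = f \<otimes>\<^bsub>W\<^esub> (g \<otimes>\<^bsub>W\<^esub> h)"
proof -
  have singles: "(Poly_Mapping.single x a \<otimes>\<^bsub>W\<^esub> Poly_Mapping.single y b) \<otimes>\<^bsub>W\<^esub> Poly_Mapping.single z c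
      = Poly_Mapping.single x a \<otimes>\<^bsub>W\<^esub> (Poly_Mapping.single y b \<otimes>\<^bsub>W\<^esub> Poly_Mapping.single z c)"
    if "x \<in> carrier G" "y \<in> carrier G" "z \<in> carrier G" for x y z a b c
  proof -
    have "\<sigma> (x \<otimes> y) z * (\<sigma> x y * (a * b) * c) = (\<sigma> x y * \<sigma> (x \<otimes> y) z) * (a * b * c)"
      by (simp add: ac_simps)
    also have "\<dots> = \<sigma> x (y \<otimes> z) * (a * (\<sigma> y z * (b * c)))"
      using that by (simp add: cocycle ac_simps)
    finally show ?thesis using that by (simp add: twisted_mult_single m_assoc)
  qed
  have f: "Poly_Mapping.keys f \<subseteq> carrier G" and g: "Poly_Mapping.keys g \<subseteq> carrier G"
    and h: "Poly_Mapping.keys h \<subseteq> carrier G" using assms by auto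
  from f show ?thesis
  proof (induction f rule: element_induct)
    case f: (single x a)
    from g show ?case
    proof (induction g rule: element_induct)
      case g: (single y b)
      from h show ?case
      proof (induction h rule: element_induct)
        case (single z c)
        then show ?case using singles f g by blast
      qed (simp add: twisted_mult_add_right)
    qed (simp add: twisted_mult_add_left twisted_mult_add_right)
  qed (simp add: twisted_mult_add_left)
qed

lemma twisted_mult_one:
  assumes "f \<in> carrier W"
  shows "\<one>\<^bsub>W\<^esub> \<otimes>\<^bsub>W\<^esub> f = f" "f \<otimes>\<^bsub>W\<^esub> \<one>\<^bsub>W\<^esub> = f"
proof -
  have f: "Poly_Mapping.keys f \<subseteq> carrier G" using assms by auto
  from f show "\<one>\<^bsub>W\<^esub> \<otimes>\<^bsub>W\<^esub> f = f"
    by (induction f rule: element_induct) (simp_all add: twisted_mult_single twisted_mult_add_right cocycle_one)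
  from f show "f \<otimes>\<^bsub>W\<^esub> \<one>\<^bsub>W\<^esub> = f"
    by (induction f rule: element_induct) (simp_all add: twisted_mult_single twisted_mult_add_left cocycle_one)
qed

lemma twisted_algebra_ring: "ring W"
proof (rule ringI)
  show "abelian_group W"
  proof (rule abelian_groupI)
    fix f g assume "f \<in> carrier W" "g \<in> carrier W"
    then show "f \<oplus>\<^bsub>W\<^esub> g \<in> carrier W" using keys_add[of f g] by auto
  next
    fix f assume "f \<in> carrier W"
    then show "\<exists>g\<in>carrier W. g \<oplus>\<^bsub>W\<^esub> f = \<zero>\<^bsub>W\<^esub>"
      by (intro bexI[of _ "- f"]) (auto simp: keys_uminus)
  qed (auto simp: ac_simps)
  show "monoid W"
    by (rule monoidI) (simp_all only: twisted_mult_closed twisted_mult_assoc twisted_mult_one, simp)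
qed (auto simp: twisted_mult_add_left twisted_mult_add_right)

sublocale twisted: ring W by (rule twisted_algebra_ring)

lemma twisted_a_inv: "f \<in> carrier W \<Longrightarrow> \<ominus>\<^bsub>W\<^esub> f = - f"
  by (rule twisted.minus_equality) (auto simp: keys_uminus)

lemma twisted_a_minus: "f \<in> carrier W \<Longrightarrow> g \<in> carrier W \<Longrightarrow> f \<ominus>\<^bsub>W\<^esub> g = f - g"
  by (simp add: a_minus_def twisted_a_inv)

lemma twisted_finsum:
  assumes "h \<in> F \<rightarrow> carrier W"
  shows "finsum W h F = (\<Sum>i\<in>F. h i)"
  using assms
proof (induction F rule: infinite_finite_induct)
  case (insert i F)
  then have "h \<in> F \<rightarrow> carrier W" by blast
  then show ?case using insert
    by (subst twisted.finsum_insert) (auto simp: Pi_iff)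
next
  case empty
  show ?case by (simp only: twisted.finsum_empty twisted_algebra_simps sum.empty)
next
  case (infinite F)
  then show ?case by (simp add: finsum_def finprod_def)
qed

end

lemma monoid_algebra_twisted_monoid:
  "monoid G \<Longrightarrow> twisted_monoid G (\<lambda>_ _. 1 :: 'r::comm_ring_1)"
  by (simp add: twisted_monoid_def twisted_monoid_axioms_def)

definition monomial_substitution ::
  "('g \<Rightarrow> 'h) \<Rightarrow> ('g \<Rightarrow> 'r) \<Rightarrow> ('g \<Rightarrow>\<^sub>0 'r) \<Rightarrow> ('h \<Rightarrow>\<^sub>0 'r::comm_ring_1)" where
  "monomial_substitution d c f =
     (\<Sum>x\<in>Poly_Mapping.keys f. Poly_Mapping.single (d x) (Poly_Mapping.lookup f x * c x))"

lemma monomial_substitution_superset: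
  assumes "finite X" "Poly_Mapping.keys f \<subseteq> X"
  shows "monomial_substitution d c f =
     (\<Sum>x\<in>X. Poly_Mapping.single (d x) (Poly_Mapping.lookup f x * c x))"
  unfolding monomial_substitution_def
  using assms by (intro sum.mono_neutral_left) (auto simp: in_keys_iff)

lemma monomial_substitution_single:
  "monomial_substitution d c (Poly_Mapping.single x a) = Poly_Mapping.single (d x) (a * c x)"
  by (subst monomial_substitution_superset[of "{x}"]) auto

lemma monomial_substitution_add:
  "monomial_substitution d c (f + g) = monomial_substitution d c f + monomial_substitution d c g"
proof -
  let ?X = "Poly_Mapping.keys f \<union> Poly_Mapping.keys g"
  have "Poly_Mapping.keys (f + g) \<subseteq> ?X" by (rule keys_add)
  then show ?thesis
    by (simp add: monomial_substitution_superset[of ?X] lookup_add distrib_right single_add sum.distrib)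
qed

text \<open>The condition on \<open>c\<close> says that \<open>x \<mapsto> c x \<cdot> X\<^bsup>d x\<^esup>\<close> is multiplicative, and a multiplicative map on
the monoid extends uniquely to its algebra.\<close>

lemma monomial_substitution_hom:
  fixes c :: "'g \<Rightarrow> 'r::comm_ring_1"
  assumes G: "monoid G" and H: "twisted_monoid H \<sigma>"
    and d: "d \<in> hom G H" "d \<one>\<^bsub>G\<^esub> = \<one>\<^bsub>H\<^esub>"
    and c: "\<And>x y. \<lbrakk>x \<in> carrier G; y \<in> carrier G\<rbrakk> \<Longrightarrow> c (x \<otimes>\<^bsub>G\<^esub> y) = c x * c y * \<sigma> (d x) (d y)"
      "c \<one>\<^bsub>G\<^esub> = 1"
  shows "monomial_substitution d c \<in> Ring.ring_hom (monoid_algebra G) (twisted_algebra H \<sigma>)"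
proof -
  interpret G: twisted_monoid G "\<lambda>_ _. 1 :: 'r" by (rule monoid_algebra_twisted_monoid[OF G])
  interpret H: twisted_monoid H \<sigma> by fact
  have closed: "d x \<in> carrier H" if "x \<in> carrier G" for x using d(1) that by (auto simp: hom_def)
  show ?thesis unfolding monoid_algebra_is_twisted
  proof (rule ring_hom_memI)
    fix f assume f: "f \<in> carrier G.W"
    have "Poly_Mapping.keys (Poly_Mapping.single (d x) (Poly_Mapping.lookup f x * c x)) \<subseteq> carrier H"
      if "x \<in> Poly_Mapping.keys f" for x
      using that f closed by auto
    then have "Poly_Mapping.keys (monomial_substitution d c f) \<subseteq> carrier H"
      unfolding monomial_substitution_def by (rule keys_sum_subsetI)
    then show "monomial_substitution d c f \<in> carrier H.W" by simp
  next
    fix f g assume "f \<in> carrier G.W" "g \<in> carrier G.W"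
    then have f: "Poly_Mapping.keys f \<subseteq> carrier G" and g: "Poly_Mapping.keys g \<subseteq> carrier G" by auto
    from f show "monomial_substitution d c (f \<otimes>\<^bsub>G.W\<^esub> g)
        = monomial_substitution d c f \<otimes>\<^bsub>H.W\<^esub> monomial_substitution d c g"
    proof (induction f rule: G.element_induct)
      case f: (single x a)
      from g show ?case
      proof (induction g rule: G.element_induct)
        case (single y b)
        have "d (x \<otimes>\<^bsub>G\<^esub> y) = d x \<otimes>\<^bsub>H\<^esub> d y"
          using hom_mult[OF d(1)] f single by blast
        then show ?case using f single
          by (simp add: twisted_mult_single monomial_substitution_single c(1) ac_simps)
      qed (simp add: twisted_mult_add_right monomial_substitution_add)
    qed (simp add: twisted_mult_add_left monomial_substitution_add)
  next
    show "monomial_substitution d c \<one>\<^bsub>G.W\<^esub> = \<one>\<^bsub>H.W\<^esub>"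
      by (simp add: monomial_substitution_single c d)
  qed (simp add: monomial_substitution_add)
qed

section \<open>Leading exponents\<close>

text \<open>Over a domain and with nonzero twists, products of leading terms do not vanish.\<close>

locale ordered_twisted_monoid = twisted_monoid G \<sigma>
  for G :: "('g, 'm) monoid_scheme" (structure) and \<sigma> :: "'g \<Rightarrow> 'g \<Rightarrow> 'r::idom" +
  fixes less :: "'g \<Rightarrow> 'g \<Rightarrow> bool" (infix \<open>\<prec>\<close> 50)
  assumes twist_nonzero: "\<lbrakk>x \<in> carrier G; y \<in> carrier G\<rbrakk> \<Longrightarrow> \<sigma> x y \<noteq> 0"
    and less_irrefl: "\<not> x \<prec> x"
    and less_trans: "\<lbrakk>x \<prec> y; y \<prec> z\<rbrakk> \<Longrightarrow> x \<prec> z"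
    and less_total: "\<lbrakk>x \<in> carrier G; y \<in> carrier G; x \<noteq> y\<rbrakk> \<Longrightarrow> x \<prec> y \<or> y \<prec> x"
    and less_mult_left: "\<lbrakk>x \<in> carrier G; y \<in> carrier G; z \<in> carrier G; x \<prec> y\<rbrakk> \<Longrightarrow> z \<otimes> x \<prec> z \<otimes> y"
    and less_mult_right: "\<lbrakk>x \<in> carrier G; y \<in> carrier G; z \<in> carrier G; x \<prec> y\<rbrakk> \<Longrightarrow> x \<otimes> z \<prec> y \<otimes> z"
begin

text \<open>A relation instead of a function of \<open>f\<close>: zero has no leading exponent.\<close>

definition is_top :: "('g \<Rightarrow>\<^sub>0 'r) \<Rightarrow> 'g \<Rightarrow> bool" where
  "is_top f t \<longleftrightarrow> t \<in> Poly_Mapping.keys f \<and> (\<forall>k\<in>Poly_Mapping.keys f. k = t \<or> k \<prec> t)"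

lemma finite_has_greatest:
  "\<lbrakk>finite K; K \<noteq> {}; K \<subseteq> carrier G\<rbrakk> \<Longrightarrow> \<exists>t\<in>K. \<forall>k\<in>K. k = t \<or> k \<prec> t"
proof (induction K rule: finite_ne_induct)
  case (insert x K)
  then obtain t where t: "t \<in> K" "\<forall>k\<in>K. k = t \<or> k \<prec> t" by auto
  then consider "x \<prec> t" | "t \<prec> x" using less_total[of x t] insert by blast
  then show ?case
  proof cases
    case 1 then show ?thesis using t by blast
  next
    case 2
    then have "k \<prec> x" if "k \<in> K" for k using t that less_trans[of k t x] by auto
    then show ?thesis by auto
  qed
qed auto

lemma is_top_exists:
  assumes "f \<in> carrier W" "f \<noteq> 0" shows "\<exists>t. is_top f t"
  using finite_has_greatest[of "Poly_Mapping.keys f"] assms by (auto simp: is_top_def)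

lemma is_top_unique: "\<lbrakk>is_top f t; is_top f u\<rbrakk> \<Longrightarrow> t = u"
  unfolding is_top_def using less_irrefl less_trans[of t u t] by metis

text \<open>The pair \<open>(t, u)\<close> is the only pair of exponents with product \<open>t \<otimes> u\<close>, since every other pair has a
strictly smaller product by translation invariance.  So its term cannot cancel.\<close>

lemma is_top_mult:
  assumes f: "f \<in> carrier W" "is_top f t" and g: "g \<in> carrier W" "is_top g u"
  shows "is_top (f \<otimes>\<^bsub>W\<^esub> g) (t \<otimes> u)"
    and "Poly_Mapping.lookup (f \<otimes>\<^bsub>W\<^esub> g) (t \<otimes> u)
           = \<sigma> t u * (Poly_Mapping.lookup f t * Poly_Mapping.lookup g u)"
proof -
  let ?F = "Poly_Mapping.keys f" and ?G = "Poly_Mapping.keys g"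
  let ?m = "\<lambda>x y. \<sigma> x y * (Poly_Mapping.lookup f x * Poly_Mapping.lookup g y)"
  have t: "t \<in> carrier G" "t \<in> ?F" and u: "u \<in> carrier G" "u \<in> ?G"
    using f g by (auto simp: is_top_def)
  have below: "x \<otimes> y \<prec> t \<otimes> u" if "x \<in> ?F" "y \<in> ?G" "x \<noteq> t \<or> y \<noteq> u" for x y
  proof -
    have xy: "x \<in> carrier G" "y \<in> carrier G" using that f g by auto
    have x: "x = t \<or> x \<prec> t" and y: "y = u \<or> y \<prec> u" using that f g by (auto simp: is_top_def)
    show ?thesis
    proof (cases "x = t")
      case True
      then show ?thesis using that y less_mult_left xy u t by auto
    next
      case False
      then have "x \<otimes> y \<prec> t \<otimes> y" using x xy t less_mult_right by blast
      moreover have "y = u \<or> t \<otimes> y \<prec> t \<otimes> u" using y xy t u less_mult_left by blast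
      ultimately show ?thesis using less_trans by metis
    qed
  qed
  have "Poly_Mapping.lookup (f \<otimes>\<^bsub>W\<^esub> g) (t \<otimes> u)
      = (\<Sum>x\<in>?F. \<Sum>y\<in>?G. if x = t \<and> y = u then ?m x y else 0)"
    unfolding twisted_algebra_def monoid.select_convs lookup_sum lookup_single when_def
    by (intro sum.cong refl if_cong) (use below less_irrefl in metis)
  also have "\<dots> = (\<Sum>x\<in>?F. if x = t then (\<Sum>y\<in>?G. if y = u then ?m x y else 0) else 0)"
    by (intro sum.cong refl) auto
  also have "\<dots> = ?m t u" using t u by (simp add: sum.delta)
  finally show coeff: "Poly_Mapping.lookup (f \<otimes>\<^bsub>W\<^esub> g) (t \<otimes> u) = ?m t u" .
  have "t \<otimes> u \<in> Poly_Mapping.keys (f \<otimes>\<^bsub>W\<^esub> g)"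
    using coeff twist_nonzero t u by (auto simp: in_keys_iff)
  then show "is_top (f \<otimes>\<^bsub>W\<^esub> g) (t \<otimes> u)"
    unfolding is_top_def using keys_twisted_mult[of G \<sigma> f g] below by blast
qed

lemma is_top_one: "is_top \<one>\<^bsub>W\<^esub> \<one>"
  by (simp add: is_top_def)

lemma is_top_pow:
  assumes "f \<in> carrier W" "is_top f t"
  shows "is_top (f [^]\<^bsub>W\<^esub> n) (t [^] (n::nat))"
proof (induction n)
  case 0
  then show ?case using is_top_one by (simp only: nat_pow_0 twisted.nat_pow_0)
next
  case (Suc n)
  then show ?case using assms is_top_mult(1) twisted.nat_pow_closed
    by (simp only: nat_pow_Suc twisted.nat_pow_Suc)
qed

lemma twisted_noncomm_domain: "noncomm_domain W"
  unfolding noncomm_domain_def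
proof (intro conjI ballI impI)
  show "\<one>\<^bsub>W\<^esub> \<noteq> \<zero>\<^bsub>W\<^esub>" using is_top_one unfolding is_top_def
    by (metis twisted_algebra_simps(3) keys_zero empty_iff)
  fix f g assume f: "f \<in> carrier W" and g: "g \<in> carrier W" and 0: "f \<otimes>\<^bsub>W\<^esub> g = \<zero>\<^bsub>W\<^esub>"
  show "f = \<zero>\<^bsub>W\<^esub> \<or> g = \<zero>\<^bsub>W\<^esub>"
  proof (rule ccontr)
    assume "\<not> (f = \<zero>\<^bsub>W\<^esub> \<or> g = \<zero>\<^bsub>W\<^esub>)"
    then obtain t u where "is_top f t" "is_top g u" using f g is_top_exists by fastforce
    then have "is_top (f \<otimes>\<^bsub>W\<^esub> g) (t \<otimes> u)" using f g is_top_mult by blast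
    then show False using 0 by (simp add: is_top_def)
  qed
qed (rule twisted_algebra_ring)

end

section \<open>Rays in finitely generated primitive monoids\<close>

text \<open>A monotone subsequence exists over every linear order, and a decreasing sequence of natural numbers
is eventually constant.\<close>

lemma nat_sequence_has_incseq_subsequence:
  fixes x :: "nat \<Rightarrow> nat"
  shows "\<exists>r. strict_mono r \<and> incseq (\<lambda>n. x (r n))"
proof -
  obtain r where r: "strict_mono r" "monoseq (\<lambda>n. x (r n))" using seq_monosub by blast
  show ?thesis
  proof (cases "incseq (\<lambda>n. x (r n))")
    case False
    then have dec: "x (r n) \<le> x (r m)" if "m \<le> n" for m n
      using r(2) that by (auto simp: monoseq_iff decseq_def)
    (* a decreasing sequence of natural numbers is constant once it has reached its minimum *)
    define N where "N = (ARG_MIN (\<lambda>n. x (r n)) n. True)"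
    have "x (r N) \<le> x (r n)" for n
      unfolding N_def by (rule arg_min_nat_le) simp
    then have "x (r (N + n)) = x (r N)" for n using dec[of N "N + n"] by (simp add: order_antisym)
    then have "incseq (\<lambda>n. x (r (N + n)))" by (simp add: incseq_def)
    moreover have "strict_mono (\<lambda>n. r (N + n))" using r(1) by (simp add: strict_mono_def)
    ultimately show ?thesis by (intro exI[of _ "\<lambda>n. r (N + n)"]) simp
  qed (use r in blast)
qed

text \<open>Dickson's lemma for \<open>\<nat>\<^sup>S\<close>: passing to a subsequence for one coordinate after the other makes all of them
increasing.\<close>

lemma dickson:
  fixes h :: "nat \<Rightarrow> 'a \<Rightarrow> nat"
  assumes "finite S"
  shows "\<exists>r. strict_mono r \<and> (\<forall>g\<in>S. incseq (\<lambda>n. h (r n) g))"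
  using assms
proof (induction S)
  case empty
  show ?case by (intro exI[of _ id]) (simp add: strict_mono_def)
next
  case (insert g S)
  then obtain r where r: "strict_mono r" "\<forall>g\<in>S. incseq (\<lambda>n. h (r n) g)" by auto
  obtain q where q: "strict_mono q" "incseq (\<lambda>n. h (r (q n)) g)"
    using nat_sequence_has_incseq_subsequence[of "\<lambda>n. h (r n) g"] by auto
  have "incseq (\<lambda>n. h (r (q n)) g')" if "g' \<in> S" for g'
    using r(2) that q(1) by (auto simp: incseq_def strict_mono_less_eq)
  then show ?case using q r(1)
    by (intro exI[of _ "\<lambda>n. r (q n)"]) (auto simp: strict_mono_def)
qed

text \<open>Written coordinate by coordinate, so that sums are ordinary sums of integers.\<close>

definition nat_combinations :: "nat \<Rightarrow> int vec set \<Rightarrow> int vec set" where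
  "nat_combinations p S =
     {v \<in> carrier_vec p. \<exists>c::int vec \<Rightarrow> nat. \<forall>i<p. v $ i = (\<Sum>g\<in>S. int (c g) * g $ i)}"

lemma smult_in_submonoid:
  assumes "submonoid \<Lambda> (monoid_vec TYPE(int) p)" "g \<in> \<Lambda>"
  shows "int n \<cdot>\<^sub>v g \<in> \<Lambda>"
proof (induction n)
  have g: "g \<in> carrier_vec p" using submonoid.subset[OF assms(1)] assms(2) by (auto simp: monoid_vec_simps)
  {
    case 0
    have "int 0 \<cdot>\<^sub>v g = 0\<^sub>v p" using g by auto
    then show ?case using submonoid.one_closed[OF assms(1)] by (simp add: monoid_vec_simps)
  next
    case (Suc n)
    have "int (Suc n) \<cdot>\<^sub>v g = int n \<cdot>\<^sub>v g + g" using g by (auto simp: algebra_simps)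
    then show ?case using submonoid.m_closed[OF assms(1) Suc assms(2)] by (simp add: monoid_vec_simps)
  }
qed

text \<open>The hull is the smallest submonoid that contains \<open>S\<close>, and the nonnegative combinations of \<open>S\<close> form one.\<close>

lemma finitely_generated_as_nat_combinations:
  assumes "finitely_generated_submonoid (monoid_vec TYPE(int) p) \<Lambda>"
    and \<Lambda>: "submonoid \<Lambda> (monoid_vec TYPE(int) p)"
  obtains S where "finite S" "S \<subseteq> \<Lambda>" "\<Lambda> = nat_combinations p S"
proof -
  let ?V = "monoid_vec TYPE(int) p"
  obtain S where S: "finite S" "S \<subseteq> carrier_vec p" and hull: "\<Lambda> = (\<lambda>M. submonoid M ?V) hull S"
    using assms(1) by (auto simp: finitely_generated_submonoid_def monoid_vec_simps)
  have gen: "S \<subseteq> \<Lambda>" unfolding hull by (rule hull_subset)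
  have "submonoid (nat_combinations p S) ?V"
  proof (rule submonoid.intro)
    show "\<one>\<^bsub>?V\<^esub> \<in> nat_combinations p S"
      by (auto simp: nat_combinations_def monoid_vec_simps intro!: exI[of _ "\<lambda>_. 0"])
    fix v w assume "v \<in> nat_combinations p S" "w \<in> nat_combinations p S"
    then obtain c d :: "int vec \<Rightarrow> nat" where vw: "v \<in> carrier_vec p" "w \<in> carrier_vec p"
      "\<forall>i<p. v $ i = (\<Sum>g\<in>S. int (c g) * g $ i)" "\<forall>i<p. w $ i = (\<Sum>g\<in>S. int (d g) * g $ i)"
      by (auto simp: nat_combinations_def)
    then show "v \<otimes>\<^bsub>?V\<^esub> w \<in> nat_combinations p S"
      by (auto simp: nat_combinations_def monoid_vec_simps distrib_right sum.distrib
          intro!: exI[of _ "\<lambda>g. c g + d g"])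
  qed (auto simp: nat_combinations_def monoid_vec_simps)
  moreover have "S \<subseteq> nat_combinations p S"
  proof
    fix g assume g: "g \<in> S"
    have "(\<Sum>g'\<in>S. int (if g' = g then 1 else 0) * g' $ i) = g $ i" for i
    proof -
      have "(\<Sum>g'\<in>S. int (if g' = g then 1 else 0) * g' $ i) = (\<Sum>g'\<in>S. if g' = g then g' $ i else 0)"
        by (intro sum.cong) auto
      then show ?thesis using g S(1) by (simp add: sum.delta)
    qed
    then show "g \<in> nat_combinations p S" using g S(2)
      by (auto simp: nat_combinations_def intro!: exI[of _ "\<lambda>g'. if g' = g then 1 else 0"])
  qed
  ultimately have "\<Lambda> \<subseteq> nat_combinations p S" unfolding hull by (intro hull_minimal)
  moreover have "v \<in> \<Lambda>" if v: "v \<in> nat_combinations p S" for v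
  proof -
    obtain c :: "int vec \<Rightarrow> nat" where c: "v \<in> carrier_vec p" "\<forall>i<p. v $ i = (\<Sum>g\<in>S. int (c g) * g $ i)"
      using v by (auto simp: nat_combinations_def)
    have "vec p (\<lambda>i. \<Sum>g\<in>T. int (c g) * g $ i) \<in> \<Lambda>" if "finite T" "T \<subseteq> S" for T
      using that
    proof (induction T)
      case empty
      have "vec p (\<lambda>i. \<Sum>g\<in>{}. int (c g) * g $ i) = 0\<^sub>v p" by auto
      then show ?case using submonoid.one_closed[OF \<Lambda>] by (simp add: monoid_vec_simps)
    next
      case (insert g T)
      have g: "g \<in> carrier_vec p" "g \<in> \<Lambda>" using insert.prems S gen by auto
      have "vec p (\<lambda>i. \<Sum>g\<in>insert g T. int (c g) * g $ i)
          = int (c g) \<cdot>\<^sub>v g + vec p (\<lambda>i. \<Sum>g\<in>T. int (c g) * g $ i)"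
        using g insert.hyps by (intro eq_vecI) auto
      moreover have "\<dots> \<in> \<Lambda>"
        using submonoid.m_closed[OF \<Lambda> smult_in_submonoid[OF \<Lambda> g(2)]] insert
        by (simp add: monoid_vec_simps)
      ultimately show ?case by simp
    qed
    from this[OF S(1) order_refl] have "vec p (\<lambda>i. \<Sum>g\<in>S. int (c g) * g $ i) \<in> \<Lambda>" .
    moreover have "v = vec p (\<lambda>i. \<Sum>g\<in>S. int (c g) * g $ i)" using c by (intro eq_vecI) auto
    ultimately show ?thesis by simp
  qed
  ultimately have "\<Lambda> = nat_combinations p S" by blast
  then show thesis using that S(1) gen by blast
qed

text \<open>Write \<open>x + n t\<close> as a nonnegative combination of generators with coefficients \<open>h n\<close>.  By Dickson's lemma
\<open>h m \<le> h n\<close> for some \<open>m < n\<close>, so that \<open>(n - m) t\<close> is a nonnegative combination as well; primitivity removes the factor.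
In terms of cones: \<open>t\<close> is a limit of points of the cone spanned by \<open>\<Lambda>\<close>, and this cone is closed.\<close>

lemma direction_of_ray_in_primitive_monoid:
  assumes fg: "finitely_generated_submonoid (monoid_vec TYPE(int) p) \<Lambda>"
    and \<Lambda>: "submonoid \<Lambda> (monoid_vec TYPE(int) p)"
    and prim: "primitive_submonoid \<Lambda>"
    and xt: "x \<in> carrier_vec p" "t \<in> group_completion \<Lambda>" "t \<in> carrier_vec p"
    and ray: "\<And>n. x + int n \<cdot>\<^sub>v t \<in> \<Lambda>"
  shows "t \<in> \<Lambda>"
proof -
  obtain S where S: "finite S" "\<Lambda> = nat_combinations p S"
    using finitely_generated_as_nat_combinations[OF fg \<Lambda>] by blast
  have "\<forall>n. \<exists>c::int vec \<Rightarrow> nat. \<forall>i<p. (x + int n \<cdot>\<^sub>v t) $ i = (\<Sum>g\<in>S. int (c g) * g $ i)"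
    using ray unfolding S(2) nat_combinations_def by blast
  then obtain h :: "nat \<Rightarrow> int vec \<Rightarrow> nat"
    where h: "\<And>n i. i < p \<Longrightarrow> (x + int n \<cdot>\<^sub>v t) $ i = (\<Sum>g\<in>S. int (h n g) * g $ i)"
    by metis
  obtain r where r: "strict_mono r" "\<forall>g\<in>S. incseq (\<lambda>n. h (r n) g)" using dickson[OF S(1)] by blast
  let ?m = "r 0" and ?n = "r 1"
  have less: "?m < ?n" using r(1) by (simp add: strict_mono_def)
  have mono: "h ?m g \<le> h ?n g" if "g \<in> S" for g using r(2) that by (auto simp: incseq_def)
  have "(int (?n - ?m) \<cdot>\<^sub>v t) $ i = (\<Sum>g\<in>S. int (h ?n g - h ?m g) * g $ i)" if i: "i < p" for i
  proof -
    have "(\<Sum>g\<in>S. int (h ?n g - h ?m g) * g $ i)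
        = (\<Sum>g\<in>S. int (h ?n g) * g $ i - int (h ?m g) * g $ i)"
      using mono by (intro sum.cong) (auto simp: of_nat_diff algebra_simps)
    also have "\<dots> = (x + int ?n \<cdot>\<^sub>v t) $ i - (x + int ?m \<cdot>\<^sub>v t) $ i"
      using i by (simp only: sum_subtractf h)
    also have "\<dots> = (int (?n - ?m) \<cdot>\<^sub>v t) $ i"
      using i xt less by (simp add: of_nat_diff algebra_simps)
    finally show ?thesis by simp
  qed
  then have "int (?n - ?m) \<cdot>\<^sub>v t \<in> \<Lambda>"
    unfolding S(2) nat_combinations_def using xt by (auto intro!: exI[of _ "\<lambda>g. h ?n g - h ?m g"])
  then show ?thesis using prim xt(2) less unfolding primitive_submonoid_def
    by (metis of_nat_0_less_iff zero_less_diff)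
qed

section \<open>Orders on the exponents of the torus\<close>

definition torus_form :: "nat \<Rightarrow> int mat \<Rightarrow> int vec \<Rightarrow> int vec \<Rightarrow> int" where
  "torus_form p U k l = (\<Sum>i<p. \<Sum>j<p. k $ i * l $ j * U $$ (i, j))"

text \<open>For antisymmetric \<open>U\<close> the monomials with exponents \<open>k\<close> and \<open>l\<close> commute up to the quotient of the twists of
\<open>(k, l)\<close> and \<open>(l, k)\<close>, which is \<open>s\<close> to twice the form, that is \<open>\<xi>\<close> to the form.\<close>

definition torus_twist :: "nat \<Rightarrow> int mat \<Rightarrow> complex \<Rightarrow> int vec \<Rightarrow> int vec \<Rightarrow> complex" where
  "torus_twist p U s k l = s powi torus_form p U k l"

definition exponent_monoid :: "nat \<Rightarrow> int vec set \<Rightarrow> int vec monoid" where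
  "exponent_monoid p \<Lambda> = (monoid_vec TYPE(int) p)\<lparr>carrier := \<Lambda>\<rparr>"

lemma exponent_monoid_simps [simp]:
  "carrier (exponent_monoid p \<Lambda>) = \<Lambda>"
  "\<one>\<^bsub>exponent_monoid p \<Lambda>\<^esub> = 0\<^sub>v p"
  "k \<otimes>\<^bsub>exponent_monoid p \<Lambda>\<^esub> l = k + l"
  by (simp_all add: exponent_monoid_def monoid_vec_simps)

lemma torus_form_add_left:
  "\<lbrakk>k \<in> carrier_vec p; k' \<in> carrier_vec p\<rbrakk>
    \<Longrightarrow> torus_form p U (k + k') l = torus_form p U k l + torus_form p U k' l"
  by (simp add: torus_form_def distrib_right sum.distrib)

lemma torus_form_add_right:
  "\<lbrakk>l \<in> carrier_vec p; l' \<in> carrier_vec p\<rbrakk>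
    \<Longrightarrow> torus_form p U k (l + l') = torus_form p U k l + torus_form p U k l'"
  by (simp add: torus_form_def distrib_right distrib_left sum.distrib)

lemma torus_form_zero: "torus_form p U (0\<^sub>v p) l = 0" "torus_form p U k (0\<^sub>v p) = 0"
  by (simp_all add: torus_form_def)

text \<open>The functional \<open>\<phi>\<close> is compared before the lexicographic order.  Thus the leading exponent of an element
is one at which \<open>\<phi>\<close> is maximal, while ties are still broken.\<close>

definition vec_less :: "nat \<Rightarrow> (int vec \<Rightarrow> int) \<Rightarrow> int vec \<Rightarrow> int vec \<Rightarrow> bool" where
  "vec_less p \<phi> v w \<longleftrightarrow>
     \<phi> v < \<phi> w \<or> (\<phi> v = \<phi> w \<and> (\<exists>j<p. v $ j < w $ j \<and> (\<forall>i<j. v $ i = w $ i)))"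

lemma vec_less_trans:
  assumes "vec_less p \<phi> v w" "vec_less p \<phi> w u" shows "vec_less p \<phi> v u"
proof (cases "\<phi> v = \<phi> w \<and> \<phi> w = \<phi> u")
  case True
  with assms obtain j k where j: "j < p" "v $ j < w $ j" "\<forall>i<j. v $ i = w $ i"
    and k: "k < p" "w $ k < u $ k" "\<forall>i<k. w $ i = u $ i"
    by (auto simp: vec_less_def)
  have "v $ min j k < u $ min j k"
    using j k by (cases j k rule: linorder_cases) (auto simp: min_def)
  moreover have "\<forall>i<min j k. v $ i = u $ i" using j k by auto
  ultimately show ?thesis using True j(1) by (auto simp: vec_less_def intro!: exI[of _ "min j k"])
qed (use assms in \<open>auto simp: vec_less_def\<close>)

lemma vec_less_total:
  assumes "v \<in> carrier_vec p" "w \<in> carrier_vec p" "v \<noteq> w"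
  shows "vec_less p \<phi> v w \<or> vec_less p \<phi> w v"
proof -
  have ex: "\<exists>j. j < p \<and> v $ j \<noteq> w $ j" using assms by (metis carrier_vecD eq_vecI)
  define j where "j = (LEAST j. j < p \<and> v $ j \<noteq> w $ j)"
  have j: "j < p" "v $ j \<noteq> w $ j" using LeastI_ex[OF ex] by (auto simp: j_def)
  have "v $ i = w $ i" if "i < j" for i
    using not_less_Least[of i "\<lambda>j. j < p \<and> v $ j \<noteq> w $ j"] that j(1) by (auto simp: j_def)
  then show ?thesis using j unfolding vec_less_def by (metis linorder_neqE_linordered_idom)
qed

text \<open>Orders for all additive \<open>\<phi>\<close> are available on the same algebra; their leading exponents are compared
with each other in the division.\<close>

lemma torus_ordered_twisted_monoid:
  assumes \<Lambda>: "submonoid \<Lambda> (monoid_vec TYPE(int) p)" and s: "s \<noteq> 0"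
    and \<phi>: "\<And>v w. \<lbrakk>v \<in> carrier_vec p; w \<in> carrier_vec p\<rbrakk> \<Longrightarrow> \<phi> (v + w) = \<phi> v + \<phi> w"
  shows "ordered_twisted_monoid (exponent_monoid p \<Lambda>) (torus_twist p U s) (vec_less p \<phi>)"
proof -
  have sub: "k \<in> carrier_vec p" if "k \<in> \<Lambda>" for k
    using submonoid.subset[OF \<Lambda>] that by (auto simp: monoid_vec_simps)
  interpret V: comm_monoid "monoid_vec TYPE(int) p" by (rule comm_monoid_vec)
  interpret G: monoid "exponent_monoid p \<Lambda>"
    unfolding exponent_monoid_def by (rule submonoid.submonoid_is_monoid[OF \<Lambda> V.monoid_axioms])
  have shift: "vec_less p \<phi> (k + l) (k' + l)"
    if "k \<in> carrier_vec p" "k' \<in> carrier_vec p" "l \<in> carrier_vec p" "vec_less p \<phi> k k'" for k k' l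
    using that by (fastforce simp: vec_less_def \<phi>)
  show ?thesis
  proof (unfold_locales, unfold exponent_monoid_simps)
    fix x y z assume xyz: "x \<in> \<Lambda>" "y \<in> \<Lambda>" "z \<in> \<Lambda>"
    then show "torus_twist p U s x y * torus_twist p U s (x + y) z
        = torus_twist p U s y z * torus_twist p U s x (y + z)"
      using s by (simp add: sub torus_twist_def torus_form_add_left torus_form_add_right
          power_int_add ac_simps)
    show "vec_less p \<phi> (z + x) (z + y)" if "vec_less p \<phi> x y"
      using shift[OF _ _ _ that, of z] xyz sub comm_add_vec by metis
    show "vec_less p \<phi> (x + z) (y + z)" if "vec_less p \<phi> x y"
      using shift[OF _ _ _ that, of z] xyz sub by metis
  next
    fix x assume "x \<in> \<Lambda>"
    then show "torus_twist p U s (0\<^sub>v p) x = 1" "torus_twist p U s x (0\<^sub>v p) = 1"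
      by (simp_all add: torus_twist_def torus_form_zero)
  next
    fix x y z assume "vec_less p \<phi> x y" "vec_less p \<phi> y z"
    then show "vec_less p \<phi> x z" by (rule vec_less_trans)
  next
    fix x y assume "x \<in> \<Lambda>" "y \<in> \<Lambda>" "x \<noteq> y"
    then show "vec_less p \<phi> x y \<or> vec_less p \<phi> y x" by (intro vec_less_total sub)
  qed (use s in \<open>auto simp: torus_twist_def vec_less_def\<close>)
qed

lemma finite_box: "finite {v \<in> carrier_vec p. \<forall>i<p. \<bar>v $ i\<bar> \<le> (M::int)}" (is "finite ?B")
proof (rule finite_surj)
  show "finite ({..<p} \<rightarrow>\<^sub>E {-M..M})" by (intro finite_PiE) auto
  show "?B \<subseteq> vec p ` ({..<p} \<rightarrow>\<^sub>E {-M..M})"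
  proof
    fix v assume v: "v \<in> ?B"
    then have "v = vec p (restrict (($) v) {..<p})" by (intro eq_vecI) auto
    moreover have "restrict (($) v) {..<p} \<in> {..<p} \<rightarrow>\<^sub>E {-M..M}" using v by (auto simp: abs_le_iff)
    ultimately show "v \<in> vec p ` ({..<p} \<rightarrow>\<^sub>E {-M..M})" by blast
  qed
qed

section \<open>Division by leading terms\<close>

lemma exponent_monoid_pow:
  assumes "x \<in> carrier_vec p"
  shows "x [^]\<^bsub>exponent_monoid p \<Lambda>\<^esub> (n::nat) = int n \<cdot>\<^sub>v x"
proof (induction n)
  case (Suc n)
  then show ?case using assms by (auto simp: algebra_simps)
qed (use assms in auto)

text \<open>The Archimedean step: a negative slope would fall below every bound.\<close>

lemma nonneg_of_linear_bound:
  fixes a b :: int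
  assumes "\<And>n::nat. b \<le> int n * a"
  shows "0 \<le> a"
proof (rule ccontr)
  assume "\<not> 0 \<le> a"
  then have "int (nat \<bar>b\<bar> + 1) * a \<le> int (nat \<bar>b\<bar> + 1) * (-1)" by (intro mult_left_mono) auto
  then show False using assms[of "nat \<bar>b\<bar> + 1"] by simp
qed

text \<open>Think of \<open>P\<close> as the numerators over \<open>z\<close> of a ring between \<open>A\<close> and \<open>z\<inverse> A\<close>.  The claim is that all of them are
divisible by \<open>z\<close>.  The exponent \<open>t\<close> of the next term of the quotient \<open>a / z\<close> is in \<open>\<Lambda>\<close>, since \<open>tz + n t\<close> is the
leading exponent of some \<open>w \<in> A\<close> for all \<open>n\<close>.  The division ends because no new exponent leaves the box of the
exponents of \<open>a\<close>.  In terms of Newton polytopes: the difference of the support functions of \<open>a\<close> and \<open>z\<close> is the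
limit of those of \<open>w\<close> divided by \<open>n\<close>, so it is convex, and it bounds its gradient \<open>t\<close> in all directions.\<close>

lemma torus_division:
  fixes U :: "int mat"
  assumes fg: "finitely_generated_submonoid (monoid_vec TYPE(int) p) \<Lambda>"
    and \<Lambda>: "submonoid \<Lambda> (monoid_vec TYPE(int) p)"
    and prim: "primitive_submonoid \<Lambda>"
    and s: "s \<noteq> 0"
  defines "A \<equiv> twisted_algebra (exponent_monoid p \<Lambda>) (torus_twist p U s)"
  assumes z: "z \<in> carrier A" "z \<noteq> \<zero>\<^bsub>A\<^esub>"
    and P: "P \<subseteq> carrier A"
    and P_minus: "\<And>a b. \<lbrakk>a \<in> P; b \<in> P\<rbrakk> \<Longrightarrow> a \<ominus>\<^bsub>A\<^esub> b \<in> P"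
    and P_mult: "\<And>c. c \<in> carrier A \<Longrightarrow> c \<otimes>\<^bsub>A\<^esub> z \<in> P"
    and P_pow: "\<And>a n. a \<in> P \<Longrightarrow>
      \<exists>w\<in>carrier A. a [^]\<^bsub>A\<^esub> (n::nat) \<otimes>\<^bsub>A\<^esub> z = w \<otimes>\<^bsub>A\<^esub> z [^]\<^bsub>A\<^esub> n"
    and a: "a \<in> P"
  shows "\<exists>c\<in>carrier A. a = c \<otimes>\<^bsub>A\<^esub> z"
proof -
  define \<phi> :: "int \<Rightarrow> nat \<Rightarrow> int vec \<Rightarrow> int" where "\<phi> e i v = e * v $ i" for e i v
  have sub: "k \<in> carrier_vec p" if "k \<in> \<Lambda>" for k
    using submonoid.subset[OF \<Lambda>] that by (auto simp: monoid_vec_simps)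
  have order: "ordered_twisted_monoid (exponent_monoid p \<Lambda>) (torus_twist p U s) (vec_less p (\<phi> e i))"
    if "i < p" for e i
    using that by (intro torus_ordered_twisted_monoid[OF \<Lambda> s]) (auto simp: \<phi>_def algebra_simps)
  interpret O: ordered_twisted_monoid "exponent_monoid p \<Lambda>" "torus_twist p U s" "vec_less p (\<lambda>_. 0)"
    by (rule torus_ordered_twisted_monoid[OF \<Lambda> s]) simp
  have A_carrier: "f \<in> carrier A \<longleftrightarrow> Poly_Mapping.keys f \<subseteq> \<Lambda>" for f by (simp add: A_def)
  have A_ring: "ring A" unfolding A_def by (rule O.twisted_algebra_ring)
  interpret A: ring A by (rule A_ring)
  have z0: "z \<noteq> 0" using z(2) by (simp add: A_def)
  obtain tz where tz: "O.is_top z tz" using O.is_top_exists z z0 by (auto simp: A_def)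
  have tz_in: "tz \<in> \<Lambda>" using tz z(1) by (auto simp: O.is_top_def A_carrier)
  (* The witness w for a power of a is chosen before the order: the same w is compared below with
     respect to the lexicographic order and to an order that starts with a coordinate. *)
  have top_eq: "\<exists>w\<in>carrier A. \<forall>less. ordered_twisted_monoid (exponent_monoid p \<Lambda>) (torus_twist p U s) less \<longrightarrow>
      (\<forall>ta tz. ordered_twisted_monoid.is_top less a ta \<longrightarrow> ordered_twisted_monoid.is_top less z tz \<longrightarrow>
        (\<exists>tw\<in>\<Lambda>. ordered_twisted_monoid.is_top less w tw \<and> tw = tz + int n \<cdot>\<^sub>v (ta - tz)))"
    if a: "a \<in> P" for a and n :: nat
  proof -
    obtain w where w: "w \<in> carrier A" "a [^]\<^bsub>A\<^esub> n \<otimes>\<^bsub>A\<^esub> z = w \<otimes>\<^bsub>A\<^esub> z [^]\<^bsub>A\<^esub> n"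
      using P_pow[OF a] by blast
    show ?thesis
    proof (intro bexI[OF _ w(1)] allI impI)
      fix less ta tz
      assume "ordered_twisted_monoid (exponent_monoid p \<Lambda>) (torus_twist p U s) less"
      then interpret Q: ordered_twisted_monoid "exponent_monoid p \<Lambda>" "torus_twist p U s" less .
      assume ta: "Q.is_top a ta" and tz: "Q.is_top z tz"
      have a_in: "a \<in> carrier A" using a P by blast
      have vec: "ta \<in> carrier_vec p" "tz \<in> carrier_vec p"
        using ta tz a_in z(1) sub by (auto simp: Q.is_top_def A_carrier)
      have l: "Q.is_top (a [^]\<^bsub>A\<^esub> n \<otimes>\<^bsub>A\<^esub> z) (int n \<cdot>\<^sub>v ta + tz)"
        using Q.is_top_mult(1)[OF _ Q.is_top_pow[OF _ ta, of n] z(1)[unfolded A_def] tz] a_in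
          A.nat_pow_closed[OF a_in, of n] vec
        unfolding A_def by (simp only: exponent_monoid_simps exponent_monoid_pow)
      then have "Q.is_top (w \<otimes>\<^bsub>A\<^esub> z [^]\<^bsub>A\<^esub> n) (int n \<cdot>\<^sub>v ta + tz)" using w(2) by simp
      moreover have "w \<noteq> 0"
      proof
        assume "w = 0"
        then have "w \<otimes>\<^bsub>A\<^esub> z [^]\<^bsub>A\<^esub> n = \<zero>\<^bsub>A\<^esub>"
          using A.l_null[OF A.nat_pow_closed[OF z(1)]] by (simp add: A_def)
        then show False using calculation by (simp add: Q.is_top_def A_def)
      qed
      then obtain tw where tw: "Q.is_top w tw" using Q.is_top_exists w(1) by (auto simp: A_def)
      have tw_in: "tw \<in> \<Lambda>" using tw w(1) by (auto simp: Q.is_top_def A_carrier)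
      have "Q.is_top (w \<otimes>\<^bsub>A\<^esub> z [^]\<^bsub>A\<^esub> n) (tw + int n \<cdot>\<^sub>v tz)"
        using Q.is_top_mult(1)[OF w(1)[unfolded A_def] tw _ Q.is_top_pow[OF _ tz, of n]] z(1)
          A.nat_pow_closed[OF z(1), of n] vec
        unfolding A_def by (simp only: exponent_monoid_simps exponent_monoid_pow)
      ultimately have eq: "int n \<cdot>\<^sub>v ta + tz = tw + int n \<cdot>\<^sub>v tz" by (rule Q.is_top_unique)
      have "tw = tz + int n \<cdot>\<^sub>v (ta - tz)"
      proof (rule eq_vecI)
        fix i assume "i < dim_vec (tz + int n \<cdot>\<^sub>v (ta - tz))"
        then have i: "i < p" using vec by auto
        have "(int n \<cdot>\<^sub>v ta + tz) $ i = (tw + int n \<cdot>\<^sub>v tz) $ i" by (simp only: eq)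
        then show "tw $ i = (tz + int n \<cdot>\<^sub>v (ta - tz)) $ i"
          using i vec sub[OF tw_in] by (simp add: algebra_simps)
      qed (use vec sub[OF tw_in] in auto)
      then show "\<exists>tw\<in>\<Lambda>. Q.is_top w tw \<and> tw = tz + int n \<cdot>\<^sub>v (ta - tz)" using tw tw_in by blast
    qed
  qed
  (* A box that contains the exponents of a bounds the whole division; the induction is on the number
     of its points that are not above the leading exponent. *)
  define box where "box M = {v \<in> carrier_vec p. \<forall>i<p. \<bar>v $ i\<bar> \<le> (M::int)}" for M
  define below where "below M f = {v \<in> box M. \<exists>k\<in>Poly_Mapping.keys f. v = k \<or> vec_less p (\<lambda>_. 0) v k}"
    for M and f :: "int vec \<Rightarrow>\<^sub>0 complex"
  have finite_below: "finite (below M f)" for M f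
    unfolding below_def box_def by (rule finite_subset[OF _ finite_box[of p M]]) auto
  have "\<exists>c\<in>carrier A. a = c \<otimes>\<^bsub>A\<^esub> z" if "a \<in> P" "Poly_Mapping.keys a \<subseteq> box M" for a M
    using that
  proof (induction "card (below M a)" arbitrary: a rule: less_induct)
    case less
    note a = less.prems
    have a_in: "a \<in> carrier A" using a(1) P by blast
    show ?case
    proof (cases "a = 0")
      case True
      have "a = \<zero>\<^bsub>A\<^esub> \<otimes>\<^bsub>A\<^esub> z" using z(1) True by (simp add: A.l_null) (simp add: A_def)
      then show ?thesis using A.zero_closed by blast
    next
      case False
      then obtain ta where ta: "O.is_top a ta" using O.is_top_exists a_in by (auto simp: A_def)
      have ta_in: "ta \<in> \<Lambda>" using ta a_in by (auto simp: O.is_top_def A_carrier)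
      define t where "t = ta - tz"
      have vec: "ta \<in> carrier_vec p" "tz \<in> carrier_vec p" "t \<in> carrier_vec p"
        using sub ta_in tz_in by (auto simp: t_def)
      have "tz + int n \<cdot>\<^sub>v t \<in> \<Lambda>" for n
        using top_eq[OF a(1), of n] ta tz O.ordered_twisted_monoid_axioms unfolding t_def by blast
      moreover have "t \<in> group_completion \<Lambda>" unfolding group_completion_def t_def using ta_in tz_in by blast
      ultimately have t_in: "t \<in> \<Lambda>" using direction_of_ray_in_primitive_monoid[OF fg \<Lambda> prim vec(2) _ vec(3)] by blast
      (* Dividing the inequality between the leading exponents of w by n and letting n grow bounds
         e * t by the difference of the maxima of e * coordinate over a and over z. *)
      have coord: "e * (t + k) $ i \<le> M"
        if k: "k \<in> Poly_Mapping.keys z" and i: "i < p" and e: "e \<in> {1, -1}" for k i e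
      proof -
        interpret Q: ordered_twisted_monoid "exponent_monoid p \<Lambda>" "torus_twist p U s" "vec_less p (\<phi> e i)"
          by (rule order[OF i])
        obtain ua uz where ua: "Q.is_top a ua" and uz: "Q.is_top z uz"
          using Q.is_top_exists[of a] Q.is_top_exists[of z] a_in z(1) z0 False by (auto simp: A_def)
        have uvec: "ua \<in> carrier_vec p" "uz \<in> carrier_vec p"
          using ua uz a_in z(1) sub by (auto simp: Q.is_top_def A_carrier)
        have "e * tz $ i - e * uz $ i \<le> int n * (e * ua $ i - e * uz $ i - e * t $ i)" for n
        proof -
          obtain w where w: "w \<in> carrier A" "O.is_top w (tz + int n \<cdot>\<^sub>v t)"
            "Q.is_top w (uz + int n \<cdot>\<^sub>v (ua - uz))"
            using top_eq[OF a(1), of n] ta tz ua uz O.ordered_twisted_monoid_axioms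
              Q.ordered_twisted_monoid_axioms unfolding t_def by blast
          have "tz + int n \<cdot>\<^sub>v t \<in> Poly_Mapping.keys w" using w(2) by (simp add: O.is_top_def)
          then have "\<phi> e i (tz + int n \<cdot>\<^sub>v t) \<le> \<phi> e i (uz + int n \<cdot>\<^sub>v (ua - uz))"
            using w(3) by (auto simp: Q.is_top_def vec_less_def)
          then show ?thesis using i vec uvec by (simp add: \<phi>_def algebra_simps)
        qed
        then have "0 \<le> e * ua $ i - e * uz $ i - e * t $ i" by (rule nonneg_of_linear_bound)
        moreover have "e * k $ i \<le> e * uz $ i"
          using uz k by (auto simp: Q.is_top_def vec_less_def \<phi>_def)
        moreover have "e * ua $ i \<le> M"
        proof -
          have "ua \<in> box M" using ua a(2) by (auto simp: Q.is_top_def)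
          then show ?thesis using i e by (auto simp: box_def abs_le_iff)
        qed
        moreover have "k \<in> carrier_vec p" using k z(1) sub by (auto simp: A_carrier)
        ultimately show ?thesis using vec i by (simp add: algebra_simps)
      qed
      define b where "b = Poly_Mapping.single t (Poly_Mapping.lookup a ta
          / (torus_twist p U s t tz * Poly_Mapping.lookup z tz))"
      have b_in: "b \<in> carrier A" using t_in by (auto simp: A_carrier b_def)
      have b0: "Poly_Mapping.lookup a ta \<noteq> 0" "Poly_Mapping.lookup z tz \<noteq> 0" "torus_twist p U s t tz \<noteq> 0"
        using ta tz O.twist_nonzero t_in tz_in by (auto simp: O.is_top_def in_keys_iff)
      have b_top: "O.is_top b t" using b0 by (simp add: b_def O.is_top_def)
      have ttz: "t + tz = ta" using vec by (auto simp: t_def)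
      have bz_top: "O.is_top (b \<otimes>\<^bsub>A\<^esub> z) ta"
        using O.is_top_mult(1)[OF _ b_top _ tz] b_in z(1) ttz by (simp add: A_def)
      have bz_lookup: "Poly_Mapping.lookup (b \<otimes>\<^bsub>A\<^esub> z) ta = Poly_Mapping.lookup a ta"
        using O.is_top_mult(2)[OF _ b_top _ tz] b_in z(1) ttz b0 by (simp add: A_def b_def)
      define a' where "a' = a \<ominus>\<^bsub>A\<^esub> b \<otimes>\<^bsub>A\<^esub> z"
      have bz_in: "b \<otimes>\<^bsub>A\<^esub> z \<in> carrier A" using b_in z(1) by simp
      have a': "a' = a - b \<otimes>\<^bsub>A\<^esub> z"
        unfolding a'_def A_def using a_in bz_in by (intro O.twisted_a_minus) (auto simp: A_def)
      have a'_P: "a' \<in> P" unfolding a'_def by (intro P_minus a(1) P_mult b_in)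
      have keys_a': "Poly_Mapping.keys a' \<subseteq> (Poly_Mapping.keys a \<union> Poly_Mapping.keys (b \<otimes>\<^bsub>A\<^esub> z)) - {ta}"
        unfolding a' using keys_minus_subset[of a "b \<otimes>\<^bsub>A\<^esub> z"] bz_lookup
        by (auto simp: in_keys_iff lookup_minus)
      have "Poly_Mapping.keys (b \<otimes>\<^bsub>A\<^esub> z) \<subseteq> box M"
      proof
        fix v assume "v \<in> Poly_Mapping.keys (b \<otimes>\<^bsub>A\<^esub> z)"
        then obtain k where k: "k \<in> Poly_Mapping.keys z" "v = t + k"
          unfolding A_def using keys_twisted_mult[of "exponent_monoid p \<Lambda>" "torus_twist p U s" b z]
          by (auto simp: b_def split: if_splits)
        have "k \<in> carrier_vec p" using k z(1) sub by (auto simp: A_carrier)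
        moreover have "\<bar>v $ i\<bar> \<le> M" if "i < p" for i
          using coord[OF k(1) that, of 1] coord[OF k(1) that, of "-1"] k(2) by (simp add: abs_le_iff)
        ultimately show "v \<in> box M" using k(2) vec by (auto simp: box_def)
      qed
      then have box': "Poly_Mapping.keys a' \<subseteq> box M" using keys_a' a(2) by blast
      have below_ta: "vec_less p (\<lambda>_. 0) k ta" if "k \<in> Poly_Mapping.keys a'" for k
        using that keys_a' ta bz_top by (auto simp: O.is_top_def)
      have "below M a' \<subseteq> below M a"
        unfolding below_def using below_ta ta O.less_trans by (auto simp: O.is_top_def) blast
      moreover have "ta \<in> below M a" using ta a(2) by (auto simp: below_def O.is_top_def)
      moreover have "ta \<notin> below M a'"
        unfolding below_def using below_ta O.less_irrefl O.less_trans by blast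
      ultimately have "card (below M a') < card (below M a)"
        using finite_below by (intro psubset_card_mono) auto
      then obtain c where c: "c \<in> carrier A" "a' = c \<otimes>\<^bsub>A\<^esub> z" using less.hyps a'_P box' by blast
      have "a = (c \<oplus>\<^bsub>A\<^esub> b) \<otimes>\<^bsub>A\<^esub> z"
      proof -
        have "a = a' + b \<otimes>\<^bsub>A\<^esub> z" by (simp add: a')
        then show ?thesis using c b_in z(1) by (simp add: A.l_distr) (simp add: A_def)
      qed
      then show ?thesis using c(1) b_in by blast
    qed
  qed
  moreover have "\<exists>M. Poly_Mapping.keys a \<subseteq> box M"
  proof -
    define M where "M = Max (insert 0 ((\<lambda>(k, i). \<bar>k $ i\<bar>) ` (Poly_Mapping.keys a \<times> {..<p})))"
    have "\<bar>k $ i\<bar> \<le> M" if "k \<in> Poly_Mapping.keys a" "i < p" for k i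
      unfolding M_def using that by (intro Max_ge) force+
    moreover have "k \<in> carrier_vec p" if "k \<in> Poly_Mapping.keys a" for k
      using that subsetD[OF P a] sub by (auto simp: A_carrier)
    ultimately show ?thesis by (auto simp: box_def)
  qed
  ultimately show ?thesis using a by blast
qed

section \<open>Fields of fractions\<close>

context domain
begin

lemma fraction_rel_equiv: "equiv (carrier R \<times> (carrier R - {\<zero>})) (fraction_rel R)"
proof (rule equivI)
  show "trans (fraction_rel R)"
  proof (rule transI, clarify)
    fix a s b t c u
    assume "((a, s), (b, t)) \<in> fraction_rel R" "((b, t), (c, u)) \<in> fraction_rel R"
    then have ast: "a \<in> carrier R" "s \<in> carrier R" "b \<in> carrier R" "t \<in> carrier R" "c \<in> carrier R"
      "u \<in> carrier R" "s \<noteq> \<zero>" "t \<noteq> \<zero>" "u \<noteq> \<zero>" "a \<otimes> t = b \<otimes> s" "b \<otimes> u = c \<otimes> t"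
      by (auto simp: fraction_rel_def)
    have "t \<otimes> (a \<otimes> u) = (a \<otimes> t) \<otimes> u" using ast(1-9) by (simp add: m_ac)
    also have "\<dots> = (b \<otimes> u) \<otimes> s" using ast(1-9) by (simp only: ast(10)) (simp add: m_ac)
    also have "\<dots> = t \<otimes> (c \<otimes> s)" using ast(1-9) by (simp only: ast(11)) (simp add: m_ac)
    finally have "a \<otimes> u = c \<otimes> s" using ast m_lcancel by simp
    then show "((a, s), (c, u)) \<in> fraction_rel R" using ast by (simp add: fraction_rel_def)
  qed
qed (auto simp: fraction_rel_def refl_on_def sym_def)

lemma fraction_eq_iff:
  assumes "a \<in> carrier R" "s \<in> carrier R - {\<zero>}" "b \<in> carrier R" "t \<in> carrier R - {\<zero>}"
  shows "fraction R a s = fraction R b t \<longleftrightarrow> a \<otimes> t = b \<otimes> s"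
  unfolding fraction_def
  using eq_equiv_class_iff[OF fraction_rel_equiv, of "(a, s)" "(b, t)"] assms
  by (auto simp: fraction_rel_def)

lemma fraction_in_carrier:
  assumes "a \<in> carrier R" "s \<in> carrier R - {\<zero>}"
  shows "fraction R a s \<in> carrier (fraction_field R)"
  using assms by (auto simp: fraction_field_def fraction_def intro: quotientI)

lemma fraction_field_cases:
  assumes "x \<in> carrier (fraction_field R)"
  obtains a s where "a \<in> carrier R" "s \<in> carrier R - {\<zero>}" "x = fraction R a s"
  using assms by (auto simp: fraction_field_def fraction_def elim!: quotientE)

lemma fraction_representatives:
  assumes "(b, t) \<in> fraction R a s"
  shows "b \<in> carrier R" "t \<in> carrier R - {\<zero>}" "a \<otimes> t = b \<otimes> s"
  using assms by (auto simp: fraction_def fraction_rel_def)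

lemma fraction_self:
  "\<lbrakk>a \<in> carrier R; s \<in> carrier R - {\<zero>}\<rbrakk> \<Longrightarrow> (a, s) \<in> fraction R a s"
  by (simp add: fraction_def fraction_rel_def)

lemma denominator_mult:
  "\<lbrakk>s \<in> carrier R - {\<zero>}; t \<in> carrier R - {\<zero>}\<rbrakk> \<Longrightarrow> s \<otimes> t \<in> carrier R - {\<zero>}"
  using integral by auto

text \<open>The operations of the fraction field are unions over all representatives; this evaluates such a
union when the value is independent of them.\<close>

lemma union_over_fractions:
  assumes ast: "a \<in> carrier R" "s \<in> carrier R - {\<zero>}" "b \<in> carrier R" "t \<in> carrier R - {\<zero>}"
    and const: "\<And>a' s' b' t'. \<lbrakk>a' \<in> carrier R; s' \<in> carrier R - {\<zero>}; b' \<in> carrier R;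
      t' \<in> carrier R - {\<zero>}; a \<otimes> s' = a' \<otimes> s; b \<otimes> t' = b' \<otimes> t\<rbrakk> \<Longrightarrow> h a' s' b' t' = X"
  shows "(\<Union>(a, s)\<in>fraction R a s. \<Union>(b, t)\<in>fraction R b t. h a s b t) = X"
proof -
  have "h a' s' b' t' = X" if "(a', s') \<in> fraction R a s" "(b', t') \<in> fraction R b t" for a' s' b' t'
    using const[of a' s' b' t'] fraction_representatives[OF that(1)] fraction_representatives[OF that(2)]
    by blast
  moreover have "(a, s) \<in> fraction R a s" "(b, t) \<in> fraction R b t" using fraction_self ast by blast+
  ultimately show ?thesis by fast
qed

lemma fraction_mult:
  assumes "a \<in> carrier R" "s \<in> carrier R - {\<zero>}" "b \<in> carrier R" "t \<in> carrier R - {\<zero>}"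
  shows "fraction R a s \<otimes>\<^bsub>fraction_field R\<^esub> fraction R b t = fraction R (a \<otimes> b) (s \<otimes> t)"
  unfolding fraction_field_def monoid.select_convs
proof (rule union_over_fractions[OF assms])
  fix a' s' b' t'
  assume h: "a' \<in> carrier R" "s' \<in> carrier R - {\<zero>}" "b' \<in> carrier R" "t' \<in> carrier R - {\<zero>}"
    "a \<otimes> s' = a' \<otimes> s" "b \<otimes> t' = b' \<otimes> t"
  have "(a' \<otimes> b') \<otimes> (s \<otimes> t) = (a' \<otimes> s) \<otimes> (b' \<otimes> t)" using h(1-4) assms by (simp add: m_ac)
  also have "\<dots> = (a \<otimes> b) \<otimes> (s' \<otimes> t')"
    using h(1-4) assms by (simp only: h(5,6)[symmetric]) (simp add: m_ac)
  finally show "fraction R (a' \<otimes> b') (s' \<otimes> t') = fraction R (a \<otimes> b) (s \<otimes> t)"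
    using h(1-4) assms denominator_mult[OF h(2,4)] denominator_mult[OF assms(2,4)]
    by (subst fraction_eq_iff) auto
qed

lemma fraction_add:
  assumes "a \<in> carrier R" "s \<in> carrier R - {\<zero>}" "b \<in> carrier R" "t \<in> carrier R - {\<zero>}"
  shows "fraction R a s \<oplus>\<^bsub>fraction_field R\<^esub> fraction R b t
    = fraction R (a \<otimes> t \<oplus> b \<otimes> s) (s \<otimes> t)"
  unfolding fraction_field_def ring_record_simps
proof (rule union_over_fractions[OF assms])
  fix a' s' b' t'
  assume h: "a' \<in> carrier R" "s' \<in> carrier R - {\<zero>}" "b' \<in> carrier R" "t' \<in> carrier R - {\<zero>}"
    "a \<otimes> s' = a' \<otimes> s" "b \<otimes> t' = b' \<otimes> t"
  have "(a' \<otimes> t' \<oplus> b' \<otimes> s') \<otimes> (s \<otimes> t) = (a' \<otimes> s) \<otimes> (t' \<otimes> t) \<oplus> (b' \<otimes> t) \<otimes> (s' \<otimes> s)"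
    using h(1-4) assms by (simp add: m_ac l_distr r_distr)
  also have "\<dots> = (a \<otimes> t \<oplus> b \<otimes> s) \<otimes> (s' \<otimes> t')"
    using h(1-4) assms by (simp only: h(5,6)[symmetric]) (simp add: m_ac l_distr r_distr)
  finally show "fraction R (a' \<otimes> t' \<oplus> b' \<otimes> s') (s' \<otimes> t') = fraction R (a \<otimes> t \<oplus> b \<otimes> s) (s \<otimes> t)"
    using h(1-4) assms denominator_mult[OF h(2,4)] denominator_mult[OF assms(2,4)]
    by (subst fraction_eq_iff) auto
qed

lemma one_denominator: "\<one> \<in> carrier R - {\<zero>}" by simp

lemma fraction_one: "\<one>\<^bsub>fraction_field R\<^esub> = fraction R \<one> \<one>"
  and fraction_zero: "\<zero>\<^bsub>fraction_field R\<^esub> = fraction R \<zero> \<one>"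
  by (simp_all add: fraction_field_def)

lemma fraction_field_cring: "cring (fraction_field R)"
proof (rule cringI)
  note closed = fraction_in_carrier denominator_mult one_denominator
  note ops = fraction_mult fraction_add fraction_one fraction_zero
  show "abelian_group (fraction_field R)"
  proof (rule abelian_groupI)
    fix x y assume "x \<in> carrier (fraction_field R)" "y \<in> carrier (fraction_field R)"
    then obtain a s b t where "a \<in> carrier R" "s \<in> carrier R - {\<zero>}" "x = fraction R a s"
      "b \<in> carrier R" "t \<in> carrier R - {\<zero>}" "y = fraction R b t"
      by (metis fraction_field_cases)
    then show "x \<oplus>\<^bsub>fraction_field R\<^esub> y \<in> carrier (fraction_field R)"
      "x \<oplus>\<^bsub>fraction_field R\<^esub> y = y \<oplus>\<^bsub>fraction_field R\<^esub> x"
      using denominator_mult[of s t]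
      by (auto simp: fraction_add m_comm[of t s] a_comm intro!: fraction_in_carrier)
  next
    fix x y z assume "x \<in> carrier (fraction_field R)" "y \<in> carrier (fraction_field R)"
      "z \<in> carrier (fraction_field R)"
    then obtain a s b t c u where h: "a \<in> carrier R" "s \<in> carrier R - {\<zero>}" "x = fraction R a s"
      "b \<in> carrier R" "t \<in> carrier R - {\<zero>}" "y = fraction R b t"
      "c \<in> carrier R" "u \<in> carrier R - {\<zero>}" "z = fraction R c u"
      by (metis fraction_field_cases)
    note d = denominator_mult[OF h(2,5)] denominator_mult[OF h(5,8)]
    have "((a \<otimes> t \<oplus> b \<otimes> s) \<otimes> u \<oplus> c \<otimes> (s \<otimes> t)) = (a \<otimes> (t \<otimes> u) \<oplus> (b \<otimes> u \<oplus> c \<otimes> t) \<otimes> s)"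
      using h by (simp add: l_distr r_distr m_ac a_assoc)
    then show "x \<oplus>\<^bsub>fraction_field R\<^esub> y \<oplus>\<^bsub>fraction_field R\<^esub> z
        = x \<oplus>\<^bsub>fraction_field R\<^esub> (y \<oplus>\<^bsub>fraction_field R\<^esub> z)"
      using h d by (simp add: fraction_add m_assoc)
  next
    fix x assume "x \<in> carrier (fraction_field R)"
    then obtain a s where h: "a \<in> carrier R" "s \<in> carrier R - {\<zero>}" "x = fraction R a s"
      by (rule fraction_field_cases)
    show "\<zero>\<^bsub>fraction_field R\<^esub> \<oplus>\<^bsub>fraction_field R\<^esub> x = x"
      using h one_denominator by (simp add: fraction_zero fraction_add)
    have "fraction R (\<ominus> a) s \<oplus>\<^bsub>fraction_field R\<^esub> x = fraction R \<zero> (s \<otimes> s)"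
      using h by (simp add: fraction_add l_neg flip: l_distr)
    also have "\<dots> = \<zero>\<^bsub>fraction_field R\<^esub>"
      unfolding fraction_zero using h denominator_mult[OF h(2,2)] by (subst fraction_eq_iff) auto
    finally show "\<exists>y\<in>carrier (fraction_field R). y \<oplus>\<^bsub>fraction_field R\<^esub> x = \<zero>\<^bsub>fraction_field R\<^esub>"
      using fraction_in_carrier[of "\<ominus> a" s] h by blast
  qed (simp add: fraction_zero fraction_in_carrier)
  show "comm_monoid (fraction_field R)"
  proof (rule comm_monoidI)
    fix x y assume "x \<in> carrier (fraction_field R)" "y \<in> carrier (fraction_field R)"
    then obtain a s b t where "a \<in> carrier R" "s \<in> carrier R - {\<zero>}" "x = fraction R a s"
      "b \<in> carrier R" "t \<in> carrier R - {\<zero>}" "y = fraction R b t"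
      by (metis fraction_field_cases)
    then show "x \<otimes>\<^bsub>fraction_field R\<^esub> y \<in> carrier (fraction_field R)"
      "x \<otimes>\<^bsub>fraction_field R\<^esub> y = y \<otimes>\<^bsub>fraction_field R\<^esub> x"
      using denominator_mult[of s t]
      by (auto simp: fraction_mult m_comm[of t s] m_comm[of b a] intro!: fraction_in_carrier)
  next
    fix x y z assume "x \<in> carrier (fraction_field R)" "y \<in> carrier (fraction_field R)"
      "z \<in> carrier (fraction_field R)"
    then obtain a s b t c u where h: "a \<in> carrier R" "s \<in> carrier R - {\<zero>}" "x = fraction R a s"
      "b \<in> carrier R" "t \<in> carrier R - {\<zero>}" "y = fraction R b t"
      "c \<in> carrier R" "u \<in> carrier R - {\<zero>}" "z = fraction R c u"
      by (metis fraction_field_cases)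
    note d = denominator_mult[OF h(2,5)] denominator_mult[OF h(5,8)]
    show "x \<otimes>\<^bsub>fraction_field R\<^esub> y \<otimes>\<^bsub>fraction_field R\<^esub> z
        = x \<otimes>\<^bsub>fraction_field R\<^esub> (y \<otimes>\<^bsub>fraction_field R\<^esub> z)"
      using h d by (simp add: fraction_mult m_assoc)
  next
    fix x assume "x \<in> carrier (fraction_field R)"
    then obtain a s where h: "a \<in> carrier R" "s \<in> carrier R - {\<zero>}" "x = fraction R a s"
      by (rule fraction_field_cases)
    show "\<one>\<^bsub>fraction_field R\<^esub> \<otimes>\<^bsub>fraction_field R\<^esub> x = x"
      using h one_denominator by (simp add: fraction_one fraction_mult)
  qed (simp add: fraction_one fraction_in_carrier)
next
  fix x y z assume "x \<in> carrier (fraction_field R)" "y \<in> carrier (fraction_field R)"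
    "z \<in> carrier (fraction_field R)"
  then obtain a s b t c u where h: "a \<in> carrier R" "s \<in> carrier R - {\<zero>}" "x = fraction R a s"
    "b \<in> carrier R" "t \<in> carrier R - {\<zero>}" "y = fraction R b t"
    "c \<in> carrier R" "u \<in> carrier R - {\<zero>}" "z = fraction R c u"
    by (metis fraction_field_cases)
  note d = denominator_mult[OF h(2,5)] denominator_mult[OF h(2,8)] denominator_mult[OF h(5,8)]
  note d' = denominator_mult[OF d(1) h(8)] denominator_mult[OF d(2,3)]
  show "(x \<oplus>\<^bsub>fraction_field R\<^esub> y) \<otimes>\<^bsub>fraction_field R\<^esub> z
      = x \<otimes>\<^bsub>fraction_field R\<^esub> z \<oplus>\<^bsub>fraction_field R\<^esub> y \<otimes>\<^bsub>fraction_field R\<^esub> z"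
    using h d d' by (simp add: fraction_mult fraction_add fraction_eq_iff l_distr r_distr m_ac)
qed

end

section \<open>The ring of central fractions\<close>

lemma center_simps [simp]:
  "x \<otimes>\<^bsub>center A\<^esub> y = x \<otimes>\<^bsub>A\<^esub> y"
  "x \<oplus>\<^bsub>center A\<^esub> y = x \<oplus>\<^bsub>A\<^esub> y"
  "\<one>\<^bsub>center A\<^esub> = \<one>\<^bsub>A\<^esub>"
  "\<zero>\<^bsub>center A\<^esub> = \<zero>\<^bsub>A\<^esub>"
  by (simp_all add: center_def)

lemma mem_center_iff:
  "z \<in> carrier (center A) \<longleftrightarrow> z \<in> carrier A \<and> (\<forall>a\<in>carrier A. z \<otimes>\<^bsub>A\<^esub> a = a \<otimes>\<^bsub>A\<^esub> z)"
  by (simp add: center_def)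

lemma center_in_carrier: "z \<in> carrier (center A) \<Longrightarrow> z \<in> carrier A"
  by (drule mem_center_iff[THEN iffD1], erule conjunct1)

lemma center_commutes:
  "\<lbrakk>z \<in> carrier (center A); a \<in> carrier A\<rbrakk> \<Longrightarrow> z \<otimes>\<^bsub>A\<^esub> a = a \<otimes>\<^bsub>A\<^esub> z"
  by (drule mem_center_iff[THEN iffD1], drule conjunct2, erule bspec)

text \<open>The ring \<open>A \<otimes>\<^sub>Z Z'\<close> for a domain \<open>A\<close> with center \<open>Z\<close>.\<close>

locale central_localization =
  fixes A :: "('a, 'm) ring_scheme" (structure)
  assumes domain: "noncomm_domain A"

sublocale central_localization \<subseteq> ring A
  using domain by (simp add: noncomm_domain_def)

context central_localization
begin

lemma no_zero_divisors: "\<lbrakk>a \<in> carrier A; b \<in> carrier A; a \<otimes> b = \<zero>\<rbrakk> \<Longrightarrow> a = \<zero> \<or> b = \<zero>"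
  using domain by (auto simp: noncomm_domain_def)

lemma left_cancel:
  assumes "c \<in> carrier A" "c \<noteq> \<zero>" "a \<in> carrier A" "b \<in> carrier A" "c \<otimes> a = c \<otimes> b"
  shows "a = b"
proof -
  have "c \<otimes> (a \<ominus> b) = \<zero>" using assms by (simp add: a_minus_def r_distr r_minus r_neg)
  then have "a \<ominus> b = \<zero>" using no_zero_divisors[of c "a \<ominus> b"] assms by simp
  then show ?thesis using assms by simp
qed

lemma center_domain: "domain (center A)"
proof -
  have "subring (carrier (center A)) A"
  proof (rule subringI)
    fix x assume "x \<in> carrier (center A)"
    then have "x \<in> carrier A" "\<And>a. a \<in> carrier A \<Longrightarrow> \<ominus> x \<otimes> a = a \<otimes> \<ominus> x"
      by (simp_all add: mem_center_iff l_minus r_minus)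
    then show "\<ominus> x \<in> carrier (center A)" by (simp add: mem_center_iff)
  next
    fix x y assume "x \<in> carrier (center A)" "y \<in> carrier (center A)"
    then have h: "x \<in> carrier A" "y \<in> carrier A" "\<And>a. a \<in> carrier A \<Longrightarrow> x \<otimes> a = a \<otimes> x"
      "\<And>a. a \<in> carrier A \<Longrightarrow> y \<otimes> a = a \<otimes> y" by (auto simp: mem_center_iff)
    have "x \<otimes> y \<otimes> a = a \<otimes> (x \<otimes> y)" if a: "a \<in> carrier A" for a
    proof -
      have "x \<otimes> y \<otimes> a = x \<otimes> (a \<otimes> y)" using h(1,2) a by (simp add: m_assoc h(4)[OF a])
      also have "\<dots> = (a \<otimes> x) \<otimes> y" using h(1,2) a by (simp add: m_assoc[symmetric] h(3)[OF a])
      finally show ?thesis using h(1,2) a by (simp add: m_assoc)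
    qed
    then show "x \<otimes> y \<in> carrier (center A)" using h(1,2) by (simp add: mem_center_iff)
    have "(x \<oplus> y) \<otimes> a = a \<otimes> (x \<oplus> y)" if "a \<in> carrier A" for a
      using that h(1,2) by (simp add: l_distr r_distr h(3)[OF that] h(4)[OF that])
    then show "x \<oplus> y \<in> carrier (center A)" using h(1,2) by (simp add: mem_center_iff)
  qed (auto simp: mem_center_iff)
  then have "ring (center A)" unfolding center_def using subring_is_ring by (simp add: mem_center_iff center_def)
  then interpret Z: ring "center A" .
  show ?thesis
  proof (rule domain.intro)
    show "cring (center A)"
    proof (rule cring.intro[OF \<open>ring (center A)\<close>])
      show "comm_monoid (center A)"
        by unfold_locales (simp add: center_commutes center_in_carrier)
    qed
    show "domain_axioms (center A)"
    proof (rule domain_axioms.intro)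
      show "\<one>\<^bsub>center A\<^esub> \<noteq> \<zero>\<^bsub>center A\<^esub>" using domain by (simp add: noncomm_domain_def)
      fix a b assume ab: "a \<otimes>\<^bsub>center A\<^esub> b = \<zero>\<^bsub>center A\<^esub>"
        "a \<in> carrier (center A)" "b \<in> carrier (center A)"
      have "a \<in> carrier A" "b \<in> carrier A" using ab center_in_carrier by fast+
      then show "a = \<zero>\<^bsub>center A\<^esub> \<or> b = \<zero>\<^bsub>center A\<^esub>"
        using ab(1) no_zero_divisors[of a b] by simp
    qed
  qed
qed

sublocale Z: domain "center A" by (rule center_domain)

abbreviation "F \<equiv> fraction_field (center A)"

sublocale F: cring F by (rule Z.fraction_field_cring)

abbreviation frac :: "'a \<Rightarrow> 'a \<Rightarrow> ('a \<times> 'a) set" where "frac \<equiv> fraction (center A)"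

definition denominators :: "'a set" where "denominators = carrier (center A) - {\<zero>}"

lemmas in_A = center_in_carrier[of _ A]
lemmas center_comm = center_commutes[of _ A]
lemma center_lcomm:
  assumes "z \<in> carrier (center A)" "a \<in> carrier A" "b \<in> carrier A"
  shows "a \<otimes> (z \<otimes> b) = z \<otimes> (a \<otimes> b)"
  using m_assoc[of a z b] m_assoc[of z a b] assms(2,3) in_A[OF assms(1)] center_comm[OF assms(1,2)]
  by simp
lemma denominatorsD: "z \<in> denominators \<Longrightarrow> z \<in> carrier (center A)" "z \<in> denominators \<Longrightarrow> z \<in> carrier A" "z \<in> denominators \<Longrightarrow> z \<noteq> \<zero>"
  by (auto simp: denominators_def in_A)
lemma denominators_mult: "\<lbrakk>s \<in> denominators; t \<in> denominators\<rbrakk> \<Longrightarrow> s \<otimes> t \<in> denominators"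
  using Z.denominator_mult[of s t] by (simp add: denominators_def)
lemma one_denominators: "\<one> \<in> denominators" using Z.one_denominator by (simp add: denominators_def)
lemma Z_closed: "\<lbrakk>y \<in> carrier (center A); z \<in> carrier (center A)\<rbrakk> \<Longrightarrow> y \<otimes> z \<in> carrier (center A)"
  "\<lbrakk>y \<in> carrier (center A); z \<in> carrier (center A)\<rbrakk> \<Longrightarrow> y \<oplus> z \<in> carrier (center A)"
  using Z.m_closed[of y z] Z.a_closed[of y z] by simp_all

lemmas frac_eq_iff = Z.fraction_eq_iff[folded denominators_def, simplified center_simps, folded denominators_def]
lemmas frac_closed = Z.fraction_in_carrier[simplified center_simps, folded denominators_def]
lemmas frac_cases = Z.fraction_field_cases[simplified center_simps, folded denominators_def]
lemmas frac_mult = Z.fraction_mult[simplified center_simps, folded denominators_def]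
lemmas frac_add = Z.fraction_add[simplified center_simps, folded denominators_def]
lemmas frac_one = Z.fraction_one[simplified center_simps]

abbreviation M :: "('a \<times> ('a \<times> 'a) set \<Rightarrow>\<^sub>0 int) ring" where "M \<equiv> monoid_algebra (A \<times>\<times> F)"

abbreviation "rels \<equiv> tensor_relations (center A) A F (\<lambda>z. center_fraction A z \<one>)"
abbreviation "I \<equiv> tensor_subgroup (center A) A F (\<lambda>z. center_fraction A z \<one>)"

sublocale T: twisted_monoid "A \<times>\<times> F" "\<lambda>_ _. 1 :: int"
  by (rule monoid_algebra_twisted_monoid, rule DirProd_monoid, rule monoid_axioms, rule F.monoid_axioms)

lemma M_ring: "ring M" unfolding monoid_algebra_is_twisted by (rule T.twisted_algebra_ring)

sublocale M: ring M by (rule M_ring)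

lemma M_simps:
  "carrier M = {f. Poly_Mapping.keys f \<subseteq> carrier A \<times> carrier F}"
  "\<zero>\<^bsub>M\<^esub> = 0" "f \<oplus>\<^bsub>M\<^esub> g = f + g"
  by (simp_all add: monoid_algebra_def)

lemma M_a_inv: "f \<in> carrier M \<Longrightarrow> \<ominus>\<^bsub>M\<^esub> f = - f"
  using T.twisted_a_inv[of f] by (simp add: monoid_algebra_is_twisted)

lemma M_minus: "f \<in> carrier M \<Longrightarrow> g \<in> carrier M \<Longrightarrow> f \<ominus>\<^bsub>M\<^esub> g = f - g"
  by (simp add: M.minus_eq M_a_inv M_simps)

lemma pair_closed: "\<lbrakk>a \<in> carrier A; x \<in> carrier F\<rbrakk> \<Longrightarrow> pair a x \<in> carrier M"
  by (simp add: M_simps)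

lemma pair_mult: "pair a x \<otimes>\<^bsub>M\<^esub> pair b y = pair (a \<otimes> b) (x \<otimes>\<^bsub>F\<^esub> y)"
  by (simp add: monoid_algebra_is_twisted twisted_mult_single)

lemma M_distrib:
  "(f + g) \<otimes>\<^bsub>M\<^esub> h = f \<otimes>\<^bsub>M\<^esub> h + g \<otimes>\<^bsub>M\<^esub> h"
  "h \<otimes>\<^bsub>M\<^esub> (f + g) = h \<otimes>\<^bsub>M\<^esub> f + h \<otimes>\<^bsub>M\<^esub> g"
  by (simp_all add: monoid_algebra_is_twisted twisted_mult_add_left twisted_mult_add_right)

lemma M_zero_mult: "0 \<otimes>\<^bsub>M\<^esub> h = 0" "h \<otimes>\<^bsub>M\<^esub> 0 = 0"
  by (simp_all add: monoid_algebra_def)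

lemma M_minus_mult:
  "(- f) \<otimes>\<^bsub>M\<^esub> h = - (f \<otimes>\<^bsub>M\<^esub> h)" "h \<otimes>\<^bsub>M\<^esub> (- f) = - (h \<otimes>\<^bsub>M\<^esub> f)"
  using M_distrib(1)[of f "- f" h] M_distrib(2)[of h f "- f"]
  by (simp_all add: M_zero_mult eq_neg_iff_add_eq_0 add.commute)

lemma M_diff_mult:
  "(f - g) \<otimes>\<^bsub>M\<^esub> h = f \<otimes>\<^bsub>M\<^esub> h - g \<otimes>\<^bsub>M\<^esub> h"
  "h \<otimes>\<^bsub>M\<^esub> (f - g) = h \<otimes>\<^bsub>M\<^esub> f - h \<otimes>\<^bsub>M\<^esub> g"
  using M_distrib(1)[of f "- g" h] M_distrib(2)[of h f "- g"] by (simp_all add: M_minus_mult)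

lemma rels_cases [consumes 1, case_names left right middle]:
  assumes "r \<in> rels"
  obtains a a' x where "r = pair (a \<oplus> a') x - pair a x - pair a' x"
      "a \<in> carrier A" "a' \<in> carrier A" "x \<in> carrier F"
    | a x x' where "r = pair a (x \<oplus>\<^bsub>F\<^esub> x') - pair a x - pair a x'"
      "a \<in> carrier A" "x \<in> carrier F" "x' \<in> carrier F"
    | a z x where "r = pair (a \<otimes> z) x - pair a (frac z \<one> \<otimes>\<^bsub>F\<^esub> x)"
      "a \<in> carrier A" "z \<in> carrier (center A)" "x \<in> carrier F"
  using assms unfolding tensor_relations_def center_fraction_def by blast

lemma rels_intros:
  "\<lbrakk>a \<in> carrier A; a' \<in> carrier A; x \<in> carrier F\<rbrakk>
    \<Longrightarrow> pair (a \<oplus> a') x - pair a x - pair a' x \<in> rels"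
  "\<lbrakk>a \<in> carrier A; x \<in> carrier F; x' \<in> carrier F\<rbrakk>
    \<Longrightarrow> pair a (x \<oplus>\<^bsub>F\<^esub> x') - pair a x - pair a x' \<in> rels"
  "\<lbrakk>a \<in> carrier A; z \<in> carrier (center A); x \<in> carrier F\<rbrakk>
    \<Longrightarrow> pair (a \<otimes> z) x - pair a (frac z \<one> \<otimes>\<^bsub>F\<^esub> x) \<in> rels"
  unfolding tensor_relations_def center_fraction_def by blast+

lemma diff_closed: "\<lbrakk>f \<in> carrier M; g \<in> carrier M\<rbrakk> \<Longrightarrow> f - g \<in> carrier M"
  using M.minus_closed[of f g] by (simp add: M_minus)

lemma frac_one_closed: "z \<in> carrier (center A) \<Longrightarrow> frac z \<one> \<in> carrier F"
  by (intro frac_closed one_denominators)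

lemma rels_carrier: "rels \<subseteq> carrier M"
proof
  fix r assume "r \<in> rels"
  then show "r \<in> carrier M"
    by (cases rule: rels_cases)
      (auto intro!: diff_closed pair_closed F.m_closed F.a_closed frac_one_closed dest: in_A)
qed

lemma I_subgroup: "subgroup I (add_monoid M)"
  unfolding tensor_subgroup_def using M.add.generate_is_subgroup rels_carrier by simp

lemma I_carrier: "u \<in> I \<Longrightarrow> u \<in> carrier M"
  using subgroup.subset[OF I_subgroup] by auto

lemma I_closed: "0 \<in> I" "\<lbrakk>u \<in> I; v \<in> I\<rbrakk> \<Longrightarrow> u + v \<in> I" "u \<in> I \<Longrightarrow> - u \<in> I"
proof -
  show "0 \<in> I" using subgroup.one_closed[OF I_subgroup] by (simp add: M_simps)
  show "u + v \<in> I" if "u \<in> I" "v \<in> I"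
    using subgroup.m_closed[OF I_subgroup that] by (simp add: M_simps)
  show "- u \<in> I" if "u \<in> I"
    using subgroup.m_inv_closed[OF I_subgroup that] M_a_inv[OF I_carrier[OF that]]
    by (simp add: a_inv_def)
qed

lemma rels_in_I: "r \<in> rels \<Longrightarrow> r \<in> I"
  unfolding tensor_subgroup_def by (rule generate.incl)

lemma I_induct [consumes 1, case_names zero rel add minus]:
  assumes u: "u \<in> I" and zero: "P 0" and rel: "\<And>r. r \<in> rels \<Longrightarrow> P r"
    and add: "\<And>u v. \<lbrakk>u \<in> I; v \<in> I; P u; P v\<rbrakk> \<Longrightarrow> P (u + v)"
    and minus: "\<And>u. \<lbrakk>u \<in> I; P u\<rbrakk> \<Longrightarrow> P (- u)"
  shows "P u"
proof -
  have "u \<in> generate (add_monoid M) rels" using u by (simp add: tensor_subgroup_def)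
  then have "u \<in> I \<and> P u"
  proof (induction rule: generate.induct)
    case one
    then show ?case using zero I_closed by (simp add: M_simps)
  next
    case (incl h)
    then show ?case using rel rels_in_I by blast
  next
    case (inv h)
    then have "inv\<^bsub>add_monoid M\<^esub> h = - h"
      using M_a_inv[of h] rels_carrier by (auto simp: a_inv_def)
    then show ?case using inv rel minus rels_in_I I_closed by simp
  next
    case (eng u v)
    then show ?case using add I_closed by (simp add: M_simps)
  qed
  then show ?thesis ..
qed

text \<open>The free abelian group on pairs is generated by the pairs, so an additive map lands in \<open>I\<close> if it does on pairs.\<close>

lemma additive_map_into_I:
  assumes pairs: "\<And>a x. \<lbrakk>a \<in> carrier A; x \<in> carrier F\<rbrakk> \<Longrightarrow> h (pair a x) \<in> I"
    and add: "\<And>f g. h (f + g) = h f + h g"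
    and f: "f \<in> carrier M"
  shows "h f \<in> I"
proof -
  have h0: "h 0 = 0" using add[of 0 0] by simp
  have hminus: "h (- f) = - h f" for f using add[of f "- f"] h0 by (simp add: eq_neg_iff_add_eq_0 add.commute)
  have int_mult: "h (Poly_Mapping.single (a, x) n) \<in> I" if "a \<in> carrier A" "x \<in> carrier F" for a x and n :: int
  proof (induction n rule: int_induct[where k = 0])
    case base
    then show ?case by (simp add: h0 I_closed)
  next
    case (step1 i)
    then show ?case using pairs[OF that] by (simp add: single_add add I_closed)
  next
    case (step2 i)
    have "Poly_Mapping.single (a, x) (i - 1) = Poly_Mapping.single (a, x) i + - pair a x"
      by (simp add: single_diff)
    then show ?case using step2 pairs[OF that] by (simp only: add hminus I_closed)
  qed
  have "Poly_Mapping.keys f \<subseteq> carrier A \<times> carrier F" using f by (simp add: M_simps)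
  then show ?thesis
  proof (induction f rule: poly_mapping_additive_induct)
    case (single k c)
    then show ?case using int_mult by (cases k) auto
  next
    case (add f g)
    then show ?case by (simp add: assms(2) I_closed)
  qed (use one_closed F.one_closed in blast)
qed

text \<open>A pair times a defining relation is again a relation.  For the relation that moves \<open>z\<close> across the
tensor sign, multiplication on the right uses that \<open>z\<close> is central.\<close>

lemma pair_times_relation:
  assumes r: "r \<in> rels" and b: "b \<in> carrier A" and y: "y \<in> carrier F"
  shows "pair b y \<otimes>\<^bsub>M\<^esub> r \<in> I" "r \<otimes>\<^bsub>M\<^esub> pair b y \<in> I"
proof -
  have "pair b y \<otimes>\<^bsub>M\<^esub> r \<in> rels \<and> r \<otimes>\<^bsub>M\<^esub> pair b y \<in> rels"
    using r
  proof (cases rule: rels_cases)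
    case (left a a' x)
    then show ?thesis using rels_intros(1)[of "b \<otimes> a" "b \<otimes> a'" "y \<otimes>\<^bsub>F\<^esub> x"]
        rels_intros(1)[of "a \<otimes> b" "a' \<otimes> b" "x \<otimes>\<^bsub>F\<^esub> y"] b y
      by (simp add: M_diff_mult pair_mult l_distr r_distr)
  next
    case (right a x x')
    then show ?thesis using rels_intros(2)[of "b \<otimes> a" "y \<otimes>\<^bsub>F\<^esub> x" "y \<otimes>\<^bsub>F\<^esub> x'"]
        rels_intros(2)[of "a \<otimes> b" "x \<otimes>\<^bsub>F\<^esub> y" "x' \<otimes>\<^bsub>F\<^esub> y"] b y
      by (simp add: M_diff_mult pair_mult F.l_distr F.r_distr)
  next
    case (middle a z x)
    note z = in_A[OF middle(3)] frac_one_closed[OF middle(3)]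
    have "a \<otimes> z \<otimes> b = a \<otimes> b \<otimes> z" using middle z b center_comm[OF middle(3) b] by (simp add: m_assoc)
    then show ?thesis using rels_intros(3)[of "b \<otimes> a" z "y \<otimes>\<^bsub>F\<^esub> x"]
        rels_intros(3)[of "a \<otimes> b" z "x \<otimes>\<^bsub>F\<^esub> y"] middle b y z
      by (simp add: M_diff_mult pair_mult m_assoc F.m_assoc F.m_lcomm)
  qed
  then show "pair b y \<otimes>\<^bsub>M\<^esub> r \<in> I" "r \<otimes>\<^bsub>M\<^esub> pair b y \<in> I" using rels_in_I by blast+
qed

lemma I_ideal: "ideal I M"
proof (rule idealI[OF M_ring I_subgroup])
  fix u f assume u: "u \<in> I" and f: "f \<in> carrier M"
  from u have "f \<otimes>\<^bsub>M\<^esub> u \<in> I \<and> u \<otimes>\<^bsub>M\<^esub> f \<in> I"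
  proof (induction rule: I_induct)
    case (rel r)
    show ?case using additive_map_into_I[of "\<lambda>f. f \<otimes>\<^bsub>M\<^esub> r", OF _ _ f]
        additive_map_into_I[of "\<lambda>f. r \<otimes>\<^bsub>M\<^esub> f", OF _ _ f] pair_times_relation[OF rel]
      by (simp add: M_distrib)
  qed (simp_all add: M_zero_mult M_distrib M_minus_mult I_closed)
  then show "f \<otimes>\<^bsub>M\<^esub> u \<in> I" "u \<otimes>\<^bsub>M\<^esub> f \<in> I" by simp_all
qed

sublocale I: ideal I M by (rule I_ideal)

text \<open>The numerator of \<open>x\<close> over the denominator \<open>e\<close>; zero is the default for fractions that cannot be written
over \<open>e\<close>.\<close>

definition numerator :: "'a \<Rightarrow> ('a \<times> 'a) set \<Rightarrow> 'a" where
  "numerator e x = (if \<exists>n\<in>carrier (center A). x = frac n e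
     then SOME n. n \<in> carrier (center A) \<and> x = frac n e else \<zero>)"

lemma numerator_closed: "numerator e x \<in> carrier (center A)"
proof (cases "\<exists>n\<in>carrier (center A). x = frac n e")
  case True
  then have "\<exists>n. n \<in> carrier (center A) \<and> x = frac n e" by blast
  from someI_ex[OF this] True show ?thesis by (simp add: numerator_def)
qed (use Z.zero_closed in \<open>auto simp: numerator_def\<close>)

lemma numerator_frac:
  assumes n: "n \<in> carrier (center A)" and e: "e \<in> denominators"
  shows "numerator e (frac n e) = n"
proof -
  have ex: "\<exists>m. m \<in> carrier (center A) \<and> frac n e = frac m e" using n by blast
  define m where "m = (SOME m. m \<in> carrier (center A) \<and> frac n e = frac m e)"
  have m: "m \<in> carrier (center A)" "frac n e = frac m e" using someI_ex[OF ex] by (auto simp: m_def)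
  then have "n \<otimes> e = m \<otimes> e" using frac_eq_iff n e by blast
  then have "e \<otimes> m = e \<otimes> n" using center_comm[of e] n m e by (simp add: denominatorsD in_A)
  then have "m = n" using left_cancel[of e m n] e n m by (simp add: denominatorsD in_A)
  moreover have "numerator e (frac n e) = m" using n by (auto simp: numerator_def m_def)
  ultimately show ?thesis by simp
qed

lemma numerator_frac_multiple:
  assumes "n \<in> carrier (center A)" "d \<in> denominators" "f \<in> denominators"
  shows "numerator (d \<otimes> f) (frac n d) = n \<otimes> f"
proof -
  have "frac n d = frac (n \<otimes> f) (d \<otimes> f)"
    using assms center_comm[of d f]
    by (subst frac_eq_iff) (auto simp: denominators_mult Z_closed denominatorsD in_A m_assoc)
  then show ?thesis using assms by (simp add: numerator_frac denominators_mult Z_closed denominatorsD)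
qed

text \<open>The value of \<open>\<Sum> a \<otimes> x\<close> after multiplication by \<open>e\<close>, as an element of \<open>A\<close>.\<close>

definition cleared :: "'a \<Rightarrow> ('a \<times> ('a \<times> 'a) set \<Rightarrow>\<^sub>0 int) \<Rightarrow> 'a" where
  "cleared e u = (\<Oplus>k\<in>Poly_Mapping.keys u.
     [Poly_Mapping.lookup u k] \<cdot> (fst k \<otimes> numerator e (snd k)))"

lemma term_closed: "a \<in> carrier A \<Longrightarrow> a \<otimes> numerator e x \<in> carrier A"
  using numerator_closed in_A by blast

lemma cleared_superset:
  assumes "finite K" "Poly_Mapping.keys u \<subseteq> K" "K \<subseteq> carrier A \<times> carrier F"
  shows "cleared e u = (\<Oplus>k\<in>K. [Poly_Mapping.lookup u k] \<cdot> (fst k \<otimes> numerator e (snd k)))"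
  unfolding cleared_def
  using assms by (intro add.finprod_mono_neutral_cong_left) (auto simp: in_keys_iff term_closed add_pow_int_ge)

lemma cleared_closed: "u \<in> carrier M \<Longrightarrow> cleared e u \<in> carrier A"
  unfolding cleared_def by (rule finsum_closed) (auto simp: M_simps term_closed)

lemma cleared_add:
  assumes u: "u \<in> carrier M" and v: "v \<in> carrier M"
  shows "cleared e (u + v) = cleared e u \<oplus> cleared e v"
proof -
  let ?K = "Poly_Mapping.keys u \<union> Poly_Mapping.keys v"
  let ?t = "\<lambda>k. fst k \<otimes> numerator e (snd k)"
  have K: "finite ?K" "?K \<subseteq> carrier A \<times> carrier F" using u v by (auto simp: M_simps)
  have t: "?t k \<in> carrier A" if "k \<in> ?K" for k using that K(2) term_closed by auto
  have "cleared e (u + v) = (\<Oplus>k\<in>?K. [Poly_Mapping.lookup u k] \<cdot> ?t k \<oplus> [Poly_Mapping.lookup v k] \<cdot> ?t k)"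
    using cleared_superset[OF K(1) keys_add K(2), of e]
    by (simp add: lookup_add) (rule finsum_cong', use t in \<open>auto simp: add.int_pow_mult\<close>)
  also have "\<dots> = (\<Oplus>k\<in>?K. [Poly_Mapping.lookup u k] \<cdot> ?t k) \<oplus> (\<Oplus>k\<in>?K. [Poly_Mapping.lookup v k] \<cdot> ?t k)"
    using t by (intro finsum_addf) auto
  also have "\<dots> = cleared e u \<oplus> cleared e v"
    using cleared_superset[OF K(1) _ K(2), of u e] cleared_superset[OF K(1) _ K(2), of v e] by simp
  finally show ?thesis .
qed

lemma cleared_pair:
  assumes "a \<in> carrier A" "x \<in> carrier F"
  shows "cleared e (pair a x) = a \<otimes> numerator e x"
proof -
  have "cleared e (pair a x) = (\<Oplus>k\<in>{(a, x)}. [Poly_Mapping.lookup (pair a x) k] \<cdot> (fst k \<otimes> numerator e (snd k)))"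
    using assms by (intro cleared_superset) auto
  also have "\<dots> = a \<otimes> numerator e x" using assms term_closed[of a e x] by simp
  finally show ?thesis .
qed

lemma cleared_zero: "cleared e 0 = \<zero>" by (simp add: cleared_def)

lemma cleared_minus:
  assumes "u \<in> carrier M" shows "cleared e (- u) = \<ominus> cleared e u"
proof -
  have "- u \<in> carrier M" using assms M.a_inv_closed[OF assms] by (simp add: M_a_inv)
  moreover have "cleared e (- u) \<oplus> cleared e u = \<zero>"
    using cleared_add[of "- u" u e] assms calculation by (simp add: cleared_zero)
  ultimately show ?thesis using assms cleared_closed minus_equality by metis
qed

lemma cleared_diff:
  "\<lbrakk>u \<in> carrier M; v \<in> carrier M\<rbrakk> \<Longrightarrow> cleared e (u - v) = cleared e u \<ominus> cleared e v"
  using cleared_add[of u "- v" e] cleared_minus[of v e] M.a_inv_closed[of v]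
  by (simp add: M_a_inv a_minus_def)

text \<open>Once \<open>e\<close> is a multiple of the denominators that occur in a relation, taking numerators over \<open>e\<close> is
additive and linear over the center on these fractions, so the relation becomes an identity in \<open>A\<close>.\<close>

lemma cleared_relation:
  assumes "r \<in> rels"
  shows "\<exists>d\<in>denominators. \<forall>f\<in>denominators. cleared (d \<otimes> f) r = \<zero>"
  using assms
proof (cases rule: rels_cases)
  case (left a a' x)
  then show ?thesis using numerator_closed in_A one_denominators
    by (auto simp: cleared_diff cleared_pair pair_closed diff_closed l_distr a_minus_def a_ac r_neg r_neg1
        intro!: bexI[of _ \<one>])
next
  case (right a x x')
  obtain n d where x: "n \<in> carrier (center A)" "d \<in> denominators" "x = frac n d" using frac_cases right by metis
  obtain n' d' where x': "n' \<in> carrier (center A)" "d' \<in> denominators" "x' = frac n' d'" using frac_cases right by metis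
  have "cleared (d \<otimes> d' \<otimes> f) r = \<zero>" if f: "f \<in> denominators" for f
  proof -
    have e: "d \<otimes> d' \<otimes> f = d \<otimes> (d' \<otimes> f)" "d \<otimes> d' \<otimes> f = d' \<otimes> (d \<otimes> f)"
      using x x' f center_comm[of d d'] by (simp_all add: denominatorsD m_assoc[symmetric]) 
    have "numerator (d \<otimes> d' \<otimes> f) x = n \<otimes> (d' \<otimes> f)"
      unfolding e(1) x(3) using x x' f by (intro numerator_frac_multiple denominators_mult)
    moreover have "numerator (d \<otimes> d' \<otimes> f) x' = n' \<otimes> (d \<otimes> f)"
      unfolding e(2) x'(3) using x x' f by (intro numerator_frac_multiple denominators_mult)
    moreover have "numerator (d \<otimes> d' \<otimes> f) (x \<oplus>\<^bsub>F\<^esub> x') = (n \<otimes> d' \<oplus> n' \<otimes> d) \<otimes> f"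
      unfolding x(3) x'(3) using x x' f
      by (simp add: frac_add) (intro numerator_frac_multiple denominators_mult Z_closed, auto simp: denominatorsD)
    ultimately have "a \<otimes> numerator (d \<otimes> d' \<otimes> f) (x \<oplus>\<^bsub>F\<^esub> x')
        = a \<otimes> numerator (d \<otimes> d' \<otimes> f) x \<oplus> a \<otimes> numerator (d \<otimes> d' \<otimes> f) x'"
      using right x x' f by (simp add: denominatorsD in_A l_distr r_distr m_assoc)
    then show ?thesis using right term_closed[OF right(2)]
      by (simp add: cleared_diff cleared_pair pair_closed diff_closed a_minus_def a_ac r_neg r_neg1)
  qed
  then show ?thesis using denominators_mult x x' by blast
next
  case (middle a z x)
  obtain n d where x: "n \<in> carrier (center A)" "d \<in> denominators" "x = frac n d" using frac_cases middle by metis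
  have "cleared (d \<otimes> f) r = \<zero>" if f: "f \<in> denominators" for f
  proof -
    have "frac z \<one> \<otimes>\<^bsub>F\<^esub> x = frac (z \<otimes> n) d"
      using x middle one_denominators by (simp add: frac_mult denominatorsD)
    then have "numerator (d \<otimes> f) (frac z \<one> \<otimes>\<^bsub>F\<^esub> x) = (z \<otimes> n) \<otimes> f"
      using x f middle by (simp add: numerator_frac_multiple Z_closed)
    moreover have "numerator (d \<otimes> f) x = n \<otimes> f" using x f by (simp add: numerator_frac_multiple)
    moreover have "frac z \<one> \<otimes>\<^bsub>F\<^esub> x \<in> carrier F" using frac_one_closed middle by simp
    ultimately show ?thesis using middle x f
      by (simp add: cleared_diff cleared_pair pair_closed diff_closed in_A denominatorsD m_assoc a_minus_def r_neg)
  qed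
  then show ?thesis using x by blast
qed

text \<open>The denominator depends on the element of \<open>I\<close>, which involves finitely many relations: their
denominators are multiplied.  Allowing all multiples \<open>d \<otimes> f\<close> makes this induction work.  The result replaces
the construction of a localized module as a target in which elements of the tensor product can be told apart.\<close>

lemma cleared_vanishes:
  assumes "u \<in> I"
  shows "\<exists>d\<in>denominators. \<forall>f\<in>denominators. cleared (d \<otimes> f) u = \<zero>"
  using assms
proof (induction rule: I_induct)
  case zero
  then show ?case using one_denominators by (auto simp: cleared_zero)
next
  case (rel r)
  then show ?case by (rule cleared_relation)
next
  case (add u v)
  then obtain d d' where d: "d \<in> denominators" "\<forall>f\<in>denominators. cleared (d \<otimes> f) u = \<zero>"
    and d': "d' \<in> denominators" "\<forall>f\<in>denominators. cleared (d' \<otimes> f) v = \<zero>" by blast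
  have "cleared (d \<otimes> d' \<otimes> f) (u + v) = \<zero>" if f: "f \<in> denominators" for f
  proof -
    have e: "d \<otimes> d' \<otimes> f = d \<otimes> (d' \<otimes> f)" "d \<otimes> d' \<otimes> f = d' \<otimes> (d \<otimes> f)"
      using d d' f center_comm[of d d'] by (simp_all add: denominatorsD m_assoc[symmetric])
    have "cleared (d \<otimes> d' \<otimes> f) u = \<zero>" unfolding e(1) using d d' f denominators_mult by blast
    moreover have "cleared (d \<otimes> d' \<otimes> f) v = \<zero>" unfolding e(2) using d d' f denominators_mult by blast
    ultimately show ?thesis using add I_carrier by (simp add: cleared_add)
  qed
  then show ?case using denominators_mult d d' by blast
next
  case (minus u)
  then obtain d where d: "d \<in> denominators" "\<forall>f\<in>denominators. cleared (d \<otimes> f) u = \<zero>" by blast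
  have "cleared (d \<otimes> f) (- u) = \<zero>" if "f \<in> denominators" for f
    using d(2) that I_carrier[OF minus.hyps] by (simp add: cleared_minus)
  then show ?case using d(1) by blast
qed

abbreviation tensor :: "'a \<Rightarrow> ('a \<times> 'a) set \<Rightarrow> ('a \<times> ('a \<times> 'a) set \<Rightarrow>\<^sub>0 int) set" where
  "tensor \<equiv> central_tensor A"

abbreviation "Q \<equiv> central_quotient_ring A"

lemma tensor_coset: "tensor a x = I +>\<^bsub>M\<^esub> pair a x"
  by (simp add: central_tensor_def pure_tensor_def)

lemma Q_def: "Q = M Quot I"
  by (simp add: central_quotient_ring_def tensor_product_def)

lemma Q_ring: "ring Q" unfolding Q_def by (rule I.quotient_is_ring)

sublocale Q: ring Q by (rule Q_ring)

lemma tensor_mult: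
  "\<lbrakk>a \<in> carrier A; b \<in> carrier A; x \<in> carrier F; y \<in> carrier F\<rbrakk>
    \<Longrightarrow> tensor a x \<otimes>\<^bsub>Q\<^esub> tensor b y = tensor (a \<otimes> b) (x \<otimes>\<^bsub>F\<^esub> y)"
  by (simp add: tensor_coset Q_def FactRing_def I.rcoset_mult_add pair_closed pair_mult)

lemma tensor_closed: "\<lbrakk>a \<in> carrier A; x \<in> carrier F\<rbrakk> \<Longrightarrow> tensor a x \<in> carrier Q"
  by (simp add: tensor_coset Q_def FactRing_def pair_closed M.a_rcosetsI I.a_subset)

lemma tensor_eqI:
  assumes "u - v \<in> I" "u \<in> carrier M" "v \<in> carrier M"
  shows "I +>\<^bsub>M\<^esub> u = I +>\<^bsub>M\<^esub> v"
  using M.quotient_eq_iff_same_a_r_cos[OF I_ideal, of u v] assms by (simp add: M_minus)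

lemma tensor_add_left:
  assumes "a \<in> carrier A" "b \<in> carrier A" "x \<in> carrier F"
  shows "tensor (a \<oplus> b) x = tensor a x \<oplus>\<^bsub>Q\<^esub> tensor b x"
proof -
  have "tensor a x \<oplus>\<^bsub>Q\<^esub> tensor b x = I +>\<^bsub>M\<^esub> (pair a x + pair b x)"
    using I.a_rcos_sum[of "pair a x" "pair b x"] assms
    by (simp add: tensor_coset Q_def FactRing_def pair_closed) (simp add: M_simps)
  moreover have "pair (a \<oplus> b) x - (pair a x + pair b x) \<in> I"
    using rels_in_I[OF rels_intros(1)[OF assms]] by (simp add: algebra_simps)
  moreover have "pair a x + pair b x \<in> carrier M"
    using M.a_closed[of "pair a x" "pair b x"] assms pair_closed by (simp add: M_simps)
  ultimately show ?thesis using tensor_eqI assms pair_closed by (simp add: tensor_coset)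
qed

lemma tensor_diff_left:
  assumes "a \<in> carrier A" "b \<in> carrier A" "x \<in> carrier F"
  shows "tensor (a \<ominus> b) x = tensor a x \<ominus>\<^bsub>Q\<^esub> tensor b x"
proof -
  have "tensor (a \<ominus> b) x \<oplus>\<^bsub>Q\<^esub> tensor b x = tensor a x"
    using assms by (simp add: tensor_add_left[symmetric] a_minus_def a_assoc l_neg)
  then show ?thesis using assms Q.a_inv_closed
    by (metis Q.add.inv_solve_right' Q.minus_eq minus_closed tensor_closed)
qed

lemma tensor_center:
  assumes "a \<in> carrier A" "z \<in> carrier (center A)" "x \<in> carrier F"
  shows "tensor (a \<otimes> z) x = tensor a (frac z \<one> \<otimes>\<^bsub>F\<^esub> x)"
  unfolding tensor_coset using assms frac_one_closed
  by (intro tensor_eqI rels_in_I rels_intros(3) pair_closed) (auto simp: in_A)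

text \<open>This contains the injectivity of \<open>a \<mapsto> a \<otimes> 1\<close>.  The two sides are cleared with the denominator
\<open>d s t\<close>, and \<open>d\<close> is cancelled in the domain \<open>A\<close>.\<close>

lemma tensor_eq_imp:
  assumes a: "a \<in> carrier A" "s \<in> denominators" and b: "b \<in> carrier A" "t \<in> denominators"
    and eq: "tensor a (frac \<one> s) = tensor b (frac \<one> t)"
  shows "a \<otimes> t = b \<otimes> s"
proof -
  have F: "frac \<one> s \<in> carrier F" "frac \<one> t \<in> carrier F"
    using a b one_denominators by (auto intro: frac_closed denominatorsD)
  have "pair a (frac \<one> s) - pair b (frac \<one> t) \<in> I"
    using M.quotient_eq_iff_same_a_r_cos[OF I_ideal, of "pair a (frac \<one> s)" "pair b (frac \<one> t)"]
      eq a b F pair_closed by (simp add: tensor_coset M_minus)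
  from cleared_vanishes[OF this] obtain d where d: "d \<in> denominators"
    "\<forall>f\<in>denominators. cleared (d \<otimes> f) (pair a (frac \<one> s) - pair b (frac \<one> t)) = \<zero>"
    by (elim bexE)
  have one: "\<one> \<in> carrier (center A)" using one_denominators by (rule denominatorsD)
  have comm: "d \<otimes> (s \<otimes> t) = s \<otimes> (d \<otimes> t)" "d \<otimes> (s \<otimes> t) = t \<otimes> (d \<otimes> s)"
    using Z.m_lcomm[of d s t] Z.m_lcomm[of d t s] Z.m_comm[of s t] d a b by (simp_all add: denominatorsD)
  have "numerator (d \<otimes> (s \<otimes> t)) (frac \<one> s) = d \<otimes> t"
    unfolding comm(1) using numerator_frac_multiple[OF one a(2), of "d \<otimes> t"] d(1) a b
    by (simp add: denominators_mult denominatorsD)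
  moreover have "numerator (d \<otimes> (s \<otimes> t)) (frac \<one> t) = d \<otimes> s"
    unfolding comm(2) using numerator_frac_multiple[OF one b(2), of "d \<otimes> s"] d(1) a b
    by (simp add: denominators_mult denominatorsD)
  ultimately have "a \<otimes> (d \<otimes> t) \<ominus> b \<otimes> (d \<otimes> s) = \<zero>"
    using bspec[OF d(2) denominators_mult[OF a(2) b(2)]] a b F by (simp add: cleared_diff cleared_pair pair_closed)
  then have "a \<otimes> (d \<otimes> t) = b \<otimes> (d \<otimes> s)" using a b d by (simp add: denominatorsD)
  moreover have "a \<otimes> (d \<otimes> t) = d \<otimes> (a \<otimes> t)" "b \<otimes> (d \<otimes> s) = d \<otimes> (b \<otimes> s)"
    using center_lcomm[of d a t] center_lcomm[of d b s] a b d(1) by (simp_all add: denominatorsD)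
  ultimately have "d \<otimes> (a \<otimes> t) = d \<otimes> (b \<otimes> s)" by simp
  then show ?thesis
    by (rule left_cancel[rotated -1]) (use a b d(1) in \<open>auto simp: denominatorsD\<close>)
qed

lemma tensor_pow:
  assumes a: "a \<in> carrier A" and z: "z \<in> denominators"
  shows "z [^] n \<in> denominators" "tensor a (frac \<one> z) [^]\<^bsub>Q\<^esub> n = tensor (a [^] n) (frac \<one> (z [^] (n::nat)))"
proof -
  have one: "\<one> \<in> carrier (center A)" using one_denominators by (rule denominatorsD)
  have "z [^] n \<in> denominators \<and> tensor a (frac \<one> z) [^]\<^bsub>Q\<^esub> n = tensor (a [^] n) (frac \<one> (z [^] n))"
  proof (induction n)
    case 0
    have "\<one>\<^bsub>M\<^esub> = pair \<one> \<one>\<^bsub>F\<^esub>" by (simp add: monoid_algebra_def)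
    then show ?case using one_denominators by (simp add: Q_def FactRing_def tensor_coset frac_one)
  next
    case (Suc n)
    then have "tensor a (frac \<one> z) [^]\<^bsub>Q\<^esub> Suc n = tensor (a [^] n \<otimes> a) (frac \<one> (z [^] n) \<otimes>\<^bsub>F\<^esub> frac \<one> z)"
      using a z one by (simp add: tensor_mult frac_closed)
    then show ?case using Suc z one by (simp add: frac_mult denominators_mult)
  qed
  then show "z [^] n \<in> denominators" "tensor a (frac \<one> z) [^]\<^bsub>Q\<^esub> n = tensor (a [^] n) (frac \<one> (z [^] n))" by auto
qed

lemma inverse_multiple_alt:
  assumes "z \<in> denominators"
  shows "inverse_multiple A z = (\<lambda>a. tensor a (frac \<one> z)) ` carrier A"
proof -
  have one: "\<one> \<in> carrier (center A)" using one_denominators by (rule denominatorsD)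
  have "tensor \<one> (frac \<one> z) \<otimes>\<^bsub>Q\<^esub> tensor a \<one>\<^bsub>F\<^esub> = tensor a (frac \<one> z)" if "a \<in> carrier A" for a
    using that assms one frac_closed[OF one assms] by (simp add: tensor_mult)
  then show ?thesis
    unfolding inverse_multiple_def embedded_order_def image_image center_fraction_def
    by (intro image_cong) simp_all
qed

text \<open>The set \<open>P\<close> of numerators over \<open>z\<close> translates the conditions on \<open>B\<close> into conditions inside \<open>A\<close>.  For the powers,
\<open>(z\<inverse> a)\<^sup>n \<in> B\<close> has the form \<open>z\<inverse> w\<close>, and \<open>z\<^bsup>-n\<^esup> a\<^sup>n = z\<inverse> w\<close> is multiplied by all denominators.\<close>

lemma between_orders_closure:
  assumes B: "subring B Q" "embedded_order A \<subseteq> B" "B \<subseteq> inverse_multiple A z" and z: "z \<in> denominators"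
  defines "P \<equiv> {a \<in> carrier A. tensor a (frac \<one> z) \<in> B}"
  shows "\<lbrakk>a \<in> P; b \<in> P\<rbrakk> \<Longrightarrow> a \<ominus> b \<in> P"
    and "c \<in> carrier A \<Longrightarrow> c \<otimes> z \<in> P"
    and "a \<in> P \<Longrightarrow> \<exists>w\<in>carrier A. a [^] (n::nat) \<otimes> z = w \<otimes> z [^] n"
    and "P \<subseteq> {c \<otimes> z | c. c \<in> carrier A} \<Longrightarrow> B = embedded_order A"
proof -
  have one: "\<one> \<in> carrier (center A)" using one_denominators by (rule denominatorsD)
  have F: "frac \<one> z \<in> carrier F" using one z by (rule frac_closed)
  have multiple: "tensor (c \<otimes> z) (frac \<one> z) = tensor c \<one>\<^bsub>F\<^esub>" if "c \<in> carrier A" for c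
  proof -
    have "frac z \<one> \<otimes>\<^bsub>F\<^esub> frac \<one> z = \<one>\<^bsub>F\<^esub>"
      using one z one_denominators by (simp add: frac_mult frac_one frac_eq_iff denominatorsD)
    then show ?thesis using that z F by (simp add: tensor_center denominatorsD)
  qed
  show "a \<ominus> b \<in> P" if "a \<in> P" "b \<in> P"
    using that subringE(5,7)[OF B(1)] F by (simp add: P_def tensor_diff_left Q.minus_eq)
  show "c \<otimes> z \<in> P" if "c \<in> carrier A"
    using that B(2) z multiple by (auto simp: P_def embedded_order_def denominatorsD)
  show "\<exists>w\<in>carrier A. a [^] n \<otimes> z = w \<otimes> z [^] n" if a: "a \<in> P"
  proof -
    have "tensor a (frac \<one> z) [^]\<^bsub>Q\<^esub> n \<in> B"
      by (induction n) (use a subringE(3,6)[OF B(1)] in \<open>auto simp: P_def\<close>)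
    then obtain w where w: "w \<in> carrier A" "tensor (a [^] n) (frac \<one> (z [^] n)) = tensor w (frac \<one> z)"
      using B(3) a z tensor_pow[of a z n] by (auto simp: P_def inverse_multiple_alt)
    have "a [^] n \<otimes> z = w \<otimes> z [^] n"
      using tensor_eq_imp[OF _ _ _ _ w(2)] a w z tensor_pow[of a z n] by (simp add: P_def)
    then show ?thesis using w by blast
  qed
  show "B = embedded_order A" if P: "P \<subseteq> {c \<otimes> z | c. c \<in> carrier A}"
  proof
    show "B \<subseteq> embedded_order A"
    proof
      fix b assume b: "b \<in> B"
      then obtain a where a: "a \<in> carrier A" "b = tensor a (frac \<one> z)"
        using B(3) z inverse_multiple_alt by blast
      then have "a \<in> P" using b by (simp add: P_def)
      then obtain c where "c \<in> carrier A" "a = c \<otimes> z" using P by blast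
      then show "b \<in> embedded_order A" using a multiple by (auto simp: embedded_order_def)
    qed
  qed (rule B(2))
qed

end

text \<open>A description of maximality that refers to \<open>A\<close> alone and not to its ring of central fractions.\<close>

theorem maximal_order_criterion:
  fixes A :: "('a, 'm) ring_scheme" (structure)
  assumes A: "noncomm_domain A" "finite_over_center A"
    and divide: "\<And>z P a. \<lbrakk>z \<in> carrier (center A); z \<noteq> \<zero>; P \<subseteq> carrier A;
      \<And>a b. \<lbrakk>a \<in> P; b \<in> P\<rbrakk> \<Longrightarrow> a \<ominus> b \<in> P; \<And>c. c \<in> carrier A \<Longrightarrow> c \<otimes> z \<in> P;
      \<And>a n. a \<in> P \<Longrightarrow> \<exists>w\<in>carrier A. a [^] (n::nat) \<otimes> z = w \<otimes> z [^] n; a \<in> P\<rbrakk>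
        \<Longrightarrow> \<exists>c\<in>carrier A. a = c \<otimes> z"
  shows "maximal_order A"
proof -
  interpret central_localization A by unfold_locales (rule A(1))
  have "B = embedded_order A"
    if B: "subring B Q" "embedded_order A \<subseteq> B" "B \<subseteq> inverse_multiple A z"
      and z: "z \<in> carrier (center A) - {\<zero>}" for B z
  proof -
    have z_denominator: "z \<in> denominators" using z by (simp add: denominators_def)
    note closure = between_orders_closure[OF B z_denominator]
    let ?P = "{a \<in> carrier A. tensor a (frac \<one> z) \<in> B}"
    have "\<exists>c\<in>carrier A. a = c \<otimes> z" if "a \<in> ?P" for a
      by (rule divide[of z ?P]) (use z that closure(1-3) in blast)+
    then show ?thesis by (intro closure(4)) blast
  qed
  then show ?thesis using A unfolding maximal_order_def by blast
qed

section \<open>Words and the relations of the quantum torus\<close>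

primrec letter_degree :: "nat \<Rightarrow> letter \<Rightarrow> int vec" where
  "letter_degree p (Pos i) = unit_vec p i"
| "letter_degree p (Neg i) = - unit_vec p i"

primrec word_degree :: "nat \<Rightarrow> letter list \<Rightarrow> int vec" where
  "word_degree p [] = 0\<^sub>v p"
| "word_degree p (a # w) = letter_degree p a + word_degree p w"

text \<open>The scalar \<open>c\<close> for which a word of degree \<open>k\<close> evaluates to \<open>c X\<^sup>k\<close>.\<close>

primrec word_coeff :: "nat \<Rightarrow> int mat \<Rightarrow> complex \<Rightarrow> letter list \<Rightarrow> complex" where
  "word_coeff p U s [] = 1"
| "word_coeff p U s (a # w) = torus_twist p U s (letter_degree p a) (word_degree p w) * word_coeff p U s w"

primrec inverse_letter :: "letter \<Rightarrow> letter" where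
  "inverse_letter (Pos i) = Neg i"
| "inverse_letter (Neg i) = Pos i"

primrec letter_index :: "letter \<Rightarrow> nat" where
  "letter_index (Pos i) = i"
| "letter_index (Neg i) = i"

lemma letter_degree_carrier [simp]: "letter_degree p a \<in> carrier_vec p"
  by (cases a) auto

lemma word_degree_carrier [simp]: "word_degree p w \<in> carrier_vec p"
  by (induction w) auto

lemma dim_word_degree [simp]: "dim_vec (word_degree p w) = p"
  by (rule carrier_vecD) simp

lemma word_degree_append: "word_degree p (u @ v) = word_degree p u + word_degree p v"
proof (induction u)
  case (Cons a u)
  then show ?case using assoc_add_vec[of "letter_degree p a" p "word_degree p u" "word_degree p v"] by simp
qed simp

lemma torus_twist_nonzero: "s \<noteq> 0 \<Longrightarrow> torus_twist p U s k l \<noteq> 0"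
  by (simp add: torus_twist_def)

lemma torus_twist_add:
  assumes "s \<noteq> 0"
  shows "\<lbrakk>k \<in> carrier_vec p; k' \<in> carrier_vec p\<rbrakk>
      \<Longrightarrow> torus_twist p U s (k + k') l = torus_twist p U s k l * torus_twist p U s k' l"
    and "\<lbrakk>l \<in> carrier_vec p; l' \<in> carrier_vec p\<rbrakk>
      \<Longrightarrow> torus_twist p U s k (l + l') = torus_twist p U s k l * torus_twist p U s k l'"
  using assms by (simp_all add: torus_twist_def torus_form_add_left torus_form_add_right power_int_add)

lemma torus_twist_zero [simp]: "torus_twist p U s (0\<^sub>v p) l = 1" "torus_twist p U s k (0\<^sub>v p) = 1"
  by (simp_all add: torus_twist_def torus_form_zero)

lemma word_coeff_append:
  assumes "s \<noteq> 0"
  shows "word_coeff p U s (u @ v)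
    = word_coeff p U s u * word_coeff p U s v * torus_twist p U s (word_degree p u) (word_degree p v)"
proof (induction u)
  case (Cons a u)
  then show ?case using assms by (simp add: word_degree_append torus_twist_add)
qed simp

lemma word_coeff_nonzero: "s \<noteq> 0 \<Longrightarrow> word_coeff p U s w \<noteq> 0"
  by (induction w) (auto simp: torus_twist_nonzero)

locale normalized_quantum_torus =
  fixes p :: nat and U :: "int mat" and \<xi> s :: complex
  assumes U: "U \<in> carrier_mat p p" "transpose_mat U = - U"
    and \<xi>: "\<xi> \<noteq> 0" and s: "s\<^sup>2 = \<xi>"
begin

lemma s_nonzero: "s \<noteq> 0" using s \<xi> by auto

lemma U_antisym: "\<lbrakk>i < p; j < p\<rbrakk> \<Longrightarrow> U $$ (j, i) = - U $$ (i, j)"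
  using arg_cong[OF U(2), of "\<lambda>M. M $$ (i, j)"] U(1) by auto

lemma form_antisym: "torus_form p U l k = - torus_form p U k l"
proof -
  have "torus_form p U l k = (\<Sum>j<p. \<Sum>i<p. l $ i * k $ j * U $$ (i, j))"
    unfolding torus_form_def by (rule sum.swap)
  also have "\<dots> = (\<Sum>j<p. \<Sum>i<p. - (k $ j * l $ i * U $$ (j, i)))"
  proof (intro sum.cong refl)
    fix j i assume "j \<in> {..<p}" "i \<in> {..<p}"
    then show "l $ i * k $ j * U $$ (i, j) = - (k $ j * l $ i * U $$ (j, i))"
      using U_antisym[of i j] by simp
  qed
  finally show ?thesis by (simp add: torus_form_def sum_negf)
qed

lemma form_self: "torus_form p U k k = 0"
  using form_antisym[of k k] by simp

lemma form_unit_vec: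
  assumes "i < p" "j < p" shows "torus_form p U (unit_vec p i) (unit_vec p j) = U $$ (i, j)"
proof -
  have "torus_form p U (unit_vec p i) (unit_vec p j)
      = (\<Sum>i'<p. if i' = i then (\<Sum>j'<p. if j' = j then U $$ (i', j') else 0) else 0)"
    unfolding torus_form_def using assms by (intro sum.cong refl) (auto intro!: sum.cong simp del: sum.delta sum.delta')
  then show ?thesis using assms by (simp add: sum.delta)
qed

lemma form_uminus_right: "l \<in> carrier_vec p \<Longrightarrow> torus_form p U k (- l) = - torus_form p U k l"
  by (simp add: torus_form_def sum_negf)

lemma form_uminus_left: "k \<in> carrier_vec p \<Longrightarrow> torus_form p U (- k) l = - torus_form p U k l"
  by (simp add: torus_form_def sum_negf)

abbreviation "FA \<equiv> free_algebra p"
abbreviation "QT \<equiv> quantum_torus p U \<xi>"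
abbreviation "J \<equiv> torus_ideal p U \<xi>"
abbreviation "W \<equiv> twisted_algebra (exponent_monoid p (carrier_vec p)) (torus_twist p U s)"

text \<open>The letters are indexed by all natural numbers; only those below \<open>p\<close> belong to the free algebra.\<close>

definition valid :: "letter list \<Rightarrow> bool" where
  "valid w \<longleftrightarrow> w \<in> carrier (word_monoid p)"

lemma valid_simps [simp]:
  "valid []" "valid (u @ v) \<longleftrightarrow> valid u \<and> valid v"
  "valid (a # w) \<longleftrightarrow> letter_index a < p \<and> valid w"
  by (auto simp: valid_def word_monoid_def, (cases a; auto)+)

lemma word_monoid_monoid: "monoid (word_monoid p)"
  by (rule monoidI) (auto simp: word_monoid_def)

sublocale WM: twisted_monoid "word_monoid p" "\<lambda>_ _. 1 :: complex"
  by (rule monoid_algebra_twisted_monoid[OF word_monoid_monoid])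

lemma FA_twisted: "FA = twisted_algebra (word_monoid p) (\<lambda>_ _. 1)"
  by (simp add: free_algebra_def monoid_algebra_is_twisted)

sublocale FA: ring FA unfolding FA_twisted by (rule WM.twisted_algebra_ring)

lemma FA_simps:
  "f \<in> carrier FA \<longleftrightarrow> (\<forall>w\<in>Poly_Mapping.keys f. valid w)"
  "\<zero>\<^bsub>FA\<^esub> = 0" "f \<oplus>\<^bsub>FA\<^esub> g = f + g" "\<one>\<^bsub>FA\<^esub> = word 1 []"
  by (auto simp: FA_twisted valid_def word_monoid_def)

lemma word_closed: "valid w \<Longrightarrow> word c w \<in> carrier FA" by (simp add: FA_simps)

lemma word_mult: "word c u \<otimes>\<^bsub>FA\<^esub> word d v = word (c * d) (u @ v)"
  by (simp add: FA_twisted twisted_mult_single) (simp add: word_monoid_def)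

lemma FA_a_inv: "f \<in> carrier FA \<Longrightarrow> \<ominus>\<^bsub>FA\<^esub> f = - f"
  using WM.twisted_a_inv[of f] by (simp add: FA_twisted)

lemma FA_minus: "\<lbrakk>f \<in> carrier FA; g \<in> carrier FA\<rbrakk> \<Longrightarrow> f \<ominus>\<^bsub>FA\<^esub> g = f - g"
  by (simp add: FA.minus_eq FA_a_inv FA_simps)

lemma FA_diff_closed: "\<lbrakk>f \<in> carrier FA; g \<in> carrier FA\<rbrakk> \<Longrightarrow> f - g \<in> carrier FA"
  using FA.minus_closed[of f g] by (simp add: FA_minus)

lemma FA_mult_diff:
  assumes "f \<in> carrier FA" "g \<in> carrier FA" "h \<in> carrier FA"
  shows "h \<otimes>\<^bsub>FA\<^esub> (f - g) = h \<otimes>\<^bsub>FA\<^esub> f - h \<otimes>\<^bsub>FA\<^esub> g"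
    and "(f - g) \<otimes>\<^bsub>FA\<^esub> h = f \<otimes>\<^bsub>FA\<^esub> h - g \<otimes>\<^bsub>FA\<^esub> h"
proof -
  have "h \<otimes>\<^bsub>FA\<^esub> (f \<ominus>\<^bsub>FA\<^esub> g) = h \<otimes>\<^bsub>FA\<^esub> f \<ominus>\<^bsub>FA\<^esub> h \<otimes>\<^bsub>FA\<^esub> g"
    "(f \<ominus>\<^bsub>FA\<^esub> g) \<otimes>\<^bsub>FA\<^esub> h = f \<otimes>\<^bsub>FA\<^esub> h \<ominus>\<^bsub>FA\<^esub> g \<otimes>\<^bsub>FA\<^esub> h"
    using assms by (simp_all only: FA.minus_eq FA.r_distr FA.l_distr FA.r_minus FA.l_minus FA.a_inv_closed)
  then show "h \<otimes>\<^bsub>FA\<^esub> (f - g) = h \<otimes>\<^bsub>FA\<^esub> f - h \<otimes>\<^bsub>FA\<^esub> g"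
    "(f - g) \<otimes>\<^bsub>FA\<^esub> h = f \<otimes>\<^bsub>FA\<^esub> h - g \<otimes>\<^bsub>FA\<^esub> h"
    using assms by (simp_all only: FA_minus FA.m_closed)
qed

lemma relations_closed: "torus_relations p U \<xi> \<subseteq> carrier FA"
  by (auto simp: torus_relations_def intro!: FA_diff_closed word_closed)

lemma J_ideal: "ideal J FA"
  unfolding torus_ideal_def by (rule FA.genideal_ideal[OF relations_closed])

sublocale J: ideal J FA by (rule J_ideal)

lemma relations_in_J: "r \<in> torus_relations p U \<xi> \<Longrightarrow> r \<in> J"
  unfolding torus_ideal_def using FA.genideal_self[OF relations_closed] by blast

lemma J_carrier: "f \<in> J \<Longrightarrow> f \<in> carrier FA" using J.a_subset by blast

lemma J_add: "\<lbrakk>f \<in> J; g \<in> J\<rbrakk> \<Longrightarrow> f + g \<in> J"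
  using J.a_closed[of f g] by (simp add: FA_simps)

lemma J_zero: "0 \<in> J" using J.zero_closed by (simp add: FA_simps)

text \<open>Equality up to a nonzero scalar in the quantum torus.  The scalar is left unspecified, since
evaluating both words determines it afterwards.\<close>

definition proportional :: "letter list \<Rightarrow> letter list \<Rightarrow> bool" where
  "proportional u v \<longleftrightarrow> valid u \<and> valid v \<and> (\<exists>c. c \<noteq> 0 \<and> word 1 u - word c v \<in> J)"

lemma proportional_refl: "valid u \<Longrightarrow> proportional u u"
  unfolding proportional_def using J_zero by (intro conjI exI[of _ 1]) auto

lemma proportional_sym:
  assumes "proportional u v" shows "proportional v u"
proof -
  obtain c where c: "valid u" "valid v" "c \<noteq> 0" "word 1 u - word c v \<in> J"
    using assms by (auto simp: proportional_def)
  define d where "d = - 1 / c"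
  have "word d [] \<otimes>\<^bsub>FA\<^esub> (word 1 u - word c v) \<in> J"
    by (intro J.I_l_closed c word_closed) simp
  also have "word d [] \<otimes>\<^bsub>FA\<^esub> (word 1 u - word c v) = word d u - word (d * c) v"
    using c by (simp add: FA_mult_diff word_closed word_mult)
  also have "\<dots> = word 1 v - word (1 / c) u"
    using c(3) by (simp add: d_def single_uminus)
  finally show ?thesis using c unfolding proportional_def by (intro conjI exI[of _ "1 / c"]) auto
qed

lemma proportional_trans:
  assumes "proportional u v" "proportional v w" shows "proportional u w"
proof -
  obtain c d where c: "valid u" "valid v" "c \<noteq> 0" "word 1 u - word c v \<in> J"
    and d: "valid w" "d \<noteq> 0" "word 1 v - word d w \<in> J"
    using assms by (auto simp: proportional_def)
  have "word c [] \<otimes>\<^bsub>FA\<^esub> (word 1 v - word d w) \<in> J"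
    by (intro J.I_l_closed d word_closed) simp
  then have "word 1 u - word c v + word c [] \<otimes>\<^bsub>FA\<^esub> (word 1 v - word d w) \<in> J"
    using c J_add by blast
  also have "word 1 u - word c v + word c [] \<otimes>\<^bsub>FA\<^esub> (word 1 v - word d w) = word 1 u - word (c * d) w"
    using c d by (simp add: FA_mult_diff word_closed word_mult)
  finally show ?thesis using c d unfolding proportional_def by (intro conjI exI[of _ "c * d"]) auto
qed

lemma proportional_append:
  assumes "proportional u v" "valid x" "valid y" shows "proportional (x @ u @ y) (x @ v @ y)"
proof -
  obtain c where c: "valid u" "valid v" "c \<noteq> 0" "word 1 u - word c v \<in> J"
    using assms by (auto simp: proportional_def)
  have "word 1 x \<otimes>\<^bsub>FA\<^esub> (word 1 u - word c v) \<otimes>\<^bsub>FA\<^esub> word 1 y \<in> J"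
    by (intro J.I_l_closed J.I_r_closed c word_closed assms)
  also have "word 1 x \<otimes>\<^bsub>FA\<^esub> (word 1 u - word c v) \<otimes>\<^bsub>FA\<^esub> word 1 y
      = word 1 (x @ u @ y) - word c (x @ v @ y)"
    using c assms by (simp add: FA_mult_diff word_closed word_mult)
  finally show ?thesis using c assms unfolding proportional_def by (intro conjI exI[of _ c]) auto
qed

lemma proportional_inverse:
  assumes "valid [a]" shows "proportional [a, inverse_letter a] []"
proof -
  have "word 1 [a, inverse_letter a] - word 1 [] \<in> torus_relations p U \<xi>"
    using assms by (cases a) (auto simp: torus_relations_def)
  then show ?thesis using assms relations_in_J unfolding proportional_def
    by (cases a) (auto intro!: exI[of _ 1])
qed

lemma index_inverse [simp]: "letter_index (inverse_letter a) = letter_index a" by (cases a) auto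
lemma inverse_inverse [simp]: "inverse_letter (inverse_letter a) = a" by (cases a) auto

text \<open>Insert \<open>a a\<inverse>\<close> on the right of \<open>a\<inverse> b\<close>, exchange \<open>b\<close> and \<open>a\<close>, and cancel on the left.\<close>

lemma proportional_commute_inverse:
  assumes "valid [a]" "valid [b]" "proportional [a, b] [b, a]"
  shows "proportional [inverse_letter a, b] [b, inverse_letter a]"
proof -
  let ?a = "inverse_letter a"
  have v: "valid [?a, b]" "valid [b]" "valid [?a]" "valid [b, ?a]" "valid []" using assms by simp_all
  have "proportional ([?a, b] @ [a, ?a] @ []) ([?a, b] @ [] @ [])"
    by (intro proportional_append proportional_inverse assms v)
  moreover have "proportional ([?a] @ [a, b] @ [?a]) ([?a] @ [b, a] @ [?a])"
    by (intro proportional_append assms v)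
  moreover have "proportional ([] @ [?a, inverse_letter ?a] @ [b, ?a]) ([] @ [] @ [b, ?a])"
    by (intro proportional_append proportional_inverse v)
  ultimately have h: "proportional [?a, b, a, ?a] [?a, b]" "proportional [?a, a, b, ?a] [?a, b, a, ?a]"
    "proportional [?a, a, b, ?a] [b, ?a]" by simp_all
  show ?thesis
    using h proportional_sym proportional_trans by blast
qed

text \<open>The relations exchange two positive letters; inverse letters follow one at a time.\<close>

lemma proportional_commute:
  assumes "valid [a]" "valid [b]" shows "proportional [a, b] [b, a]"
proof -
  have pos: "proportional [Pos i, Pos j] [Pos j, Pos i]" if "i < p" "j < p" for i j
  proof -
    have "word 1 [Pos i, Pos j] - word (\<xi> powi (U $$ (i, j))) [Pos j, Pos i] \<in> torus_relations p U \<xi>"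
      using that by (auto simp: torus_relations_def)
    then show ?thesis using that \<xi> relations_in_J unfolding proportional_def
      by (intro conjI exI[of _ "\<xi> powi (U $$ (i, j))"]) auto
  qed
  have neg: "proportional [Neg i, Pos j] [Pos j, Neg i]" if "i < p" "j < p" for i j
    using proportional_commute_inverse[of "Pos i" "Pos j"] pos that by simp
  have negneg: "proportional [Neg j, Neg i] [Neg i, Neg j]" if "i < p" "j < p" for i j
    using proportional_commute_inverse[of "Pos j" "Neg i"] proportional_sym[OF neg] that by simp
  show ?thesis using assms pos neg negneg proportional_sym[OF neg] by (cases a; cases b) simp_all
qed

lemma proportional_move:
  "\<lbrakk>valid [a]; valid u; valid v\<rbrakk> \<Longrightarrow> proportional (a # u @ v) (u @ a # v)"
proof (induction u)
  case Nil
  then show ?case using proportional_refl[of "a # v"] by simp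
next
  case (Cons b u)
  then have val: "valid [b]" "valid u" by simp_all
  have "proportional ([] @ [a, b] @ u @ v) ([] @ [b, a] @ u @ v)"
    using Cons.prems val by (intro proportional_append proportional_commute) simp_all
  moreover have "proportional ([b] @ (a # u @ v) @ []) ([b] @ (u @ a # v) @ [])"
    using Cons val by (intro proportional_append) simp_all
  ultimately show ?case using proportional_trans by simp
qed

lemma proportional_perm:
  "\<lbrakk>valid u; valid v; mset u = mset v\<rbrakk> \<Longrightarrow> proportional u v"
proof (induction u arbitrary: v)
  case Nil
  then show ?case by (simp add: proportional_refl)
next
  case (Cons a u)
  then have "a \<in> set v" by (metis list.set_intros(1) mset_eq_setD)
  then obtain v1 v2 where v: "v = v1 @ a # v2" by (meson split_list)
  have val: "valid [a]" "valid u" "valid v1" "valid v2" using Cons.prems v by simp_all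
  have "proportional u (v1 @ v2)" using Cons.prems v val by (intro Cons.IH) simp_all
  then have "proportional ([a] @ u @ []) ([a] @ (v1 @ v2) @ [])"
    using val by (intro proportional_append) simp_all
  moreover have "proportional (a # v1 @ v2) (v1 @ a # v2)" using val by (intro proportional_move)
  ultimately show ?case using v proportional_trans by simp
qed

lemma proportional_cancel:
  assumes "valid w" "a \<in> set w" "inverse_letter a \<in> set w"
  shows "\<exists>w'. proportional w w' \<and> length w' < length w \<and> word_degree p w' = word_degree p w"
proof -
  have ne: "inverse_letter a \<noteq> a" by (cases a) auto
  define w1 where "w1 = remove1 a w"
  define w' where "w' = remove1 (inverse_letter a) w1"
  have w1: "mset w = add_mset a (mset w1)" using assms(2) by (simp add: w1_def)
  have "inverse_letter a \<in> set w1" using assms(3) ne by (simp add: w1_def in_set_remove1)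
  then have w': "mset w1 = add_mset (inverse_letter a) (mset w')" by (simp add: w'_def)
  let ?v = "[a, inverse_letter a] @ w'"
  have eq: "mset w = mset ?v" using w1 w' by simp
  have "set ?v = set w" using eq by (metis mset_eq_setD)
  then have val: "valid [a]" "valid w'" "valid ?v"
    using assms(1) unfolding valid_def word_monoid_def by auto
  have "proportional w ?v" using assms(1) val eq by (intro proportional_perm)
  moreover have "proportional ([] @ [a, inverse_letter a] @ w') ([] @ [] @ w')"
    using val by (intro proportional_append proportional_inverse) simp_all
  ultimately have "proportional w w'" using proportional_trans by simp
  moreover have "length w' < length w" using arg_cong[OF eq, of size] by simp
  moreover have "word_degree p w' = word_degree p w"
  proof -
    have perm: "word_degree p x = word_degree p y" if "mset x = mset y" for x y
      using that
    proof (induction x arbitrary: y)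
      case (Cons b x)
      then have "b \<in> set y" by (metis list.set_intros(1) mset_eq_setD)
      then obtain y1 y2 where y: "y = y1 @ b # y2" by (meson split_list)
      have "word_degree p x = word_degree p (y1 @ y2)" using Cons y by (intro Cons.IH) simp
      moreover have "letter_degree p b + (word_degree p y1 + word_degree p y2)
          = word_degree p y1 + (letter_degree p b + word_degree p y2)"
        by (intro eq_vecI) auto
      ultimately show ?case by (simp add: y word_degree_append)
    qed simp
    have "word_degree p w = word_degree p ?v" using perm[OF eq] .
    also have "\<dots> = word_degree p w'" by (cases a) (auto intro!: eq_vecI)
    finally show ?thesis ..
  qed
  ultimately show ?thesis by blast
qed

lemma word_degree_count:
  assumes "i < p" "valid w"
  shows "word_degree p w $ i = int (count (mset w) (Pos i)) - int (count (mset w) (Neg i))"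
  using assms(2)
proof (induction w)
  case (Cons a w)
  have "word_degree p (a # w) $ i = letter_degree p a $ i + word_degree p w $ i"
    using assms(1) by simp
  moreover have "valid [a]" "valid w" using Cons.prems by simp_all
  ultimately show ?case using Cons.IH assms(1) by (cases a) auto
qed (use assms(1) in simp)

text \<open>Up to scalars the letters commute, so a word that contains a letter together with its inverse can be shortened.
A word without such pairs is determined by its degree up to a permutation of its letters.\<close>

lemma proportional_if_same_degree:
  "\<lbrakk>valid u; valid v; word_degree p u = word_degree p v\<rbrakk> \<Longrightarrow> proportional u v"
proof (induction "length u + length v" arbitrary: u v rule: less_induct)
  case less
  show ?case
  proof (cases "\<exists>a. a \<in> set u \<and> inverse_letter a \<in> set u")
    case True
    then obtain u' where u': "proportional u u'" "length u' < length u" "word_degree p u' = word_degree p u"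
      using proportional_cancel less.prems by blast
    then have "proportional u' v" using less by (auto simp: proportional_def)
    then show ?thesis using u' proportional_trans by blast
  next
    case reduced_u: False
    show ?thesis
    proof (cases "\<exists>a. a \<in> set v \<and> inverse_letter a \<in> set v")
      case True
      then obtain v' where v': "proportional v v'" "length v' < length v" "word_degree p v' = word_degree p v"
        using proportional_cancel less.prems by blast
      then have "proportional u v'" using less by (auto simp: proportional_def)
      then show ?thesis using v' proportional_trans proportional_sym by blast
    next
      case reduced_v: False
      have zero: "count (mset w) (Pos i) = 0 \<or> count (mset w) (Neg i) = 0"
        if "\<not> (\<exists>a. a \<in> set w \<and> inverse_letter a \<in> set w)" for w i
        using that by (metis inverse_letter.simps(1) count_eq_zero_iff set_mset_mset)
      have "count (mset u) a = count (mset v) a" for a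
      proof -
        obtain i where i: "a = Pos i \<or> a = Neg i" by (cases a) auto
        show ?thesis
        proof (cases "i < p")
          case True
          have "int (count (mset u) (Pos i)) - int (count (mset u) (Neg i))
              = int (count (mset v) (Pos i)) - int (count (mset v) (Neg i))"
            using word_degree_count[OF True] less.prems by metis
          then have "count (mset u) (Pos i) = count (mset v) (Pos i)
              \<and> count (mset u) (Neg i) = count (mset v) (Neg i)"
            using zero[OF reduced_u, of i] zero[OF reduced_v, of i] by linarith
          then show ?thesis using i by auto
        next
          case False
          then have "a \<notin> set u" "a \<notin> set v"
            using i less.prems(1,2) by (auto simp: valid_def word_monoid_def)
          then show ?thesis by (metis count_eq_zero_iff set_mset_mset)
        qed
      qed
      then show ?thesis using less.prems by (intro proportional_perm multiset_eqI)
    qed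
  qed
qed

end

section \<open>The quantum torus as a twisted group algebra\<close>

lemma submonoid_carrier_vec: "submonoid (carrier_vec p) (monoid_vec TYPE(int) p)"
  by (rule submonoid.intro) (auto simp: monoid_vec_simps)

context normalized_quantum_torus
begin

sublocale V: ordered_twisted_monoid "exponent_monoid p (carrier_vec p)" "torus_twist p U s" "vec_less p (\<lambda>_. 0)"
  by (rule torus_ordered_twisted_monoid[OF submonoid_carrier_vec s_nonzero]) simp

lemma W_mult_single:
  "Poly_Mapping.single k a \<otimes>\<^bsub>W\<^esub> Poly_Mapping.single l b
    = Poly_Mapping.single (k + l) (torus_twist p U s k l * (a * b))"
  by (simp add: twisted_mult_single)

text \<open>The homomorphism from the free algebra to the twisted group algebra that sends \<open>x\<^sub>i\<close> to \<open>X\<^bsup>e\<^sub>i\<^esup>\<close>.\<close>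

definition evaluate :: "(letter list \<Rightarrow>\<^sub>0 complex) \<Rightarrow> (int vec \<Rightarrow>\<^sub>0 complex)" where
  "evaluate = monomial_substitution (word_degree p) (word_coeff p U s)"

lemma evaluate_hom: "evaluate \<in> Ring.ring_hom FA W"
  unfolding evaluate_def free_algebra_def
proof (rule monomial_substitution_hom[OF word_monoid_monoid V.twisted_monoid_axioms])
  show "word_degree p \<in> hom (word_monoid p) (exponent_monoid p (carrier_vec p))"
    by (rule homI) (auto simp: word_monoid_def word_degree_append)
qed (simp_all add: word_monoid_def word_coeff_append s_nonzero)

sublocale ev: ring_hom_ring FA W evaluate
  by (rule ring_hom_ringI2[OF FA.ring_axioms V.twisted_algebra_ring evaluate_hom])

lemma evaluate_word: "evaluate (word c w) = Poly_Mapping.single (word_degree p w) (c * word_coeff p U s w)"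
  by (simp add: evaluate_def monomial_substitution_single)

lemma evaluate_diff: "\<lbrakk>f \<in> carrier FA; g \<in> carrier FA\<rbrakk> \<Longrightarrow> evaluate (f - g) = evaluate f - evaluate g"
proof -
  assume fg: "f \<in> carrier FA" "g \<in> carrier FA"
  have "evaluate ((f - g) + g) = evaluate (f - g) + evaluate g"
    unfolding evaluate_def by (rule monomial_substitution_add)
  then show ?thesis by simp
qed

lemma evaluate_relation:
  assumes "r \<in> torus_relations p U \<xi>" shows "evaluate r = 0"
proof -
  have inverses: "unit_vec p i + - unit_vec p i = (0\<^sub>v p :: int vec)"
    "- unit_vec p i + unit_vec p i = (0\<^sub>v p :: int vec)" for i
    by (auto intro!: eq_vecI)
  have twist1: "torus_twist p U s (unit_vec p i) (- unit_vec p i) = 1"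
    "torus_twist p U s (- unit_vec p i) (unit_vec p i) = 1" for i
    by (simp_all add: torus_twist_def form_uminus_right form_uminus_left form_self)
  have commute: "unit_vec p j + unit_vec p i = (unit_vec p i + unit_vec p j :: int vec)" for i j
    by (rule comm_add_vec[of _ p]) auto
  have twist2: "torus_twist p U s (unit_vec p i) (unit_vec p j)
      = \<xi> powi (U $$ (i, j)) * torus_twist p U s (unit_vec p j) (unit_vec p i)"
    if "i < p" "j < p" for i j
  proof -
    have "\<xi> powi (U $$ (i, j)) = s powi (U $$ (i, j) + U $$ (i, j))"
      by (simp only: power_int_add[OF disjI1[OF s_nonzero]] s[symmetric] power2_eq_square
          power_int_mult_distrib)
    then have "\<xi> powi (U $$ (i, j)) * torus_twist p U s (unit_vec p j) (unit_vec p i)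
        = s powi (U $$ (i, j) + U $$ (i, j) + U $$ (j, i))"
      using s_nonzero by (simp add: torus_twist_def form_unit_vec that power_int_add)
    then show ?thesis using U_antisym[OF that] by (simp add: torus_twist_def form_unit_vec that)
  qed
  consider (right_inverse) i where "i < p" "r = word 1 [Pos i, Neg i] - word 1 []"
    | (left_inverse) i where "i < p" "r = word 1 [Neg i, Pos i] - word 1 []"
    | (commutation) i j where "i < p" "j < p"
        "r = word 1 [Pos i, Pos j] - word (\<xi> powi (U $$ (i, j))) [Pos j, Pos i]"
    using assms unfolding torus_relations_def by blast
  then show ?thesis
  proof cases
    case (commutation i j)
    then show ?thesis
      by (simp add: evaluate_diff word_closed evaluate_word commute[of j i] twist2[of i j])
  qed (simp_all add: evaluate_diff word_closed evaluate_word inverses twist1)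
qed

lemma mem_kernel_iff: "f \<in> a_kernel FA W evaluate \<longleftrightarrow> f \<in> carrier FA \<and> evaluate f = 0"
  unfolding a_kernel_def' mem_Collect_eq twisted_algebra_simps ..

text \<open>If the coefficients of \<open>f\<close> at the words of some degree cancel under evaluation, at least two words of
that degree occur in \<open>f\<close>.  They are proportional modulo the relations, so one of them can be
eliminated; induct on the number of words.\<close>

lemma kernel_evaluate: "a_kernel FA W evaluate = J"
proof
  have "torus_relations p U \<xi> \<subseteq> a_kernel FA W evaluate"
  proof
    fix r assume r: "r \<in> torus_relations p U \<xi>"
    show "r \<in> a_kernel FA W evaluate"
      unfolding mem_kernel_iff using evaluate_relation[OF r] subsetD[OF relations_closed r] by blast
  qed
  then show J_kernel: "J \<subseteq> a_kernel FA W evaluate"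
    unfolding torus_ideal_def by (intro FA.genideal_minimal ev.kernel_is_ideal)
  have "f \<in> J" if "f \<in> carrier FA" "evaluate f = 0" for f
    using that
  proof (induction "card (Poly_Mapping.keys f)" arbitrary: f rule: less_induct)
    case less
    show ?case
    proof (cases "f = 0")
      case True
      then show ?thesis using J_zero by simp
    next
      case False
      then obtain u where u: "u \<in> Poly_Mapping.keys f" by (metis keys_eq_empty ex_in_conv)
      have "\<exists>v\<in>Poly_Mapping.keys f. v \<noteq> u \<and> word_degree p v = word_degree p u"
      proof (rule ccontr)
        assume unique: "\<not> ?thesis"
        have "0 = Poly_Mapping.lookup (evaluate f) (word_degree p u)" using less.prems by simp
        also have "\<dots> = (\<Sum>w\<in>Poly_Mapping.keys f.
            if w = u then Poly_Mapping.lookup f w * word_coeff p U s w else 0)"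
          unfolding evaluate_def monomial_substitution_def lookup_sum lookup_single when_def
          by (intro sum.cong refl) (use unique in auto)
        also have "\<dots> = Poly_Mapping.lookup f u * word_coeff p U s u" using u by (simp add: sum.delta)
        finally show False using u word_coeff_nonzero[OF s_nonzero] by (simp add: in_keys_iff)
      qed
      then obtain v where v: "v \<in> Poly_Mapping.keys f" "v \<noteq> u" "word_degree p v = word_degree p u" by blast
      have valid: "valid u" "valid v" using u v less.prems by (auto simp: FA_simps)
      have "proportional u v" using valid v by (intro proportional_if_same_degree) simp_all
      then obtain c where c: "word 1 u - word c v \<in> J" by (auto simp: proportional_def)
      (* u is replaced by a multiple of v, which occurs in f already, so a key disappears *)
      define g where "g = word (Poly_Mapping.lookup f u) [] \<otimes>\<^bsub>FA\<^esub> (word 1 u - word c v)"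
      have gJ: "g \<in> J" unfolding g_def by (intro J.I_l_closed c word_closed) simp
      have g: "g = word (Poly_Mapping.lookup f u) u - word (Poly_Mapping.lookup f u * c) v"
        unfolding g_def using valid by (simp add: FA_mult_diff word_closed word_mult)
      have gker: "evaluate g = 0"
        using gJ J_kernel mem_kernel_iff by blast
      have "Poly_Mapping.keys (f - g) \<subseteq> Poly_Mapping.keys f - {u}"
        using v u by (auto simp: g in_keys_iff lookup_minus lookup_single when_def split: if_splits)
      then have "Poly_Mapping.keys (f - g) \<subset> Poly_Mapping.keys f" using u by blast
      then have "card (Poly_Mapping.keys (f - g)) < card (Poly_Mapping.keys f)"
        by (intro psubset_card_mono) auto
      moreover have "evaluate (f - g) = 0"
        using evaluate_diff[OF less.prems(1) J_carrier[OF gJ]] gker less.prems by simp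
      ultimately have "f - g \<in> J" using less.hyps FA_diff_closed J_carrier[OF gJ] less.prems by blast
      then show ?thesis using J_add[OF _ gJ, of "f - g"] by simp
    qed
  qed
  then show "a_kernel FA W evaluate \<subseteq> J" using mem_kernel_iff by blast
qed

text \<open>The isomorphism induced by the evaluation on the quotient by its kernel.\<close>

definition \<Phi> :: "(letter list \<Rightarrow>\<^sub>0 complex) set \<Rightarrow> (int vec \<Rightarrow>\<^sub>0 complex)" where
  "\<Phi> X = the_elem (evaluate ` X)"

lemma QT_def: "QT = FA Quot J"
  by (simp add: quantum_torus_def)

lemma QT_ring: "ring QT" unfolding QT_def by (rule J.quotient_is_ring)

sublocale QT: ring QT by (rule QT_ring)

lemma \<Phi>_hom: "\<Phi> \<in> Ring.ring_hom QT W"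
  using ev.the_elem_hom unfolding kernel_evaluate QT_def \<Phi>_def[abs_def] .

sublocale \<Phi>: ring_hom_ring QT W \<Phi>
  by (rule ring_hom_ringI2[OF QT_ring V.twisted_algebra_ring \<Phi>_hom])

lemma \<Phi>_inj: "inj_on \<Phi> (carrier QT)"
  using ev.the_elem_inj unfolding kernel_evaluate QT_def \<Phi>_def[abs_def] by (rule inj_onI)

lemma \<Phi>_coset: "f \<in> carrier FA \<Longrightarrow> \<Phi> (J +>\<^bsub>FA\<^esub> f) = evaluate f"
  using ev.the_elem_simp[of f] by (simp add: kernel_evaluate \<Phi>_def)

lemma coset_closed: "f \<in> carrier FA \<Longrightarrow> J +>\<^bsub>FA\<^esub> f \<in> carrier QT"
  by (simp add: QT_def FactRing_def FA.a_rcosetsI J.a_subset)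

lemma torus_const_closed: "torus_const p U \<xi> c \<in> carrier QT"
  and \<Phi>_const: "\<Phi> (torus_const p U \<xi> c) = Poly_Mapping.single (0\<^sub>v p) c"
  by (simp_all add: torus_const_def coset_closed word_closed \<Phi>_coset evaluate_word)

lemma torus_gen_closed: "i < p \<Longrightarrow> torus_gen p U \<xi> i \<in> carrier QT"
  and \<Phi>_gen: "i < p \<Longrightarrow> \<Phi> (torus_gen p U \<xi> i) = Poly_Mapping.single (unit_vec p i) 1"
  by (simp_all add: torus_gen_def coset_closed word_closed \<Phi>_coset evaluate_word)

lemma torus_gen_unit:
  assumes "i < p" shows "torus_gen p U \<xi> i \<in> Units QT"
proof -
  let ?y = "J +>\<^bsub>FA\<^esub> word 1 [Neg i]"
  have y: "?y \<in> carrier QT" using assms by (simp add: coset_closed word_closed)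
  have coset_mult: "(J +>\<^bsub>FA\<^esub> word 1 u) \<otimes>\<^bsub>QT\<^esub> (J +>\<^bsub>FA\<^esub> word 1 v) = J +>\<^bsub>FA\<^esub> word 1 (u @ v)"
    if "valid u" "valid v" for u v
    using that by (simp add: QT_def FactRing_def J.rcoset_mult_add word_closed word_mult)
  have "word 1 [Pos i, Neg i] - word 1 [] \<in> J" "word 1 [Neg i, Pos i] - word 1 [] \<in> J"
    using assms by (auto intro!: relations_in_J simp: torus_relations_def)
  then have "J +>\<^bsub>FA\<^esub> word 1 [Pos i, Neg i] = \<one>\<^bsub>QT\<^esub>" "J +>\<^bsub>FA\<^esub> word 1 [Neg i, Pos i] = \<one>\<^bsub>QT\<^esub>"
    using FA.quotient_eq_iff_same_a_r_cos[OF J_ideal, of "word 1 [Pos i, Neg i]" "word 1 []"]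
      FA.quotient_eq_iff_same_a_r_cos[OF J_ideal, of "word 1 [Neg i, Pos i]" "word 1 []"] assms
    by (simp_all add: FA_minus word_closed QT_def FactRing_def FA_simps(4))
  then have "torus_gen p U \<xi> i \<otimes>\<^bsub>QT\<^esub> ?y = \<one>\<^bsub>QT\<^esub>" "?y \<otimes>\<^bsub>QT\<^esub> torus_gen p U \<xi> i = \<one>\<^bsub>QT\<^esub>"
    using coset_mult[of "[Pos i]" "[Neg i]"] coset_mult[of "[Neg i]" "[Pos i]"] assms
    by (simp_all add: torus_gen_def)
  then show ?thesis unfolding Units_def using torus_gen_closed[OF assms] y by blast
qed

lemma twist_parallel: "torus_twist p U s (a \<cdot>\<^sub>v k) (b \<cdot>\<^sub>v k) = 1" if "k \<in> carrier_vec p"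
proof -
  have "torus_form p U (a \<cdot>\<^sub>v k) (b \<cdot>\<^sub>v k) = a * b * torus_form p U k k"
    using that by (simp add: torus_form_def sum_distrib_left ac_simps)
  then show ?thesis by (simp add: torus_twist_def form_self)
qed

lemma \<Phi>_gen_nat_pow:
  assumes "i < p"
  shows "\<Phi> (torus_gen p U \<xi> i [^]\<^bsub>QT\<^esub> (n::nat)) = Poly_Mapping.single (int n \<cdot>\<^sub>v unit_vec p i) 1"
proof (induction n)
  case 0
  have "0 \<cdot>\<^sub>v unit_vec p i = (0\<^sub>v p :: int vec)" by auto
  then show ?case using \<Phi>.hom_one by simp
next
  case (Suc n)
  have "\<Phi> (torus_gen p U \<xi> i [^]\<^bsub>QT\<^esub> Suc n)
      = Poly_Mapping.single (int n \<cdot>\<^sub>v unit_vec p i) 1 \<otimes>\<^bsub>W\<^esub> Poly_Mapping.single (1 \<cdot>\<^sub>v unit_vec p i) 1"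
    using Suc \<Phi>.hom_mult torus_gen_closed[OF assms] by (simp add: \<Phi>_gen assms)
  also have "\<dots> = Poly_Mapping.single (int n \<cdot>\<^sub>v unit_vec p i + 1 \<cdot>\<^sub>v unit_vec p i) 1"
    by (simp only: W_mult_single twist_parallel[OF unit_vec_carrier]) simp
  also have "int n \<cdot>\<^sub>v unit_vec p i + 1 \<cdot>\<^sub>v unit_vec p i = (int (Suc n) \<cdot>\<^sub>v unit_vec p i :: int vec)"
    by (auto simp: algebra_simps)
  finally show ?case .
qed

lemma torus_gen_pow_closed: "i < p \<Longrightarrow> torus_gen p U \<xi> i [^]\<^bsub>QT\<^esub> (m::int) \<in> carrier QT"
  unfolding int_pow_def2
  using QT.Units_closed QT.Units_pow_closed[OF torus_gen_unit] QT.Units_inv_closed by presburger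

lemma \<Phi>_gen_pow:
  assumes "i < p"
  shows "\<Phi> (torus_gen p U \<xi> i [^]\<^bsub>QT\<^esub> (m::int)) = Poly_Mapping.single (m \<cdot>\<^sub>v unit_vec p i) 1"
proof (cases "m < 0")
  case False
  then show ?thesis
    using \<Phi>_gen_nat_pow[OF assms, of "nat m"] unfolding int_pow_def2 by (simp del: pow_nat)
next
  case True
  define n where "n = nat (- m)"
  define y where "y = torus_gen p U \<xi> i [^]\<^bsub>QT\<^esub> n"
  have y: "y \<in> Units QT" unfolding y_def by (rule QT.Units_pow_closed[OF torus_gen_unit[OF assms]])
  have "\<Phi> y \<otimes>\<^bsub>W\<^esub> \<Phi> (inv\<^bsub>QT\<^esub> y) = \<one>\<^bsub>W\<^esub>"
    using y QT.Units_r_inv[OF y] \<Phi>.hom_one \<Phi>.hom_mult[of y "inv\<^bsub>QT\<^esub> y"]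
    by (simp only: QT.Units_closed QT.Units_inv_closed)
  moreover have "Poly_Mapping.single (m \<cdot>\<^sub>v unit_vec p i) 1 \<otimes>\<^bsub>W\<^esub> \<Phi> y = \<one>\<^bsub>W\<^esub>"
  proof -
    have "m \<cdot>\<^sub>v unit_vec p i + int n \<cdot>\<^sub>v unit_vec p i = (0\<^sub>v p :: int vec)"
      using True by (auto simp: n_def)
    then show ?thesis
      by (simp only: y_def \<Phi>_gen_nat_pow[OF assms] W_mult_single twist_parallel[OF unit_vec_carrier]) simp
  qed
  ultimately have "Poly_Mapping.single (m \<cdot>\<^sub>v unit_vec p i) 1 = \<Phi> (inv\<^bsub>QT\<^esub> y)"
    using V.twisted.inv_unique[of "Poly_Mapping.single (m \<cdot>\<^sub>v unit_vec p i) 1" "\<Phi> y" "\<Phi> (inv\<^bsub>QT\<^esub> y)"]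
      \<Phi>.hom_closed[OF QT.Units_closed[OF y]] \<Phi>.hom_closed[OF QT.Units_inv_closed[OF y]] by simp
  then show ?thesis using True unfolding int_pow_def2 y_def n_def by (simp del: pow_nat)
qed

lemma foldr_mult_closed:
  "set ys \<subseteq> carrier QT \<Longrightarrow> foldr (\<otimes>\<^bsub>QT\<^esub>) ys \<one>\<^bsub>QT\<^esub> \<in> carrier QT"
  by (induction ys) auto

lemma foldr_mult_snoc:
  "\<lbrakk>set ys \<subseteq> carrier QT; y \<in> carrier QT\<rbrakk>
    \<Longrightarrow> foldr (\<otimes>\<^bsub>QT\<^esub>) (ys @ [y]) \<one>\<^bsub>QT\<^esub> = foldr (\<otimes>\<^bsub>QT\<^esub>) ys \<one>\<^bsub>QT\<^esub> \<otimes>\<^bsub>QT\<^esub> y"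
proof (induction ys)
  case (Cons a ys)
  then have "foldr (\<otimes>\<^bsub>QT\<^esub>) ys \<one>\<^bsub>QT\<^esub> \<in> carrier QT" by (intro foldr_mult_closed) simp
  then show ?case using Cons by (simp add: QT.m_assoc)
qed simp

text \<open>Appending \<open>x\<^sub>n\<close> to the power \<open>k n\<close> on the right contributes the exponents \<open>k i k n U i n\<close> for \<open>i < n\<close>.  This is
exactly what the normalization divides out.\<close>

lemma \<Phi>_ordered_monomial:
  assumes k: "k \<in> carrier_vec p" and "n \<le> p"
  shows "\<Phi> (foldr (\<otimes>\<^bsub>QT\<^esub>) (map (\<lambda>i. torus_gen p U \<xi> i [^]\<^bsub>QT\<^esub> (k $ i)) [0..<n]) \<one>\<^bsub>QT\<^esub>)
    = Poly_Mapping.single (vec p (\<lambda>i. if i < n then k $ i else 0))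
        (s powi (\<Sum>j<n. \<Sum>i<j. k $ i * k $ j * U $$ (i, j)))"
  using assms(2)
proof (induction n)
  case 0
  have "vec p (\<lambda>i. 0) = (0\<^sub>v p :: int vec)" by auto
  then show ?case using \<Phi>.hom_one by simp
next
  case (Suc n)
  let ?y = "\<lambda>i. torus_gen p U \<xi> i [^]\<^bsub>QT\<^esub> (k $ i)"
  let ?h = "\<lambda>n. vec p (\<lambda>i. if i < n then k $ i else 0)"
  let ?S = "\<lambda>n. \<Sum>j<n. \<Sum>i<j. k $ i * k $ j * U $$ (i, j)"
  have n: "n < p" using Suc.prems by simp
  have ys: "set (map ?y [0..<n]) \<subseteq> carrier QT" using n torus_gen_pow_closed by auto
  have "\<Phi> (foldr (\<otimes>\<^bsub>QT\<^esub>) (map ?y [0..<Suc n]) \<one>\<^bsub>QT\<^esub>)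
      = \<Phi> (foldr (\<otimes>\<^bsub>QT\<^esub>) (map ?y [0..<n]) \<one>\<^bsub>QT\<^esub> \<otimes>\<^bsub>QT\<^esub> ?y n)"
    using foldr_mult_snoc[OF ys torus_gen_pow_closed[OF n]] by simp
  also have "\<dots> = Poly_Mapping.single (?h n) (s powi ?S n)
      \<otimes>\<^bsub>W\<^esub> Poly_Mapping.single (k $ n \<cdot>\<^sub>v unit_vec p n) 1"
    using \<Phi>.hom_mult[OF foldr_mult_closed[OF ys] torus_gen_pow_closed[OF n]] Suc.IH n
    by (simp add: \<Phi>_gen_pow)
  also have "\<dots> = Poly_Mapping.single (?h n + k $ n \<cdot>\<^sub>v unit_vec p n)
      (torus_twist p U s (?h n) (k $ n \<cdot>\<^sub>v unit_vec p n) * s powi ?S n)"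
    by (simp add: W_mult_single)
  also have "?h n + k $ n \<cdot>\<^sub>v unit_vec p n = ?h (Suc n)"
    using n by (intro eq_vecI) (auto simp: less_Suc_eq)
  also have "torus_twist p U s (?h n) (k $ n \<cdot>\<^sub>v unit_vec p n) * s powi ?S n = s powi ?S (Suc n)"
  proof -
    have "torus_form p U (?h n) (k $ n \<cdot>\<^sub>v unit_vec p n)
        = (\<Sum>i<p. \<Sum>j<p. if j = n then (if i < n then k $ i else 0) * k $ n * U $$ (i, n) else 0)"
      unfolding torus_form_def using n by (intro sum.cong refl) auto
    also have "\<dots> = (\<Sum>i<p. if i < n then k $ i * k $ n * U $$ (i, n) else 0)"
      using n by (intro sum.cong refl) (simp add: sum.delta)
    also have "\<dots> = (\<Sum>i<n. k $ i * k $ n * U $$ (i, n))"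
      using n by (intro sum.mono_neutral_cong_right) auto
    finally show ?thesis using s_nonzero by (simp add: torus_twist_def power_int_add)
  qed
  finally show ?case .
qed

abbreviation "monomial \<equiv> normalized_monomial p U \<xi> s"

lemma monomial_closed:
  "monomial k \<in> carrier QT"
proof -
  have "set (map (\<lambda>i. torus_gen p U \<xi> i [^]\<^bsub>QT\<^esub> (k $ i)) [0..<p]) \<subseteq> carrier QT"
    using torus_gen_pow_closed by auto
  then show ?thesis unfolding normalized_monomial_def normalized_product_def
    by (intro QT.m_closed torus_const_closed foldr_mult_closed)
qed

lemma \<Phi>_monomial:
  assumes k: "k \<in> carrier_vec p"
  shows "\<Phi> (monomial k) = Poly_Mapping.single k 1"
proof -
  have ys: "set (map (\<lambda>i. torus_gen p U \<xi> i [^]\<^bsub>QT\<^esub> (k $ i)) [0..<p]) \<subseteq> carrier QT"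
    using torus_gen_pow_closed by auto
  have "vec p (\<lambda>i. if i < p then k $ i else 0) = k" using k by (intro eq_vecI) auto
  then show ?thesis
    unfolding normalized_monomial_def normalized_product_def
    using \<Phi>.hom_mult[OF torus_const_closed foldr_mult_closed[OF ys]] k s_nonzero
    by (simp add: \<Phi>_const \<Phi>_ordered_monomial W_mult_single power_int_minus)
qed

lemma \<Phi>_finsum:
  assumes "finite F" "h \<in> F \<rightarrow> carrier QT"
  shows "\<Phi> (finsum QT h F) = (\<Sum>k\<in>F. \<Phi> (h k))"
  using assms
proof (induction F)
  case empty
  then show ?case using \<Phi>.hom_zero by simp
next
  case (insert k F)
  then have h: "h \<in> F \<rightarrow> carrier QT" "h k \<in> carrier QT" by auto
  then show ?case
    using insert \<Phi>.hom_add[OF h(2) QT.finsum_closed[OF h(1)]] by (simp add: QT.finsum_insert)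
qed

lemma term_closed: "torus_const p U \<xi> c \<otimes>\<^bsub>QT\<^esub> monomial k \<in> carrier QT"
  by (intro QT.m_closed torus_const_closed monomial_closed)

lemma \<Phi>_term:
  "k \<in> carrier_vec p \<Longrightarrow> \<Phi> (torus_const p U \<xi> c \<otimes>\<^bsub>QT\<^esub> monomial k) = Poly_Mapping.single k c"
  using \<Phi>.hom_mult[OF torus_const_closed monomial_closed, of c k]
  by (simp add: \<Phi>_const \<Phi>_monomial W_mult_single)

text \<open>The images of the normalized monomials under \<open>\<Phi>\<close> are the monomials of the twisted group algebra, so spans
become conditions on supports.\<close>

lemma monomial_subalgebra_carrier:
  assumes "\<Lambda> \<subseteq> carrier_vec p"
  shows "carrier (monomial_subalgebra p U \<xi> s \<Lambda>) = {X \<in> carrier QT. Poly_Mapping.keys (\<Phi> X) \<subseteq> \<Lambda>}"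
proof -
  let ?t = "\<lambda>c k. torus_const p U \<xi> (c k) \<otimes>\<^bsub>QT\<^esub> monomial k"
  have closed: "?t c \<in> F \<rightarrow> carrier QT" for c F using term_closed by auto
  have \<Phi>_sum: "\<Phi> (finsum QT (?t c) F) = (\<Sum>k\<in>F. Poly_Mapping.single k (c k))"
    if "finite F" "F \<subseteq> \<Lambda>" for c F
    unfolding \<Phi>_finsum[OF that(1) closed] using that(2) assms by (intro sum.cong refl \<Phi>_term) auto
  have expand: "\<exists>F c. X = finsum QT (?t c) F \<and> finite F \<and> F \<subseteq> \<Lambda>"
    if X: "X \<in> carrier QT" "Poly_Mapping.keys (\<Phi> X) \<subseteq> \<Lambda>" for X
  proof (intro exI conjI)
    let ?F = "Poly_Mapping.keys (\<Phi> X)" and ?c = "Poly_Mapping.lookup (\<Phi> X)"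
    have "\<Phi> X = \<Phi> (finsum QT (?t ?c) ?F)"
      using \<Phi>_sum[of ?F ?c] X(2) by (simp add: sum_single_lookup)
    then show "X = finsum QT (?t ?c) ?F"
      using inj_onD[OF \<Phi>_inj _ X(1) QT.finsum_closed[OF closed]] by blast
  qed (use X in auto)
  have keys: "Poly_Mapping.keys (\<Phi> (finsum QT (?t c) F)) \<subseteq> \<Lambda>" if "finite F" "F \<subseteq> \<Lambda>" for c F
    unfolding \<Phi>_sum[OF that] using that(2) by (intro keys_sum_subsetI) auto
  have carrier: "carrier (monomial_subalgebra p U \<xi> s \<Lambda>)
      = {finsum QT (?t c) F | F c. finite F \<and> F \<subseteq> \<Lambda>}"
    by (simp add: monomial_subalgebra_def)
  show ?thesis
  proof (intro Set.set_eqI iffI)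
    fix X assume "X \<in> carrier (monomial_subalgebra p U \<xi> s \<Lambda>)"
    then obtain F c where "X = finsum QT (?t c) F" "finite F" "F \<subseteq> \<Lambda>"
      unfolding carrier by (elim CollectE exE conjE)
    then show "X \<in> {X \<in> carrier QT. Poly_Mapping.keys (\<Phi> X) \<subseteq> \<Lambda>}"
      using QT.finsum_closed[OF closed] keys by simp
  next
    fix X assume "X \<in> {X \<in> carrier QT. Poly_Mapping.keys (\<Phi> X) \<subseteq> \<Lambda>}"
    then show "X \<in> carrier (monomial_subalgebra p U \<xi> s \<Lambda>)"
      unfolding carrier mem_Collect_eq by (elim conjE) (rule expand)
  qed
qed

end

section \<open>Monomial subalgebras\<close>

lemma noncomm_domain_pullback:
  assumes R: "ring R" and S: "noncomm_domain S" and h: "h \<in> Ring.ring_hom R S" "inj_on h (carrier R)"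
  shows "noncomm_domain R"
proof -
  interpret R: ring R by (rule R)
  interpret S: ring S using S by (simp add: noncomm_domain_def)
  interpret h: ring_hom_ring R S h by (rule ring_hom_ringI2[OF R S.ring_axioms h(1)])
  have zero: "a = \<zero>\<^bsub>R\<^esub>" if "a \<in> carrier R" "h a = \<zero>\<^bsub>S\<^esub>" for a
    using inj_onD[OF h(2), of a "\<zero>\<^bsub>R\<^esub>"] that h.hom_zero by simp
  show ?thesis unfolding noncomm_domain_def
  proof (intro conjI ballI impI)
    show "\<one>\<^bsub>R\<^esub> \<noteq> \<zero>\<^bsub>R\<^esub>"
    proof
      assume "\<one>\<^bsub>R\<^esub> = \<zero>\<^bsub>R\<^esub>"
      then have "h \<one>\<^bsub>R\<^esub> = h \<zero>\<^bsub>R\<^esub>" by (rule arg_cong)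
      then show False using S unfolding h.hom_one h.hom_zero noncomm_domain_def by blast
    qed
    fix a b assume ab: "a \<in> carrier R" "b \<in> carrier R" "a \<otimes>\<^bsub>R\<^esub> b = \<zero>\<^bsub>R\<^esub>"
    have "h a \<otimes>\<^bsub>S\<^esub> h b = \<zero>\<^bsub>S\<^esub>" using h.hom_mult[OF ab(1,2)] ab(3) by simp
    then have "h a = \<zero>\<^bsub>S\<^esub> \<or> h b = \<zero>\<^bsub>S\<^esub>"
      using S h.hom_closed ab(1,2) unfolding noncomm_domain_def by blast
    then show "a = \<zero>\<^bsub>R\<^esub> \<or> b = \<zero>\<^bsub>R\<^esub>" using zero ab(1,2) by blast
  qed (rule R)
qed

text \<open>Stated for isomorphisms, since central elements must be carried to central elements.\<close>

lemma finite_over_center_iso: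
  assumes R: "ring R" and S: "ring S" and h: "h \<in> ring_iso R S" and fin: "finite_over_center R"
  shows "finite_over_center S"
proof -
  interpret R: ring R by (rule R)
  interpret S: ring S by (rule S)
  have hom: "h \<in> Ring.ring_hom R S" and bij: "bij_betw h (carrier R) (carrier S)"
    using h by (auto simp: ring_iso_def)
  interpret h: ring_hom_ring R S h by (rule ring_hom_ringI2[OF R S hom])
  have inj: "inj_on h (carrier R)" and surj: "h ` carrier R = carrier S"
    using bij by (auto simp: bij_betw_def)
  have center: "h z \<in> carrier (center S)" if z: "z \<in> carrier (center R)" for z
    unfolding mem_center_iff
  proof (intro conjI ballI)
    show "h z \<in> carrier S" using center_in_carrier[OF z] by simp
    fix b assume "b \<in> carrier S"
    then obtain a where a: "a \<in> carrier R" "b = h a" using surj by blast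
    show "h z \<otimes>\<^bsub>S\<^esub> b = b \<otimes>\<^bsub>S\<^esub> h z"
      using h.hom_mult[OF center_in_carrier[OF z] a(1)] h.hom_mult[OF a(1) center_in_carrier[OF z]]
        center_commutes[OF z a(1)] a(2) by simp
  qed
  have hom_finsum: "h (finsum R f F) = finsum S (\<lambda>i. h (f i)) F"
    if "finite F" "f \<in> F \<rightarrow> carrier R" for f F
    using that
  proof (induction F)
    case (insert x F)
    then have f: "f \<in> F \<rightarrow> carrier R" "f x \<in> carrier R" by auto
    have "h (f i) \<in> carrier S" if "i \<in> F" for i by (rule h.hom_closed[OF funcset_mem[OF f(1) that]])
    then have "(\<lambda>i. h (f i)) \<in> F \<rightarrow> carrier S" by (rule Pi_I)
    then show ?case using insert f h.hom_add[OF f(2) R.finsum_closed[OF f(1)]] by simp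
  qed simp
  obtain X where X: "finite X" "X \<subseteq> carrier R"
    "\<And>a. a \<in> carrier R \<Longrightarrow> \<exists>c\<in>X \<rightarrow> carrier (center R). a = (\<Oplus>\<^bsub>R\<^esub>x\<in>X. c x \<otimes>\<^bsub>R\<^esub> x)"
    using fin unfolding finite_over_center_def by blast
  have injX: "inj_on h X" using inj X(2) by (rule inj_on_subset)
  show ?thesis unfolding finite_over_center_def
  proof (intro exI[of _ "h ` X"] conjI ballI)
    show "finite (h ` X)" "h ` X \<subseteq> carrier S" using X(1,2) surj by auto
    fix b assume "b \<in> carrier S"
    then obtain a where a: "a \<in> carrier R" "b = h a" using surj by blast
    then obtain c where c: "c \<in> X \<rightarrow> carrier (center R)" "a = (\<Oplus>\<^bsub>R\<^esub>x\<in>X. c x \<otimes>\<^bsub>R\<^esub> x)"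
      using X(3) by blast
    have cX: "c x \<in> carrier R" "x \<in> carrier R" if "x \<in> X" for x
      using center_in_carrier[of "c x" R] c(1) X(2) that by auto
    define d where "d y = h (c (inv_into X h y))" for y
    have "b = (\<Oplus>\<^bsub>S\<^esub>x\<in>X. h (c x \<otimes>\<^bsub>R\<^esub> x))"
      unfolding a(2) c(2) using X(1) cX by (intro hom_finsum) auto
    also have "\<dots> = (\<Oplus>\<^bsub>S\<^esub>x\<in>X. d (h x) \<otimes>\<^bsub>S\<^esub> h x)"
      using cX by (intro S.finsum_cong') (auto simp: d_def inv_into_f_f[OF injX])
    also have "\<dots> = (\<Oplus>\<^bsub>S\<^esub>y\<in>h ` X. d y \<otimes>\<^bsub>S\<^esub> y)"
      using cX by (intro S.finsum_reindex[symmetric] injX) (auto simp: d_def inv_into_f_f[OF injX])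
    finally have "b = (\<Oplus>\<^bsub>S\<^esub>y\<in>h ` X. d y \<otimes>\<^bsub>S\<^esub> y)" .
    moreover have "h (c x) \<in> carrier (center S)" if "x \<in> X" for x
      by (rule center[OF funcset_mem[OF c(1) that]])
    then have "d \<in> h ` X \<rightarrow> carrier (center S)" by (auto simp: d_def inv_into_f_f[OF injX])
    ultimately show "\<exists>d\<in>h ` X \<rightarrow> carrier (center S). b = (\<Oplus>\<^bsub>S\<^esub>y\<in>h ` X. d y \<otimes>\<^bsub>S\<^esub> y)" by blast
  qed
qed

context normalized_quantum_torus
begin

context
  fixes \<Lambda> :: "int vec set"
  assumes \<Lambda>: "submonoid \<Lambda> (monoid_vec TYPE(int) p)"
begin

abbreviation "A \<equiv> monomial_subalgebra p U \<xi> s \<Lambda>"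
abbreviation "W\<Lambda> \<equiv> twisted_algebra (exponent_monoid p \<Lambda>) (torus_twist p U s)"

interpretation L: ordered_twisted_monoid "exponent_monoid p \<Lambda>" "torus_twist p U s" "vec_less p (\<lambda>_. 0)"
  by (rule torus_ordered_twisted_monoid[OF \<Lambda> s_nonzero]) simp

lemma exponents_subset: "\<Lambda> \<subseteq> carrier_vec p"
  using submonoid.subset[OF \<Lambda>] by (simp add: monoid_vec_simps)

lemma W\<Lambda>_mult: "f \<otimes>\<^bsub>W\<Lambda>\<^esub> g = f \<otimes>\<^bsub>W\<^esub> g"
  by (simp add: twisted_algebra_def)

lemma A_eq: "A = QT\<lparr>carrier := carrier A\<rparr>"
  by (simp add: monomial_subalgebra_def)

lemma A_carrier_iff: "X \<in> carrier A \<longleftrightarrow> X \<in> carrier QT \<and> \<Phi> X \<in> carrier W\<Lambda>"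
  unfolding monomial_subalgebra_carrier[OF exponents_subset] by simp

lemma A_simps:
  "X \<otimes>\<^bsub>A\<^esub> Y = X \<otimes>\<^bsub>QT\<^esub> Y" "X \<oplus>\<^bsub>A\<^esub> Y = X \<oplus>\<^bsub>QT\<^esub> Y" "\<one>\<^bsub>A\<^esub> = \<one>\<^bsub>QT\<^esub>" "\<zero>\<^bsub>A\<^esub> = \<zero>\<^bsub>QT\<^esub>"
  by (simp_all add: monomial_subalgebra_def)

lemma A_ring: "ring A"
proof -
  have "subring (carrier A) QT"
  proof (rule QT.subringI)
    show "carrier A \<subseteq> carrier QT" using A_carrier_iff by blast
    show "\<one>\<^bsub>QT\<^esub> \<in> carrier A"
      unfolding A_carrier_iff \<Phi>.hom_one using L.twisted.one_closed by simp
  next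
    fix X assume X: "X \<in> carrier A"
    have "\<Phi> (\<ominus>\<^bsub>QT\<^esub> X) = - \<Phi> X"
      using X \<Phi>.hom_a_inv[of X] V.twisted_a_inv[OF \<Phi>.hom_closed[of X]] unfolding A_carrier_iff by simp
    then show "\<ominus>\<^bsub>QT\<^esub> X \<in> carrier A" using X unfolding A_carrier_iff by (simp add: keys_uminus)
  next
    fix X Y assume XY: "X \<in> carrier A" "Y \<in> carrier A"
    then have "X \<in> carrier QT" "Y \<in> carrier QT" unfolding A_carrier_iff by simp_all
    then show "X \<otimes>\<^bsub>QT\<^esub> Y \<in> carrier A" "X \<oplus>\<^bsub>QT\<^esub> Y \<in> carrier A"
      using XY L.twisted.m_closed[of "\<Phi> X" "\<Phi> Y"] L.twisted.a_closed[of "\<Phi> X" "\<Phi> Y"]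
        \<Phi>.hom_mult[of X Y] \<Phi>.hom_add[of X Y]
      unfolding A_carrier_iff W\<Lambda>_mult by simp_all
  qed
  then have "ring (QT\<lparr>carrier := carrier A\<rparr>)" by (rule QT.subring_is_ring)
  then show ?thesis by (simp only: A_eq[symmetric])
qed

lemma \<Phi>_surj:
  assumes "f \<in> carrier W\<Lambda>" shows "\<exists>X\<in>carrier A. \<Phi> X = f"
proof -
  let ?t = "\<lambda>k. torus_const p U \<xi> (Poly_Mapping.lookup f k) \<otimes>\<^bsub>QT\<^esub> monomial k"
  have closed: "?t \<in> Poly_Mapping.keys f \<rightarrow> carrier QT" using term_closed by blast
  have keys: "k \<in> carrier_vec p" if "k \<in> Poly_Mapping.keys f" for k
    using assms exponents_subset that by auto
  have eq: "\<Phi> (finsum QT ?t (Poly_Mapping.keys f)) = f"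
    unfolding \<Phi>_finsum[OF finite_keys closed]
    using keys by (simp add: \<Phi>_term sum_single_lookup)
  show ?thesis
  proof (rule bexI, rule eq)
    show "finsum QT ?t (Poly_Mapping.keys f) \<in> carrier A"
      unfolding A_carrier_iff eq using QT.finsum_closed[OF closed] assms by (rule conjI)
  qed
qed

lemma \<Phi>_iso: "\<Phi> \<in> ring_iso A W\<Lambda>"
proof (rule ring_iso_memI)
  fix X Y assume "X \<in> carrier A" "Y \<in> carrier A"
  then show "\<Phi> (X \<otimes>\<^bsub>A\<^esub> Y) = \<Phi> X \<otimes>\<^bsub>W\<Lambda>\<^esub> \<Phi> Y" "\<Phi> (X \<oplus>\<^bsub>A\<^esub> Y) = \<Phi> X \<oplus>\<^bsub>W\<Lambda>\<^esub> \<Phi> Y"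
    using \<Phi>.hom_mult[of X Y] \<Phi>.hom_add[of X Y]
    unfolding A_carrier_iff W\<Lambda>_mult A_simps by simp_all
next
  show "bij_betw \<Phi> (carrier A) (carrier W\<Lambda>)"
    unfolding bij_betw_def
  proof (intro conjI)
    show "inj_on \<Phi> (carrier A)" using \<Phi>_inj by (rule inj_on_subset) (use A_carrier_iff in blast)
    show "\<Phi> ` carrier A = carrier W\<Lambda>" using \<Phi>_surj A_carrier_iff by blast
  qed
next
  show "\<Phi> \<one>\<^bsub>A\<^esub> = \<one>\<^bsub>W\<Lambda>\<^esub>" unfolding A_simps \<Phi>.hom_one by simp
qed (use A_carrier_iff in blast)

text \<open>The commutator of \<open>X\<^bsup>N q\<^esup>\<close> with any monomial is a power of \<open>\<xi>\<^sup>N = 1\<close>.\<close>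

lemma central_monomial:
  assumes N: "\<xi> ^ N = 1" and q: "q \<in> \<Lambda>" "int N \<cdot>\<^sub>v q \<in> \<Lambda>"
  shows "Poly_Mapping.single (int N \<cdot>\<^sub>v q) a \<in> carrier (center W\<Lambda>)"
  unfolding mem_center_iff
proof (intro conjI ballI)
  show z: "Poly_Mapping.single (int N \<cdot>\<^sub>v q) a \<in> carrier W\<Lambda>" using q by simp
  have sN: "s powi (2 * int N) = 1"
    using N by (simp add: s[symmetric] power_int_mult)
  have twist: "torus_twist p U s (int N \<cdot>\<^sub>v q) l = torus_twist p U s l (int N \<cdot>\<^sub>v q)" if l: "l \<in> \<Lambda>" for l
  proof -
    have form: "torus_form p U (int N \<cdot>\<^sub>v q) l = int N * torus_form p U q l"
      using q exponents_subset by (auto simp: torus_form_def sum_distrib_left ac_simps intro!: sum.cong)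
    have "s powi (int N * torus_form p U q l) = s powi (2 * int N * torus_form p U q l + - (int N * torus_form p U q l))"
      by simp
    also have "\<dots> = s powi (- (int N * torus_form p U q l))"
      using s_nonzero sN by (simp only: power_int_add[OF disjI1[OF s_nonzero]] power_int_mult) simp
    finally show ?thesis
      unfolding torus_twist_def form_antisym[of l "int N \<cdot>\<^sub>v q"] form .
  qed
  fix f assume "f \<in> carrier W\<Lambda>"
  then have "Poly_Mapping.keys f \<subseteq> \<Lambda>" by simp
  then show "Poly_Mapping.single (int N \<cdot>\<^sub>v q) a \<otimes>\<^bsub>W\<Lambda>\<^esub> f = f \<otimes>\<^bsub>W\<Lambda>\<^esub> Poly_Mapping.single (int N \<cdot>\<^sub>v q) a"
  proof (induction f rule: poly_mapping_additive_induct)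
    case (single l c)
    then have "int N \<cdot>\<^sub>v q + l = l + int N \<cdot>\<^sub>v q"
      using q exponents_subset by (intro comm_add_vec[of _ p]) auto
    then show ?case using twist[OF single] by (simp add: twisted_mult_single mult.commute)
  next
    case (add f g)
    then show ?case by (simp add: twisted_mult_add_left twisted_mult_add_right)
  qed (use q in blast)
qed

text \<open>Reducing the coefficients of a combination of generators modulo \<open>N\<close> writes each exponent as
\<open>N q + r\<close> with finitely many possible \<open>r\<close>, and \<open>X\<^bsup>N q\<^esup>\<close> is central.\<close>

lemma finite_over_center_W\<Lambda>:
  assumes N: "\<xi> ^ N = 1" "N > 0"
    and fg: "finitely_generated_submonoid (monoid_vec TYPE(int) p) \<Lambda>"
  shows "finite_over_center W\<Lambda>"
proof -
  obtain X where X: "finite X" "X \<subseteq> \<Lambda>" "\<Lambda> = nat_combinations p X"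
    using finitely_generated_as_nat_combinations[OF fg \<Lambda>] by blast
  define comb :: "(int vec \<Rightarrow> nat) \<Rightarrow> int vec" where "comb c = vec p (\<lambda>i. \<Sum>g\<in>X. int (c g) * g $ i)" for c
  define T :: "(int vec \<Rightarrow>\<^sub>0 complex) set"
    where "T = (\<lambda>c. Poly_Mapping.single (comb c) 1) ` (X \<rightarrow>\<^sub>E {..<N})"
  have comb_in: "comb c \<in> \<Lambda>" for c
    unfolding X(3) nat_combinations_def comb_def by auto
  have T: "finite T" "T \<subseteq> carrier W\<Lambda>"
    unfolding T_def using X(1) comb_in by (auto intro: finite_PiE)
  have zero_center: "0 \<in> carrier (center W\<Lambda>)"
    unfolding mem_center_iff by (simp add: twisted_algebra_def)
  have add_center: "y + z \<in> carrier (center W\<Lambda>)"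
    if "y \<in> carrier (center W\<Lambda>)" "z \<in> carrier (center W\<Lambda>)" for y z
    unfolding mem_center_iff
  proof (intro conjI ballI)
    show "y + z \<in> carrier W\<Lambda>"
      using L.twisted.a_closed[OF center_in_carrier[OF that(1)] center_in_carrier[OF that(2)]] by simp
    fix f assume f: "f \<in> carrier W\<Lambda>"
    show "(y + z) \<otimes>\<^bsub>W\<Lambda>\<^esub> f = f \<otimes>\<^bsub>W\<Lambda>\<^esub> (y + z)"
      unfolding twisted_mult_add_left twisted_mult_add_right
      using center_commutes[OF that(1) f] center_commutes[OF that(2) f] by simp
  qed
  have combination: "(\<lambda>t. c t \<otimes>\<^bsub>W\<Lambda>\<^esub> t) \<in> T \<rightarrow> carrier W\<Lambda>"
    if "c \<in> T \<rightarrow> carrier (center W\<Lambda>)" for c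
  proof (rule Pi_I)
    fix t assume t: "t \<in> T"
    show "c t \<otimes>\<^bsub>W\<Lambda>\<^esub> t \<in> carrier W\<Lambda>"
      by (rule L.twisted.m_closed[OF center_in_carrier[OF funcset_mem[OF that t]] subsetD[OF T(2) t]])
  qed
  have "\<exists>c\<in>T \<rightarrow> carrier (center W\<Lambda>). f = (\<Oplus>\<^bsub>W\<Lambda>\<^esub>t\<in>T. c t \<otimes>\<^bsub>W\<Lambda>\<^esub> t)"
    if "Poly_Mapping.keys f \<subseteq> \<Lambda>" for f
    using that
  proof (induction f rule: poly_mapping_additive_induct)
    case (single k a)
    then obtain e :: "int vec \<Rightarrow> nat" where e: "k \<in> carrier_vec p"
      "\<And>i. i < p \<Longrightarrow> k $ i = (\<Sum>g\<in>X. int (e g) * g $ i)"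
      unfolding X(3) nat_combinations_def by blast
    define r where "r = comb (\<lambda>g. e g mod N)"
    define q where "q = comb (\<lambda>g. e g div N)"
    have k: "k = int N \<cdot>\<^sub>v q + r"
    proof (rule eq_vecI)
      fix i assume "i < dim_vec (int N \<cdot>\<^sub>v q + r)"
      then have i: "i < p" by (simp add: r_def comb_def)
      have "(int N \<cdot>\<^sub>v q + r) $ i = (\<Sum>g\<in>X. int N * (int (e g div N) * g $ i) + int (e g mod N) * g $ i)"
        using i by (simp add: q_def r_def comb_def sum_distrib_left sum.distrib)
      also have "\<dots> = (\<Sum>g\<in>X. int (e g) * g $ i)"
      proof (intro sum.cong refl)
        fix g
        have "int N * int (e g div N) + int (e g mod N) = int (e g)"
          by (metis mult_div_mod_eq of_nat_add of_nat_mult)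
        then show "int N * (int (e g div N) * g $ i) + int (e g mod N) * g $ i = int (e g) * g $ i"
          by (metis distrib_right mult.assoc)
      qed
      finally show "k $ i = (int N \<cdot>\<^sub>v q + r) $ i" using e(2)[OF i] by simp
    qed (use e(1) in \<open>simp add: r_def comb_def\<close>)
    have q: "q \<in> \<Lambda>" "int N \<cdot>\<^sub>v q \<in> \<Lambda>"
      using comb_in smult_in_submonoid[OF \<Lambda>] by (simp_all add: q_def)
    have r: "Poly_Mapping.single r 1 \<in> T"
    proof -
      have "r = comb (restrict (\<lambda>g. e g mod N) X)"
        unfolding r_def comb_def by (intro eq_vecI) (auto intro!: sum.cong)
      moreover have "restrict (\<lambda>g. e g mod N) X \<in> X \<rightarrow>\<^sub>E {..<N}" using N(2) by auto
      ultimately show ?thesis unfolding T_def by blast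
    qed
    (* splitting the coefficients of k modulo N puts k into a central part N q and one of the
       finitely many remainders r *)
    define z where "z = Poly_Mapping.single (int N \<cdot>\<^sub>v q) (a / torus_twist p U s (int N \<cdot>\<^sub>v q) r)"
    have z: "z \<in> carrier (center W\<Lambda>)" unfolding z_def by (rule central_monomial[OF N(1) q])
    have zr: "z \<otimes>\<^bsub>W\<Lambda>\<^esub> Poly_Mapping.single r 1 = Poly_Mapping.single k a"
      using torus_twist_nonzero[OF s_nonzero] by (simp add: z_def twisted_mult_single k)
    define c where "c t = (if t = Poly_Mapping.single r 1 then z else 0)" for t :: "int vec \<Rightarrow>\<^sub>0 complex"
    have c: "c \<in> T \<rightarrow> carrier (center W\<Lambda>)" using z zero_center by (auto simp: c_def)
    have "(\<Oplus>\<^bsub>W\<Lambda>\<^esub>t\<in>T. c t \<otimes>\<^bsub>W\<Lambda>\<^esub> t) = (\<Sum>t\<in>T. c t \<otimes>\<^bsub>W\<Lambda>\<^esub> t)"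
      by (rule L.twisted_finsum[OF combination[OF c]])
    also have "\<dots> = (\<Sum>t\<in>T. if t = Poly_Mapping.single r 1 then z \<otimes>\<^bsub>W\<Lambda>\<^esub> t else 0)"
      by (intro sum.cong refl) (simp add: c_def twisted_algebra_def)
    also have "\<dots> = Poly_Mapping.single k a" using T(1) r zr by (simp add: sum.delta)
    finally show ?case by (intro bexI[OF _ c]) (rule sym)
  next
    case (add f g)
    then obtain c d where c: "c \<in> T \<rightarrow> carrier (center W\<Lambda>)" "f = (\<Oplus>\<^bsub>W\<Lambda>\<^esub>t\<in>T. c t \<otimes>\<^bsub>W\<Lambda>\<^esub> t)"
      and d: "d \<in> T \<rightarrow> carrier (center W\<Lambda>)" "g = (\<Oplus>\<^bsub>W\<Lambda>\<^esub>t\<in>T. d t \<otimes>\<^bsub>W\<Lambda>\<^esub> t)" by blast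
    have cd: "(\<lambda>t. c t + d t) \<in> T \<rightarrow> carrier (center W\<Lambda>)"
    proof (rule Pi_I)
      fix t assume t: "t \<in> T"
      show "c t + d t \<in> carrier (center W\<Lambda>)"
        by (rule add_center[OF funcset_mem[OF c(1) t] funcset_mem[OF d(1) t]])
    qed
    have "f + g = (\<Oplus>\<^bsub>W\<Lambda>\<^esub>t\<in>T. (c t + d t) \<otimes>\<^bsub>W\<Lambda>\<^esub> t)"
      unfolding c(2) d(2) L.twisted_finsum[OF combination[OF c(1)]]
        L.twisted_finsum[OF combination[OF d(1)]] L.twisted_finsum[OF combination[OF cd]]
      by (simp add: twisted_mult_add_left sum.distrib)
    then show ?case by (rule bexI[OF _ cd])
  qed (use comb_in in blast)
  then show ?thesis unfolding finite_over_center_def using T by (intro exI[of _ T]) auto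
qed

theorem monomial_subalgebra_maximal_order:
  assumes N: "\<xi> ^ N = 1" "N > 0"
    and fg: "finitely_generated_submonoid (monoid_vec TYPE(int) p) \<Lambda>"
    and prim: "primitive_submonoid \<Lambda>"
  shows "maximal_order A"
proof (rule maximal_order_criterion)
  have hom: "\<Phi> \<in> Ring.ring_hom A W\<Lambda>" and bij: "bij_betw \<Phi> (carrier A) (carrier W\<Lambda>)"
    using \<Phi>_iso by (simp_all add: ring_iso_def)
  have inj: "inj_on \<Phi> (carrier A)" using bij by (simp add: bij_betw_def)
  interpret A: ring A by (rule A_ring)
  interpret h: ring_hom_ring A W\<Lambda> \<Phi> by (rule ring_hom_ringI2[OF A_ring L.twisted_algebra_ring hom])
  show "noncomm_domain A"
    by (rule noncomm_domain_pullback[OF A_ring L.twisted_noncomm_domain hom inj])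
  show "finite_over_center A"
    by (rule finite_over_center_iso[OF L.twisted_algebra_ring A_ring ring_iso_set_sym[OF A_ring \<Phi>_iso]
          finite_over_center_W\<Lambda>[OF N fg]])
  have hom_minus: "\<Phi> (a \<ominus>\<^bsub>A\<^esub> b) = \<Phi> a \<ominus>\<^bsub>W\<Lambda>\<^esub> \<Phi> b" if "a \<in> carrier A" "b \<in> carrier A" for a b
    unfolding A.minus_eq L.twisted.minus_eq h.hom_add[OF that(1) A.a_inv_closed[OF that(2)]]
      h.hom_a_inv[OF that(2)] ..
  have hom_pow: "\<Phi> (a [^]\<^bsub>A\<^esub> n) = \<Phi> a [^]\<^bsub>W\<Lambda>\<^esub> n" if a: "a \<in> carrier A" for a and n :: nat
  proof (induction n)
    case (Suc n)
    show ?case unfolding A.nat_pow_Suc L.twisted.nat_pow_Suc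
        h.hom_mult[OF A.nat_pow_closed[OF a] a] Suc ..
  qed (simp only: A.nat_pow_0 L.twisted.nat_pow_0 h.hom_one)
  fix z P a
  assume z: "z \<in> carrier (center A)" "z \<noteq> \<zero>\<^bsub>A\<^esub>" and P: "P \<subseteq> carrier A"
    and minus: "\<And>a b. a \<in> P \<Longrightarrow> b \<in> P \<Longrightarrow> a \<ominus>\<^bsub>A\<^esub> b \<in> P"
    and mult: "\<And>c. c \<in> carrier A \<Longrightarrow> c \<otimes>\<^bsub>A\<^esub> z \<in> P"
    and pow: "\<And>a n. a \<in> P \<Longrightarrow> \<exists>w\<in>carrier A. a [^]\<^bsub>A\<^esub> (n::nat) \<otimes>\<^bsub>A\<^esub> z = w \<otimes>\<^bsub>A\<^esub> z [^]\<^bsub>A\<^esub> n"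
    and a: "a \<in> P"
  have zA: "z \<in> carrier A" by (rule center_in_carrier[OF z(1)])
  have "\<exists>c\<in>carrier W\<Lambda>. \<Phi> a = c \<otimes>\<^bsub>W\<Lambda>\<^esub> \<Phi> z"
  proof (rule torus_division[OF fg \<Lambda> prim s_nonzero, where P = "\<Phi> ` P"])
    show "\<Phi> z \<in> carrier W\<Lambda>" by (rule h.hom_closed[OF zA])
    show "\<Phi> z \<noteq> \<zero>\<^bsub>W\<Lambda>\<^esub>"
    proof
      assume "\<Phi> z = \<zero>\<^bsub>W\<Lambda>\<^esub>"
      then have "\<Phi> z = \<Phi> \<zero>\<^bsub>A\<^esub>" unfolding h.hom_zero .
      then show False using inj_onD[OF inj _ zA A.zero_closed] z(2) by blast
    qed
    show "\<Phi> ` P \<subseteq> carrier W\<Lambda>" using P h.hom_closed by blast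
    show "\<Phi> a \<in> \<Phi> ` P" using a by (rule imageI)
  next
    fix f g assume "f \<in> \<Phi> ` P" "g \<in> \<Phi> ` P"
    then obtain b c where bc: "b \<in> P" "c \<in> P" "f = \<Phi> b" "g = \<Phi> c" by (elim imageE)
    have "f \<ominus>\<^bsub>W\<Lambda>\<^esub> g = \<Phi> (b \<ominus>\<^bsub>A\<^esub> c)"
      unfolding bc(3,4) by (rule hom_minus[symmetric]) (rule subsetD[OF P bc(1)], rule subsetD[OF P bc(2)])
    then show "f \<ominus>\<^bsub>W\<Lambda>\<^esub> g \<in> \<Phi> ` P" using minus[OF bc(1,2)] by (metis imageI)
  next
    fix f assume "f \<in> carrier W\<Lambda>"
    then obtain c where c: "c \<in> carrier A" "\<Phi> c = f" using \<Phi>_surj by blast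
    have "f \<otimes>\<^bsub>W\<Lambda>\<^esub> \<Phi> z = \<Phi> (c \<otimes>\<^bsub>A\<^esub> z)" unfolding h.hom_mult[OF c(1) zA] c(2) ..
    then show "f \<otimes>\<^bsub>W\<Lambda>\<^esub> \<Phi> z \<in> \<Phi> ` P" using mult[OF c(1)] by (metis imageI)
  next
    fix f and n :: nat assume "f \<in> \<Phi> ` P"
    then obtain b where b: "b \<in> P" "f = \<Phi> b" by (elim imageE)
    have bA: "b \<in> carrier A" by (rule subsetD[OF P b(1)])
    obtain w where w: "w \<in> carrier A" "b [^]\<^bsub>A\<^esub> n \<otimes>\<^bsub>A\<^esub> z = w \<otimes>\<^bsub>A\<^esub> z [^]\<^bsub>A\<^esub> n" using pow[OF b(1)] by metis
    have "f [^]\<^bsub>W\<Lambda>\<^esub> n \<otimes>\<^bsub>W\<Lambda>\<^esub> \<Phi> z = \<Phi> (b [^]\<^bsub>A\<^esub> n \<otimes>\<^bsub>A\<^esub> z)"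
      unfolding b(2) h.hom_mult[OF A.nat_pow_closed[OF bA] zA] hom_pow[OF bA] ..
    also have "\<dots> = \<Phi> w \<otimes>\<^bsub>W\<Lambda>\<^esub> \<Phi> z [^]\<^bsub>W\<Lambda>\<^esub> n"
      unfolding w(2) h.hom_mult[OF w(1) A.nat_pow_closed[OF zA]] hom_pow[OF zA] ..
    finally show "\<exists>w\<in>carrier W\<Lambda>. f [^]\<^bsub>W\<Lambda>\<^esub> n \<otimes>\<^bsub>W\<Lambda>\<^esub> \<Phi> z = w \<otimes>\<^bsub>W\<Lambda>\<^esub> \<Phi> z [^]\<^bsub>W\<Lambda>\<^esub> n"
      using h.hom_closed[OF w(1)] by metis
  qed
  then obtain f where f: "f \<in> carrier W\<Lambda>" "\<Phi> a = f \<otimes>\<^bsub>W\<Lambda>\<^esub> \<Phi> z" by (elim bexE)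
  obtain c where c: "c \<in> carrier A" "\<Phi> c = f" using \<Phi>_surj[OF f(1)] by (elim bexE)
  have "\<Phi> a = \<Phi> (c \<otimes>\<^bsub>A\<^esub> z)" unfolding h.hom_mult[OF c(1) zA] c(2) f(2) ..
  then have "a = c \<otimes>\<^bsub>A\<^esub> z"
    by (rule inj_onD[OF inj _ subsetD[OF P a] A.m_closed[OF c(1) zA]])
  then show "\<exists>c\<in>carrier A. a = c \<otimes>\<^bsub>A\<^esub> z" using c(1) by blast
qed

end

end

theorem proposition1p3p7:
  fixes p :: nat and U :: "int mat" and \<xi> s :: complex and \<Lambda> :: "int vec set"
  assumes "U \<in> carrier_mat p p" and "transpose_mat U = - U"
    and "\<xi> \<noteq> 0" and "\<exists>n::nat. n > 0 \<and> \<xi> ^ n = 1" and "s\<^sup>2 = \<xi>"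
    and "submonoid \<Lambda> (monoid_vec TYPE(int) p)"
    and "finitely_generated_submonoid (monoid_vec TYPE(int) p) \<Lambda>"
    and "subgroup_rank p (group_completion \<Lambda>) = p"
    and "primitive_submonoid \<Lambda>"
  shows "maximal_order (monomial_subalgebra p U \<xi> s \<Lambda>)"
proof -
  interpret normalized_quantum_torus p U \<xi> s
    by unfold_locales (use assms in auto)
  obtain N where "N > 0" "\<xi> ^ N = 1" using assms(4) by blast
  then show ?thesis using monomial_subalgebra_maximal_order assms(6,7,9) by blast
qed

end
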